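(* Let $\alpha,\beta>-1$. Let $r\ge 1$ be an integer and let $f:[-1,1]\to\mathbb{R}$ be a function whose derivative $f^{(r-1)}$ is absolutely continuous on $[-1,1]$ and satisfies $f^{(r-1)}(t)=f^{(r-1)}(-1)+\int_{-1}^t g(y)\,dy$ for all $t\in[-1,1]$, for some absolutely integrable $g$ of bounded variation on $[-1,1]$. For each $n$ let $E_n[f]=f-L[f]$, where $L[f]$ is the polynomial of degree at most $n$ interpolating $f$ at the $n+1$ roots of $(1-t)P_n^{(\alpha,\beta)}(t)$. Then for $n\ge r+1$, $$\|E_n[f]\|_\infty=n^{-r}\cdot\begin{cases} O\left(n^{-\min\{0,\alpha+\frac12,\alpha-\beta\}}\right),&-1<\alpha\le\frac12,\\ O\left(n^{-\min\{0,\frac12-\beta,\frac52-\alpha,\alpha-\beta\}}\right),&\alpha>\frac12. \end{cases}$$ In particular, $\|E_n[f]\|_\infty=O(n^{-r})$ whenever $(\alpha,\beta)\in\overline S$, where $$\overline S=\left(\left[-\tfrac12,\tfrac52\right]\times\left(-1,\tfrac12\right]\right)\setminus\left\{(\alpha,\beta):-\tfrac12\le\alpha\le\tfrac12,\ \alpha<\beta\le\tfrac12\right\}.$$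
   Context: $P_n^{(\alpha,\beta)}$ is the Jacobi polynomial of degree $n$ (orthogonal on $[-1,1]$ with respect to the weight $(1-t)^\alpha(1+t)^\beta$, normalized by $P_n^{(\alpha,\beta)}(1)=\binom{n+\alpha}{n}$); its $n$ roots are simple and lie in $(-1,1)$. $\|\cdot\|_\infty$ is the supremum norm on $[-1,1]$; $f^{(0)}=f$. The $O$-constants may depend on $f,r,\alpha,\beta$ but not on $n$. *)

theory Defs
  imports "HOL-Analysis.Analysis"
begin

text \<open>
  The Jacobi polynomial is characterised by its degree, its orthogonality to all polynomials of
  smaller degree, and its value at 1. For \<open>\<alpha>, \<beta> > -1\<close> there is exactly one such polynomial.
  The weight takes the value 0 at an endpoint where it should be 1 or infinite
  (since \<open>0 powr a = 0\<close>), which does not affect the integral.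
\<close>

definition is_jacobi_poly :: "real \<Rightarrow> real \<Rightarrow> nat \<Rightarrow> real poly \<Rightarrow> bool" where
  "is_jacobi_poly \<alpha> \<beta> n p \<longleftrightarrow>
     degree p = n \<and>
     (\<forall>q. degree q < n \<longrightarrow>
        ((\<lambda>t. poly p t * poly q t * ((1 - t) powr \<alpha> * (1 + t) powr \<beta>)) has_integral 0) {-1..1}) \<and>
     poly p 1 = (real n + \<alpha>) gchoose n"

definition jacobi_poly :: "real \<Rightarrow> real \<Rightarrow> nat \<Rightarrow> real poly" where
  "jacobi_poly \<alpha> \<beta> n = (THE p. is_jacobi_poly \<alpha> \<beta> n p)"

definition jacobi_nodes :: "real \<Rightarrow> real \<Rightarrow> nat \<Rightarrow> real set" where
  "jacobi_nodes \<alpha> \<beta> n = {t. (1 - t) * poly (jacobi_poly \<alpha> \<beta> n) t = 0}"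

text \<open>Unique whenever \<open>X\<close> has exactly \<open>n + 1\<close> elements.\<close>

definition interp_poly :: "nat \<Rightarrow> real set \<Rightarrow> (real \<Rightarrow> real) \<Rightarrow> real poly" where
  "interp_poly n X f = (THE p. degree p \<le> n \<and> (\<forall>x\<in>X. poly p x = f x))"

definition interp_error :: "real \<Rightarrow> real \<Rightarrow> nat \<Rightarrow> (real \<Rightarrow> real) \<Rightarrow> real \<Rightarrow> real" where
  "interp_error \<alpha> \<beta> n f t = f t - poly (interp_poly n (jacobi_nodes \<alpha> \<beta> n) f) t"

definition sup_norm :: "(real \<Rightarrow> real) \<Rightarrow> real" where
  "sup_norm h = (SUP t\<in>{-1..1}. \<bar>h t\<bar>)"

text \<open>
  The next two notions are meant for intervals \<open>S\<close>. In the first, the intervals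
  \<open>{a i..b i}\<close> are non-overlapping: they may share endpoints.
\<close>

definition abs_continuous_on :: "real set \<Rightarrow> (real \<Rightarrow> real) \<Rightarrow> bool" where
  "abs_continuous_on S f \<longleftrightarrow>
     (\<forall>\<epsilon>>0. \<exists>\<delta>>0. \<forall>(m::nat) a b.
        (\<forall>i<m. a i \<in> S \<and> b i \<in> S \<and> a i \<le> b i) \<and>
        disjoint_family_on (\<lambda>i. {a i<..<b i}) {..<m} \<and>
        (\<Sum>i<m. b i - a i) < \<delta> \<longrightarrow>
        (\<Sum>i<m. \<bar>f (b i) - f (a i)\<bar>) < \<epsilon>)"

definition bounded_variation_on :: "real set \<Rightarrow> (real \<Rightarrow> real) \<Rightarrow> bool" where
  "bounded_variation_on S f \<longleftrightarrow>
     (\<exists>B. \<forall>(m::nat) x.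
        (\<forall>i\<le>m. x i \<in> S) \<and> (\<forall>i<m. x i \<le> x (Suc i)) \<longrightarrow>
        (\<Sum>i<m. \<bar>f (x (Suc i)) - f (x i)\<bar>) \<le> B)"

definition S_bar :: "(real \<times> real) set" where
  "S_bar = ({-1/2..5/2} \<times> {-1<..1/2}) -
           {(\<alpha>, \<beta>). -1/2 \<le> \<alpha> \<and> \<alpha> \<le> 1/2 \<and> \<alpha> < \<beta> \<and> \<beta> \<le> 1/2}"

end

theory Submission
  imports Defs
begin

text \<open>
  For fixed \<open>x\<close> the error \<open>E\<^sub>n[f](x)\<close> is a combination of point evaluations that annihilates polynomials
  of degree at most \<open>n\<close>, hence an integral of \<open>g\<close> against the Peano kernel of order \<open>r\<close>. Every
  tail integral of a kernel orthogonal to polynomials of degree \<open>m\<close> gains a factor \<open>O(1/m)\<close>, because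
  step functions have distance \<open>O(1/m)\<close> from these polynomials in the mean. Since \<open>g\<close> is a difference
  of monotone functions, the second mean value theorem gives one such factor more, and so
  \<open>E\<^sub>n[f](x)\<close> is \<open>O(n\<^sup>-\<^sup>r)\<close> times the largest error of interpolating a step function.

  The interpolation errors for two adjacent positions of the step have opposite signs and differ by one
  fundamental polynomial, so this error is at most the maximum of 1 and the largest value of the
  fundamental polynomials. The latter are \<open>(1 - x) p(x) / (w'(b) (x - b))\<close>, where \<open>w(t) = (1 - t) p(t)\<close>
  and \<open>p\<close> is the Jacobi polynomial, and are homogeneous of degree 0 in \<open>p\<close>. It therefore suffices to
  know \<open>|p|\<close>, and \<open>|p'|\<close> at the zeros, up to one common factor: an energy of the solutions of the Jacobi
  differential equation is constant up to bounded factors as long as \<open>n\<^sup>2 (1 - x\<^sup>2)\<close> is bounded below,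
  and nearer to the ends \<open>p\<close> is comparable to its end values.
\<close>

section \<open>Jacobi polynomials from their differential equation\<close>

text \<open>The exponents of the result come from one squared bound: with
  \<open>a = \<alpha> + 1/2\<close>, \<open>b = \<beta> + 1/2\<close> and \<mu> of order n^2, the
  five powers in \<open>lagr_growth\<close> are n to twice the exponents 0, -(\<alpha> + 1/2),
  \<beta> - 1/2, \<alpha> - 5/2 and \<beta> - \<alpha>. In each case of the theorem the exponents
  missing from the minimum are dominated by those present. The obstacle to this rate is the Lebesgue
  constant: it sums all fundamental polynomials and always costs a logarithm. The alternating signs
  replace the sum by a single term, and the same argument at Chebyshev nodes supplies the
  approximation in the mean. The condition \<open>n \<ge> r + 1\<close> is what \<open>r\<close>
  tail integrals consume: the kernel of order 1 is orthogonal to degree \<open>n - 1\<close>, each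
  tail integral lowers the degree by one, and the factor O(1/m) requires \<open>m \<ge> 1\<close>.
  In the differential equation \<mu> is a free parameter, so uniformity in n becomes uniformity in
  \<mu>.\<close>

definition jacobi_ode :: "real \<Rightarrow> real \<Rightarrow> real \<Rightarrow> real poly \<Rightarrow> bool" where
  "jacobi_ode \<alpha> \<beta> \<mu> p \<longleftrightarrow> (\<forall>x. (1 - x\<^sup>2) * poly (pderiv (pderiv p)) x +
     (\<beta> - \<alpha> - (\<alpha> + \<beta> + 2) * x) * poly (pderiv p) x + \<mu> * poly p x = 0)"

definition jacobi_eigenvalue :: "real \<Rightarrow> real \<Rightarrow> nat \<Rightarrow> real" where
  "jacobi_eigenvalue \<alpha> \<beta> n = real n * (real n + \<alpha> + \<beta> + 1)"

definition jacobi_weight :: "real \<Rightarrow> real \<Rightarrow> real \<Rightarrow> real" where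
  "jacobi_weight \<alpha> \<beta> t = (1 - t) powr \<alpha> * (1 + t) powr \<beta>"

lemma jacobi_weight_pos: "x \<in> {-1<..<1} \<Longrightarrow> jacobi_weight \<alpha> \<beta> x > 0"
  by (simp add: jacobi_weight_def)

lemma jacobi_weight_DERIV:
  assumes "x \<in> {-1<..<1}"
  shows "(jacobi_weight \<alpha> \<beta> has_real_derivative
           jacobi_weight \<alpha> \<beta> x * ((\<beta> - \<alpha> - (\<alpha> + \<beta>) * x) / (1 - x\<^sup>2))) (at x)"
proof -
  have x: "1 - x > 0" "1 + x > 0" using assms by auto
  have "1 - x\<^sup>2 = (1 - x) * (1 + x)" by (simp add: power2_eq_square algebra_simps)
  moreover have "(jacobi_weight \<alpha> \<beta> has_real_derivative
           (1 - x) powr \<alpha> * (1 + x) powr \<beta> * (\<beta> / (1 + x) - \<alpha> / (1 - x))) (at x)"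
  proof -
    have "((\<lambda>x. 1 - x) has_real_derivative - 1) (at x)" "((\<lambda>x. 1 + x) has_real_derivative 1) (at x)"
      by (auto intro!: derivative_eq_intros)
    from DERIV_mult[OF DERIV_fun_powr[OF this(1) x(1), of \<alpha>] DERIV_fun_powr[OF this(2) x(2), of \<beta>]]
    show ?thesis
      unfolding jacobi_weight_def by (rule DERIV_cong)
        (use x in \<open>simp add: powr_diff right_diff_distrib mult_ac\<close>)
  qed
  moreover have "\<beta> / (1 + x) - \<alpha> / (1 - x) = (\<beta> - \<alpha> - (\<alpha> + \<beta>) * x) / ((1 - x) * (1 + x))"
    using x by (simp add: divide_simps) (simp add: algebra_simps)
  ultimately show ?thesis by (simp add: jacobi_weight_def)
qed

lemma jacobi_weight_Suc:
  assumes "x \<in> {-1<..<1}"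
  shows "jacobi_weight (\<alpha> + 1) (\<beta> + 1) x = (1 - x\<^sup>2) * jacobi_weight \<alpha> \<beta> x"
  using assms by (simp add: jacobi_weight_def powr_add power2_eq_square algebra_simps)

lemma jacobi_weight_continuous:
  assumes "\<alpha> > 0" "\<beta> > 0"
  shows "continuous_on {-1..1} (jacobi_weight \<alpha> \<beta>)"
  unfolding jacobi_weight_def using assms by (intro continuous_intros continuous_on_powr') auto

text \<open>Since \<open>0 powr a = 0\<close> for every real \<open>a\<close>, the endpoint values
  are 0 even for negative exponents. The boundary terms below use the exponents
  \<open>\<alpha> + 1\<close> and \<open>\<beta> + 1\<close>, which are positive, so that this value
  is also the limit.\<close>

lemma jacobi_weight_endpoints [simp]: "jacobi_weight \<alpha> \<beta> 1 = 0" "jacobi_weight \<alpha> \<beta> (-1) = 0"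
  by (auto simp: jacobi_weight_def)

text \<open>With a derivative in place of \<open>p\<close> this is the divergence form of the Jacobi
  operator. Later \<open>p\<close> is such a derivative or a Wronskian.\<close>

lemma jacobi_operator_self_adjoint:
  assumes "x \<in> {-1<..<1}"
  shows "((\<lambda>x. jacobi_weight (\<alpha> + 1) (\<beta> + 1) x * poly p x) has_real_derivative
    jacobi_weight \<alpha> \<beta> x * ((1 - x\<^sup>2) * poly (pderiv p) x +
       (\<beta> - \<alpha> - (\<alpha> + \<beta> + 2) * x) * poly p x)) (at x)"
proof -
  have "1 - x\<^sup>2 \<noteq> 0" using assms by (auto simp: power2_eq_1_iff)
  then show ?thesis
    by (intro DERIV_cong[OF DERIV_mult[OF jacobi_weight_DERIV[OF assms] poly_DERIV]])
       (simp only: jacobi_weight_Suc[OF assms], simp add: divide_simps, simp add: algebra_simps)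
qed

text \<open>Reflection swaps the two parameters, so every estimate at the end 1 also serves at
  -1.\<close>

lemma jacobi_ode_reflect:
  assumes "jacobi_ode \<alpha> \<beta> \<mu> p"
  shows "jacobi_ode \<beta> \<alpha> \<mu> (pcompose p [:0, -1:])"
  unfolding jacobi_ode_def
proof
  fix x :: real
  have "pderiv [:0, -1::real:] = [:-1:]" by (simp add: pderiv_pCons)
  then have "pderiv (pcompose p [:0, -1:]) = pcompose (- pderiv p) [:0, -1:]"
    "pderiv (pderiv (pcompose p [:0, -1:])) = pcompose (pderiv (pderiv p)) [:0, -1:]"
    by (simp_all add: pderiv_pcompose pcompose_uminus pderiv_minus pderiv_smult)
  then show "(1 - x\<^sup>2) * poly (pderiv (pderiv (pcompose p [:0, -1:]))) x +
     (\<alpha> - \<beta> - (\<beta> + \<alpha> + 2) * x) * poly (pderiv (pcompose p [:0, -1:])) x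
       + \<mu> * poly (pcompose p [:0, -1:]) x = 0"
    using assms[unfolded jacobi_ode_def, rule_format, of "-x"]
    by (simp add: poly_pcompose algebra_simps)
qed

text \<open>The coefficients are those of the hypergeometric series for \<open>P\<^sub>n\<close> in powers of \<open>1 - x\<close>.\<close>

lemma jacobi_ode_solution_exists:
  assumes "\<alpha> > -1" "\<beta> > -1"
  obtains p where "jacobi_ode \<alpha> \<beta> (jacobi_eigenvalue \<alpha> \<beta> n) p" "degree p = n" "poly p 1 = 1"
proof -
  let ?L = "jacobi_eigenvalue \<alpha> \<beta>"
  \<comment> \<open>Partial products of the two-term recursion \<open>c_rec\<close>. The factor at
    \<open>i = n\<close> vanishes, so the series stops there; for \<open>i < n\<close> no factor
    does, because \<open>i + n \<ge> 1\<close> and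
    \<open>\<alpha> + \<beta> + 1 > -1\<close>.\<close>
  define c where "c k = (\<Prod>i<k. (?L i - ?L n) / (2 * (real i + 1) * (real i + 1 + \<alpha>)))" for k
  have c_rec: "2 * (real k + 1) * (real k + 1 + \<alpha>) * c (Suc k) = (?L k - ?L n) * c k" for k
  proof -
    have "real k + 1 + \<alpha> \<noteq> 0" using assms by linarith
    then show ?thesis by (simp add: c_def)
  qed
  have c_0: "c k = 0" if "k > n" for k
    using that by (auto simp: c_def)
  have L_diff: "?L i - ?L n = (real i - real n) * (real i + real n + \<alpha> + \<beta> + 1)" for i
    by (simp add: jacobi_eigenvalue_def algebra_simps)
  have c_n: "c n \<noteq> 0"
  proof -
    have "?L i - ?L n \<noteq> 0 \<and> real i + 1 + \<alpha> \<noteq> 0" if "i < n" for i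
    proof -
      have "real i + real n \<ge> 1" using that by linarith
      then show ?thesis using assms that unfolding L_diff by auto
    qed
    then show ?thesis by (auto simp: c_def)
  qed
  define Y where "Y = Poly (map c [0..<Suc n])"
  have coeff_Y: "coeff Y k = c k" for k
    using c_0[of k] by (auto simp: Y_def nth_default_def simp del: upt_Suc)
  have deg: "degree Y = n"
    by (intro antisym degree_le le_degree) (auto simp: coeff_Y c_0 c_n)
  \<comment> \<open>The Jacobi equation in the variable \<open>1 - x\<close>; comparing coefficients
    gives exactly \<open>c_rec\<close>.\<close>
  have ode_Y: "[:0, 2, -1:] * pderiv (pderiv Y) + [:2 * \<alpha> + 2, - (\<alpha> + \<beta> + 2):] * pderiv Y
      + smult (?L n) Y = 0" (is "?E = 0")
  proof (rule poly_eqI)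
    fix k
    have "coeff ?E k = 2 * (real k + 1) * (real k + 1 + \<alpha>) * c (Suc k) - (?L k - ?L n) * c k"
      by (cases k; cases "k - 1")
         (simp_all add: coeff_pCons coeff_pderiv coeff_Y jacobi_eigenvalue_def algebra_simps split:
           nat.splits)
    then show "coeff ?E k = coeff 0 k" using c_rec[of k] by simp
  qed
  define p where "p = pcompose Y [:1, -1:]"
  have "pderiv [:1, -1::real:] = [:-1:]" by (simp add: pderiv_pCons)
  then have d: "pderiv p = pcompose (- pderiv Y) [:1, -1:]"
    "pderiv (pderiv p) = pcompose (pderiv (pderiv Y)) [:1, -1:]"
    by (simp_all add: p_def pderiv_pcompose pcompose_uminus pderiv_minus pderiv_smult)
  have "jacobi_ode \<alpha> \<beta> (?L n) p"
    unfolding jacobi_ode_def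
  proof
    fix x :: real
    have "poly ?E (1 - x) = 0" unfolding ode_Y by simp
    then show "(1 - x\<^sup>2) * poly (pderiv (pderiv p)) x +
        (\<beta> - \<alpha> - (\<alpha> + \<beta> + 2) * x) * poly (pderiv p) x + ?L n * poly p x = 0"
      unfolding d(2) unfolding d(1) by (simp add: p_def poly_pcompose power2_eq_square algebra_simps)
  qed
  moreover have "degree p = n" by (simp add: p_def deg degree_pcompose)
  moreover have "poly p 1 = 1"
    using coeff_Y[of 0] by (simp add: p_def poly_pcompose poly_0_coeff_0 c_def)
  ultimately show thesis by (rule that)
qed

lemma jacobi_ode_smult: "jacobi_ode \<alpha> \<beta> \<mu> p \<Longrightarrow> jacobi_ode \<alpha> \<beta> \<mu> (smult c p)"
  unfolding jacobi_ode_def by (simp add: pderiv_smult) (metis (no_types, opaque_lifting) distrib_left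
    mult.left_commute mult_zero_right)

text \<open>Green's identity: the integrand is the derivative of the weight with exponents raised by
  1 times the Wronskian of \<open>p\<close> and \<open>r\<close>, and this product vanishes at both
  ends.\<close>

lemma jacobi_ode_orthogonal_range:
  assumes "\<alpha> > -1" "\<beta> > -1" and p: "jacobi_ode \<alpha> \<beta> \<mu> p"
  shows "((\<lambda>x. poly p x * ((1 - x\<^sup>2) * poly (pderiv (pderiv r)) x +
     (\<beta> - \<alpha> - (\<alpha> + \<beta> + 2) * x) * poly (pderiv r) x + \<mu> * poly r x) * jacobi_weight \<alpha> \<beta> x)
     has_integral 0) {-1..1}"
proof -
  let ?F = "\<lambda>x. jacobi_weight (\<alpha> + 1) (\<beta> + 1) x * poly (p * pderiv r - r * pderiv p) x"
  have "((\<lambda>x. poly p x * ((1 - x\<^sup>2) * poly (pderiv (pderiv r)) x +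
     (\<beta> - \<alpha> - (\<alpha> + \<beta> + 2) * x) * poly (pderiv r) x + \<mu> * poly r x) * jacobi_weight \<alpha> \<beta> x)
     has_integral (?F 1 - ?F (-1))) {-1..1}"
  proof (rule fundamental_theorem_of_calculus_interior)
    show "continuous_on {-1..1} ?F"
      using assms by (intro continuous_intros jacobi_weight_continuous) auto
  next
    fix x :: real assume x: "x \<in> {-1<..<1}"
    have ode: "(1 - x\<^sup>2) * poly (pderiv (pderiv p)) x +
        (\<beta> - \<alpha> - (\<alpha> + \<beta> + 2) * x) * poly (pderiv p) x = - \<mu> * poly p x"
      using p[unfolded jacobi_ode_def, rule_format, of x] by linarith
    have alg: "v * (P * R2 - R * P2) + w * (P * R1 - R * P1) = P * (v * R2 + w * R1) - R * (v * P2 + w * P1)"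
      for v w P P1 P2 R R1 R2 :: real by (simp add: algebra_simps)
    have "poly (pderiv (p * pderiv r - r * pderiv p)) x =
        poly p x * poly (pderiv (pderiv r)) x - poly r x * poly (pderiv (pderiv p)) x"
      by (simp add: pderiv_diff pderiv_mult)
    then have "(1 - x\<^sup>2) * poly (pderiv (p * pderiv r - r * pderiv p)) x +
        (\<beta> - \<alpha> - (\<alpha> + \<beta> + 2) * x) * poly (p * pderiv r - r * pderiv p) x =
      poly p x * ((1 - x\<^sup>2) * poly (pderiv (pderiv r)) x +
        (\<beta> - \<alpha> - (\<alpha> + \<beta> + 2) * x) * poly (pderiv r) x) - poly r x *
      ((1 - x\<^sup>2) * poly (pderiv (pderiv p)) x +
        (\<beta> - \<alpha> - (\<alpha> + \<beta> + 2) * x) * poly (pderiv p) x)"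
      using alg by (simp only: poly_diff poly_mult)
    also have "\<dots> = poly p x * ((1 - x\<^sup>2) * poly (pderiv (pderiv r)) x +
        (\<beta> - \<alpha> - (\<alpha> + \<beta> + 2) * x) * poly (pderiv r) x + \<mu> * poly r x)"
      unfolding ode by (simp add: algebra_simps)
    finally show "(?F has_vector_derivative poly p x * ((1 - x\<^sup>2) * poly (pderiv (pderiv r)) x +
     (\<beta> - \<alpha> - (\<alpha> + \<beta> + 2) * x) * poly (pderiv r) x + \<mu> * poly r x) * jacobi_weight \<alpha> \<beta> x) (at x)"
      unfolding has_real_derivative_iff_has_vector_derivative[symmetric]
      using jacobi_operator_self_adjoint[OF x, of \<alpha> \<beta> "p * pderiv r - r * pderiv p"]
      by (simp add: mult_ac)
  qed simp
  then show ?thesis by simp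
qed

text \<open>The operator of the preceding lemma sends the monomial of degree k < n to a polynomial
  of degree k whose leading coefficient is the nonzero difference of the eigenvalues for n and k.
  Its range, to which \<open>p\<close> is orthogonal, therefore reaches every leading term, and
  induction on the degree disposes of the remainder.\<close>

lemma jacobi_ode_orthogonal:
  assumes ab: "\<alpha> > -1" "\<beta> > -1" and p: "jacobi_ode \<alpha> \<beta> (jacobi_eigenvalue \<alpha> \<beta> n) p"
    and "degree q < n"
  shows "((\<lambda>x. poly p x * poly q x * jacobi_weight \<alpha> \<beta> x) has_integral 0) {-1..1}"
  using assms(4)
proof (induction "degree q" arbitrary: q rule: less_induct)
  case less
  let ?L = "jacobi_eigenvalue \<alpha> \<beta>"
  show ?case
  proof (cases "q = 0")
    case True
    then show ?thesis by simp
  next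
    case False
    let ?k = "degree q"
    define r where "r = (monom 1 ?k :: real poly)"
    define Lr where "Lr = [:1, 0, -1:] * pderiv (pderiv r) + [:\<beta> - \<alpha>, - (\<alpha> + \<beta> + 2):] * pderiv r
      + smult (?L n) r"
    have "poly Lr x = (1 - x\<^sup>2) * poly (pderiv (pderiv r)) x +
        (\<beta> - \<alpha> - (\<alpha> + \<beta> + 2) * x) * poly (pderiv r) x + ?L n * poly r x" for x
      by (simp add: Lr_def power2_eq_square) (simp add: algebra_simps)
    then have Lr_int: "((\<lambda>x. poly p x * poly Lr x * jacobi_weight \<alpha> \<beta> x) has_integral 0) {-1..1}"
      using jacobi_ode_orthogonal_range[OF ab p, of r] by simp
    have deg_r: "coeff r i = of_bool (i = ?k)" for i by (simp add: r_def)
    have cLr: "coeff Lr i = (if i = ?k then ?L n - ?L ?k else 0)" if "i \<ge> ?k" for i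
    proof -
      have "coeff Lr i = (?L n - ?L i) * coeff r i + (real i + 1) * (real i + 2) * coeff r (Suc (Suc i))
          + (\<beta> - \<alpha>) * (real i + 1) * coeff r (Suc i)"
        unfolding Lr_def
        by (cases i; cases "i - 1")
           (auto simp: coeff_pCons coeff_pderiv jacobi_eigenvalue_def algebra_simps split: nat.splits)
      then show ?thesis using that by (simp add: deg_r)
    qed
    have ne: "?L n - ?L ?k \<noteq> 0"
    proof -
      have eq: "?L n - ?L ?k = (real n - real ?k) * (real n + real ?k + \<alpha> + \<beta> + 1)"
        by (simp add: jacobi_eigenvalue_def algebra_simps)
      have "real n + real ?k \<ge> 1" using less.prems by linarith
      then have "real n + real ?k + \<alpha> + \<beta> + 1 > 0" using ab by linarith
      then show ?thesis unfolding eq using less.prems by simp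
    qed
    define c where "c = lead_coeff q / (?L n - ?L ?k)"
    define s where "s = q - smult c Lr"
    have cs: "coeff s i = 0" if "i \<ge> ?k" for i
      using that cLr[OF that] ne by (auto simp: s_def c_def coeff_eq_0)
    have s_int: "((\<lambda>x. poly p x * poly s x * jacobi_weight \<alpha> \<beta> x) has_integral 0) {-1..1}"
    proof (cases "s = 0")
      case False
      then have "degree s < ?k" using cs by (metis leading_coeff_0_iff not_le)
      then show ?thesis using less by simp
    qed simp
    have "((\<lambda>x. poly p x * poly s x * jacobi_weight \<alpha> \<beta> x + c * (poly p x * poly Lr x * jacobi_weight \<alpha> \<beta> x))
        has_integral 0 + c * 0) {-1..1}"
      by (intro has_integral_add has_integral_mult_right s_int Lr_int)
    then show ?thesis by (simp add: s_def algebra_simps)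
  qed
qed

section \<open>Uniqueness and identification of the Jacobi polynomial\<close>

lemma nonneg_poly_integral_0_imp_0:
  assumes int: "((\<lambda>x. poly p x * jacobi_weight \<alpha> \<beta> x) has_integral 0) {-1..1}"
    and nonneg: "\<And>x. x \<in> {-1<..<1} \<Longrightarrow> poly p x \<ge> 0"
  shows "p = 0"
proof -
  let ?f = "\<lambda>x. poly p x * jacobi_weight \<alpha> \<beta> x"
  have nn: "?f x \<ge> 0" if "x \<in> {-1..1}" for x
  proof (cases "x = 1 \<or> x = -1")
    case False
    then have "x \<in> {-1<..<1}" using that by auto
    then show ?thesis using nonneg jacobi_weight_pos[of x \<alpha> \<beta>] by auto
  qed auto
  have io: "?f integrable_on {-1..1}" using int by blast
  then have io': "?f integrable_on {-1/2..1/2}" by (rule integrable_on_subinterval) auto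
  \<comment> \<open>The weight may be unbounded at the ends, so continuity is used on a compact
    subinterval; vanishing there already means infinitely many zeros.\<close>
  have "integral {-1/2..1/2} ?f \<le> integral {-1..1} ?f"
    by (rule integral_subset_le) (use io io' nn in auto)
  also have "\<dots> = 0" using int by blast
  finally have "integral {-1/2..1/2} ?f \<le> 0" .
  moreover have "integral {-1/2..1/2} ?f \<ge> 0" by (rule integral_nonneg) (use io' nn in auto)
  moreover have "continuous_on {-1/2..1/2} ?f"
    by (intro continuous_intros DERIV_continuous_on[OF DERIV_subset[OF jacobi_weight_DERIV]]) auto
  ultimately have "\<forall>x\<in>{-1/2..1/2}. ?f x = 0"
    using integral_eq_0_iff[of "-1/2" "1/2" ?f] nn by auto
  then have "poly p x = 0" if "x \<in> {-1/2..1/2}" for x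
    using that jacobi_weight_pos[of x \<alpha> \<beta>] by force
  then have "{-1/2..1/2} \<subseteq> {x. poly p x = 0}" by auto
  moreover have "infinite {-1/2..1/2::real}" by (simp add: infinite_Icc)
  ultimately show "p = 0" using poly_roots_finite finite_subset by blast
qed

text \<open>Cancelling the leading coefficients leaves a polynomial of degree below \<open>n\<close>
  that is orthogonal to itself, hence zero. The common value at 1, a binomial coefficient without
  vanishing factors, then fixes the scalar.\<close>

lemma is_jacobi_poly_unique:
  assumes "\<alpha> > -1" and p: "is_jacobi_poly \<alpha> \<beta> n p" and q: "is_jacobi_poly \<alpha> \<beta> n q"
  shows "p = q"
proof -
  define c where "c = lead_coeff p / lead_coeff q"
  define s where "s = p - smult c q"
  have val: "poly p 1 \<noteq> 0"
  proof -
    have "real n + \<alpha> - real i \<noteq> 0" if "i < n" for i using that assms(1) by linarith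
    then show ?thesis using p by (auto simp: is_jacobi_poly_def gbinomial_prod_rev)
  qed
  have dp: "degree p = n" "degree q = n" and v: "poly p 1 = poly q 1"
    using p q by (auto simp: is_jacobi_poly_def)
  have "q \<noteq> 0" using val v by auto
  then have "coeff q n \<noteq> 0" using dp leading_coeff_0_iff[of q] by simp
  then have cs: "coeff s i = 0" if "i \<ge> n" for i
    using that dp by (cases "i = n") (simp_all add: s_def c_def coeff_eq_0)
  have "s = 0"
  proof (rule ccontr)
    assume s: "s \<noteq> 0"
    then have ds: "degree s < n" using cs by (metis leading_coeff_0_iff not_le)
    have "((\<lambda>t. poly p t * poly s t * jacobi_weight \<alpha> \<beta> t - c * (poly q t * poly s t * jacobi_weight \<alpha> \<beta> t))
        has_integral 0 - c * 0) {-1..1}"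
      using p q ds by (intro has_integral_diff has_integral_mult_right) (auto
        simp: is_jacobi_poly_def jacobi_weight_def)
    then have "((\<lambda>t. poly (s * s) t * jacobi_weight \<alpha> \<beta> t) has_integral 0) {-1..1}"
      by (simp add: s_def algebra_simps)
    then have "s * s = 0" by (rule nonneg_poly_integral_0_imp_0) simp
    then show False using s by simp
  qed
  then have pq: "p = smult c q" by (simp add: s_def)
  then have "c = 1" using v val by auto
  then show ?thesis using pq by simp
qed

text \<open>A solution of the differential equation, rescaled to the prescribed value at 1,
  satisfies the defining conditions, so uniqueness resolves the description operator. From here on
  the equation takes the place of the definition.\<close>

lemma jacobi_poly_props:
  assumes "\<alpha> > -1" "\<beta> > -1"
  shows "degree (jacobi_poly \<alpha> \<beta> n) = n" "jacobi_poly \<alpha> \<beta> n \<noteq> 0"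
    "jacobi_ode \<alpha> \<beta> (jacobi_eigenvalue \<alpha> \<beta> n) (jacobi_poly \<alpha> \<beta> n)"
proof -
  obtain p where p: "jacobi_ode \<alpha> \<beta> (jacobi_eigenvalue \<alpha> \<beta> n) p" "degree p = n" "poly p 1 = 1"
    using jacobi_ode_solution_exists[OF assms] by blast
  define c where "c = (real n + \<alpha>) gchoose n"
  have c: "c \<noteq> 0"
  proof -
    have "real n + \<alpha> - real i \<noteq> 0" if "i < n" for i using that assms(1) by linarith
    then show ?thesis by (auto simp: c_def gbinomial_prod_rev)
  qed
  have ode: "jacobi_ode \<alpha> \<beta> (jacobi_eigenvalue \<alpha> \<beta> n) (smult c p)" using p jacobi_ode_smult by blast
  have jac: "is_jacobi_poly \<alpha> \<beta> n (smult c p)"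
    unfolding is_jacobi_poly_def
    using jacobi_ode_orthogonal[OF assms ode] p c by (simp add: jacobi_weight_def c_def)
  have eq: "jacobi_poly \<alpha> \<beta> n = smult c p"
    unfolding jacobi_poly_def using jac is_jacobi_poly_unique[OF assms(1)] by (intro the_equality) auto
  show "degree (jacobi_poly \<alpha> \<beta> n) = n" "jacobi_poly \<alpha> \<beta> n \<noteq> 0"
    "jacobi_ode \<alpha> \<beta> (jacobi_eigenvalue \<alpha> \<beta> n) (jacobi_poly \<alpha> \<beta> n)"
    unfolding eq using p c ode by auto
qed

section \<open>Energy estimates for the differential equation\<close>

text \<open>\<open>G x * exp (- k x)\<close> decreases and \<open>G x * exp (k x)\<close> increases.
  Both directions matter, since the energy is compared between points in either order.\<close>

lemma gronwall_two_sided: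
  fixes G k :: "real \<Rightarrow> real"
  assumes "l \<le> u"
    and G: "\<And>x. x \<in> {l..u} \<Longrightarrow> (G has_real_derivative G' x) (at x)"
    and k: "\<And>x. x \<in> {l..u} \<Longrightarrow> (k has_real_derivative k' x) (at x)"
    and le: "\<And>x. x \<in> {l..u} \<Longrightarrow> \<bar>G' x\<bar> \<le> k' x * G x"
  shows "G u \<le> G l * exp (k u - k l)" "G l \<le> G u * exp (k u - k l)"
proof -
  have "G u * exp (- k u) \<le> G l * exp (- k l)"
  proof (rule DERIV_nonpos_imp_nonincreasing[OF assms(1)])
    fix x assume "l \<le> x" "x \<le> u"
    then have x: "x \<in> {l..u}" by simp
    have "((\<lambda>x. G x * exp (- k x)) has_real_derivative (G' x - k' x * G x) * exp (- k x)) (at x)"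
      by (auto intro!: derivative_eq_intros G[OF x] k[OF x] simp: algebra_simps)
    moreover have "(G' x - k' x * G x) * exp (- k x) \<le> 0"
      using le[OF x] by (intro mult_nonpos_nonneg) auto
    ultimately show "\<exists>y. ((\<lambda>x. G x * exp (- k x)) has_real_derivative y) (at x) \<and> y \<le> 0" by blast
  qed
  then show "G u \<le> G l * exp (k u - k l)" by (simp add: exp_diff exp_minus field_simps)
  have "G l * exp (k l) \<le> G u * exp (k u)"
  proof (rule DERIV_nonneg_imp_nondecreasing[OF assms(1)])
    fix x assume "l \<le> x" "x \<le> u"
    then have x: "x \<in> {l..u}" by simp
    have "((\<lambda>x. G x * exp (k x)) has_real_derivative (G' x + k' x * G x) * exp (k x)) (at x)"
      by (auto intro!: derivative_eq_intros G[OF x] k[OF x] simp: algebra_simps)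
    moreover have "(G' x + k' x * G x) * exp (k x) \<ge> 0"
      using le[OF x] by (intro mult_nonneg_nonneg) auto
    ultimately show "\<exists>y. ((\<lambda>x. G x * exp (k x)) has_real_derivative y) (at x) \<and> 0 \<le> y" by blast
  qed
  then show "G l \<le> G u * exp (k u - k l)" by (simp add: exp_diff field_simps)
qed

text \<open>In \<open>\<theta> = arccos x\<close> the weight is that of the Liouville normal form,
  and \<open>(1 - x\<^sup>2) * (poly (pderiv p) x)\<^sup>2\<close> is the square of the
  \<theta>-derivative. At a zero of \<open>p\<close> only this term remains, which is how the energy
  controls the derivative at the nodes.\<close>

definition jacobi_energy :: "real \<Rightarrow> real \<Rightarrow> real \<Rightarrow> real poly \<Rightarrow> real \<Rightarrow> real" where
  "jacobi_energy \<alpha> \<beta> \<mu> p x = jacobi_weight (\<alpha> + 1/2) (\<beta> + 1/2) x *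
     ((poly p x)\<^sup>2 + (1 - x\<^sup>2) * (poly (pderiv p) x)\<^sup>2 / \<mu>)"

text \<open>The derivative of the corrected energy, divided by the weight: \<open>- m / v\<close> is
  the logarithmic derivative of the weight and \<open>s\<close> stands for the derivative of
  \<open>m\<close>. Without cross term and \<open>K\<close> the left side would be
  \<open>m * (Y1\<^sup>2 / \<mu> - Y\<^sup>2 / v)\<close>. The cross term cancels exactly this, and
  what is left has the denominators \<open>\<mu> * v\<close> and
  \<open>\<mu> * v\<^sup>2\<close>.\<close>

lemma corrected_energy_identity:
  fixes m x v \<mu> K Y Y1 Y2 s :: real
  assumes "v \<noteq> 0" "\<mu> \<noteq> 0" "v * Y2 = (m + x) * Y1 - \<mu> * Y"
  shows "- m / v * (Y\<^sup>2 + v * Y1\<^sup>2 / \<mu> + K * Y\<^sup>2 / (\<mu> * v) - m * Y * Y1 / \<mu>) +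
      (2 * Y * Y1 + (2 * v * Y1 * Y2 - 2 * x * Y1\<^sup>2) / \<mu> + K * (2 * Y * Y1 / v + 2 * x * Y\<^sup>2 / v\<^sup>2) / \<mu>
       - (s * Y * Y1 + m * Y1\<^sup>2 + m * Y * Y2) / \<mu>) =
    K * (2 * x - m) * Y\<^sup>2 / (\<mu> * v\<^sup>2) + (2 * K - (s * v + m * x)) * (Y * Y1) / (\<mu> * v)"
proof -
  have Y2: "Y2 = ((m + x) * Y1 - \<mu> * Y) / v" using assms by (simp add: field_simps)
  show ?thesis unfolding Y2 using assms(1,2)
    by (simp add: divide_simps) (simp add: algebra_simps power2_eq_square power3_eq_cube power4_eq_xxxx)
qed

text \<open>With \<open>t = sqrt (\<mu> * v)\<close> and \<open>Z = v * Y1 / t\<close> the quantity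
  \<open>h\<close> is \<open>Y\<^sup>2 + Z\<^sup>2\<close> and the cross term is
  \<open>(m * Y / t) * Z\<close>. The choice \<open>K = Q\<^sup>2\<close> makes
  \<open>K * Y\<^sup>2 / t\<^sup>2\<close> dominate \<open>(m * Y / t)\<^sup>2\<close>, so the
  inequality of the means absorbs the cross term at the cost of the factor 2.\<close>

lemma corrected_energy_bounds:
  fixes m x v \<mu> K Y Y1 s Q c :: real
  assumes v: "0 < v" "v \<le> 1" and \<mu>: "0 < \<mu>" and c: "0 < c" "c \<le> \<mu> * v"
    and m: "\<bar>m\<bar> \<le> Q" and s: "\<bar>s\<bar> \<le> Q" and x: "\<bar>x\<bar> \<le> 1" and K: "K = Q\<^sup>2"
  defines "h \<equiv> Y\<^sup>2 + v * Y1\<^sup>2 / \<mu>"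
  defines "g \<equiv> Y\<^sup>2 + v * Y1\<^sup>2 / \<mu> + K * Y\<^sup>2 / (\<mu> * v) - m * Y * Y1 / \<mu>"
  shows "h \<le> 2 * g" "g \<le> (1 + K / c + Q / sqrt c) * h"
    "\<bar>K * (2 * x - m) * Y\<^sup>2 / (\<mu> * v\<^sup>2) + (2 * K - (s * v + m * x)) * (Y * Y1) / (\<mu> * v)\<bar>
       \<le> (K * (Q + 2) / sqrt c + K + Q) * h / (sqrt (\<mu> * v) * v)"
proof -
  define t where "t = sqrt (\<mu> * v)"
  have t2: "t * t = \<mu> * v" using v \<mu> by (simp add: t_def)
  have ct: "sqrt c \<le> t" "0 < sqrt c" "0 < t" using c v \<mu> by (auto simp: t_def)
  have Q: "Q \<ge> 0" using m by linarith
  have K0: "K \<ge> 0" by (simp add: K)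
  define Z where "Z = v * Y1 / t"
  have Z2: "Z\<^sup>2 = v * Y1\<^sup>2 / \<mu>"
  proof -
    have "Z\<^sup>2 = v\<^sup>2 * Y1\<^sup>2 / (t * t)" by (simp add: Z_def power2_eq_square)
    then show ?thesis using v \<mu> unfolding t2 by (simp add: field_simps power2_eq_square)
  qed
  have Y1: "Y1 = Z * t / v" using v ct by (simp add: Z_def)
  have h: "h = Y\<^sup>2 + Z\<^sup>2" by (simp add: h_def Z2)
  have h0: "h \<ge> 0" by (simp add: h)
  have YZ: "\<bar>Y * Z\<bar> \<le> h / 2"
    using sum_squares_bound[of "\<bar>Y\<bar>" "\<bar>Z\<bar>"] by (simp add: h abs_mult)
  have r1: "Y * Y1 / \<mu> = Y * Z / t"
    using v \<mu> ct t2 by (simp add: Y1 divide_simps)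
  have mm: "m * Y * Y1 / \<mu> = (m * Y / t) * Z"
    using arg_cong[OF r1, of "\<lambda>u. m * u"] by (simp add: mult_ac)
  have g: "g = Y\<^sup>2 + Z\<^sup>2 + K * Y\<^sup>2 / t\<^sup>2 - (m * Y / t) * Z"
    unfolding g_def mm Z2 using t2 by (simp add: power2_eq_square)
  have mK: "(m * Y / t)\<^sup>2 \<le> K * Y\<^sup>2 / t\<^sup>2"
  proof -
    have "m\<^sup>2 \<le> Q\<^sup>2" using m by (metis abs_le_square_iff abs_of_nonneg Q)
    then show ?thesis unfolding K by (simp add: power_divide power_mult_distrib divide_right_mono
      mult_right_mono)
  qed
  have "2 * ((m * Y / t) * Z) \<le> (m * Y / t)\<^sup>2 + Z\<^sup>2" using sum_squares_bound[of "m * Y / t" Z] by simp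
  then show "h \<le> 2 * g" using mK unfolding h g by (smt (verit) zero_le_power2)
  have KY: "K * Y\<^sup>2 / t\<^sup>2 \<le> K / c * h"
  proof -
    have "K * Y\<^sup>2 / t\<^sup>2 \<le> K * Y\<^sup>2 / c" using c t2 K by (intro divide_left_mono) (auto simp: power2_eq_square)
    also have "\<dots> \<le> K * h / c" using c K by (intro divide_right_mono mult_left_mono) (auto simp: h)
    finally show ?thesis by simp
  qed
  have mYZ: "\<bar>(m * Y / t) * Z\<bar> \<le> Q / sqrt c * h"
  proof -
    have "\<bar>(m * Y / t) * Z\<bar> = \<bar>m\<bar> / t * \<bar>Y * Z\<bar>" using ct by (simp add: abs_mult)
    also have "\<dots> \<le> Q / sqrt c * h"
      using m Q ct YZ h0 by (intro mult_mono frac_le) auto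
    finally show ?thesis .
  qed
  show "g \<le> (1 + K / c + Q / sqrt c) * h"
  proof -
    have "g \<le> h + K / c * h + Q / sqrt c * h" using KY abs_le_D2[OF mYZ] unfolding g h by linarith
    then show ?thesis by (simp add: distrib_right)
  qed
  have A: "\<bar>K * (2 * x - m) * Y\<^sup>2 / (\<mu> * v\<^sup>2)\<bar> \<le> K * (Q + 2) / sqrt c * h / (t * v)"
  proof -
    have "\<bar>K * (2 * x - m) * Y\<^sup>2 / (\<mu> * v\<^sup>2)\<bar> = K * \<bar>2 * x - m\<bar> * Y\<^sup>2 / t / (t * v)"
    proof -
      have "\<mu> * v\<^sup>2 = t * (t * v)" using t2 by (simp add: power2_eq_square mult.assoc[symmetric])
      then show ?thesis using ct v K by (simp add: abs_mult)
    qed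
    also have "\<dots> \<le> K * (Q + 2) * h / sqrt c / (t * v)"
      using ct v m x Q by (intro divide_right_mono frac_le mult_mono) (auto simp: K h)
    finally show ?thesis by simp
  qed
  have B: "\<bar>(2 * K - (s * v + m * x)) * (Y * Y1) / (\<mu> * v)\<bar> \<le> (K + Q) * h / (t * v)"
  proof -
    have "\<bar>s * v\<bar> \<le> Q * 1" unfolding abs_mult using s v Q by (intro mult_mono) auto
    moreover have "\<bar>m * x\<bar> \<le> Q * 1" unfolding abs_mult using m x Q by (intro mult_mono) auto
    ultimately have b: "\<bar>2 * K - (s * v + m * x)\<bar> \<le> 2 * K + 2 * Q" using K0 by linarith
    have "(2 * K - (s * v + m * x)) * (Y * Y1) / (\<mu> * v) = (2 * K - (s * v + m * x)) * (Y * Y1 / \<mu>) / v"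
      by simp
    then have "\<bar>(2 * K - (s * v + m * x)) * (Y * Y1) / (\<mu> * v)\<bar> = \<bar>2 * K - (s * v
      + m * x)\<bar> * \<bar>Y * Z\<bar> / (t * v)"
      unfolding r1 using ct v by (simp add: abs_mult)
    also have "\<dots> \<le> (2 * K + 2 * Q) * (h / 2) / (t * v)"
      using b YZ ct v Q K by (intro divide_right_mono mult_mono) auto
    finally show ?thesis by (simp add: algebra_simps)
  qed
  have "\<bar>K * (2 * x - m) * Y\<^sup>2 / (\<mu> * v\<^sup>2) + (2 * K - (s * v + m * x)) * (Y * Y1) / (\<mu> * v)\<bar>
      \<le> K * (Q + 2) / sqrt c * h / (t * v) + (K + Q) * h / (t * v)"
    using A B by linarith
  also have "\<dots> = (K * (Q + 2) / sqrt c + K + Q) * h / (t * v)"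
    by (simp add: distrib_right add_divide_distrib)
  finally show "\<bar>K * (2 * x - m) * Y\<^sup>2 / (\<mu> * v\<^sup>2) + (2 * K - (s * v + m * x)) * (Y * Y1) / (\<mu> * v)\<bar>
       \<le> (K * (Q + 2) / sqrt c + K + Q) * h / (sqrt (\<mu> * v) * v)" by (simp add: t_def)
qed

text \<open>The bound just found for the logarithmic derivative thus has an antiderivative of
  modulus at most \<open>1 / sqrt c\<close> wherever \<open>c \<le> \<mu> * (1 - x\<^sup>2)\<close>.
  This is the uniformity in \<mu>.\<close>

lemma DERIV_x_over_sqrt:
  fixes x :: real
  assumes "\<bar>x\<bar> < 1" "\<mu> > 0"
  shows "((\<lambda>x. x / sqrt (\<mu> * (1 - x\<^sup>2))) has_real_derivative 1 / (sqrt (\<mu> * (1 - x\<^sup>2)) * (1 - x\<^sup>2))) (at x)"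
proof -
  have v: "1 - x\<^sup>2 > 0" using assms by (simp add: abs_square_less_1)
  define t where "t = sqrt (\<mu> * (1 - x\<^sup>2))"
  have t: "t > 0" "t * t = \<mu> * (1 - x\<^sup>2)" using v assms by (auto simp: t_def)
  have "((\<lambda>x. sqrt (\<mu> * (1 - x\<^sup>2))) has_real_derivative - \<mu> * x / t) (at x)"
    using v assms by (auto intro!: derivative_eq_intros simp: t_def field_simps)
  from DERIV_divide[OF DERIV_ident this]
  have "((\<lambda>x. x / sqrt (\<mu> * (1 - x\<^sup>2))) has_real_derivative (t - x * (- \<mu> * x / t)) / (t * t)) (at x)"
    using t v assms by (simp add: t_def)
  moreover have "(t - x * (- \<mu> * x / t)) / (t * t) = 1 / (t * (1 - x\<^sup>2))"
  proof -
    have "(t - x * (- \<mu> * x / t)) / (t * t) = (t * t + \<mu> * x\<^sup>2) / (t * (t * t))"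
      using t(1) by (simp add: divide_simps power2_eq_square)
    also have "t * t + \<mu> * x\<^sup>2 = \<mu>" unfolding t by (simp add: algebra_simps)
    finally have "(t - x * (- \<mu> * x / t)) / (t * t) = \<mu> / (t * (t * t))" .
    then show ?thesis unfolding t(2) using t(1) assms v by simp
  qed
  ultimately show ?thesis by (simp add: t_def)
qed

text \<open>
  In the variable \<open>\<theta> = arccos x\<close> the quantity compared here is essentially \<open>u\<^sup>2 + (u')\<^sup>2/\<mu>\<close> for the
  Liouville-transformed solution \<open>u\<close>. Its logarithmic derivative is not integrable uniformly in \<open>\<mu>\<close>
  up to the ends; subtracting the cross term \<open>m p p'/\<mu>\<close> removes the non-integrable part, and the
  term with \<open>K\<close> restores positivity.
\<close>

lemma jacobi_energy_comparable:
  fixes \<alpha> \<beta> c :: real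
  assumes c: "c > 0"
  shows "\<exists>C\<ge>1. \<forall>\<mu> p x z. \<mu> > 0 \<longrightarrow> jacobi_ode \<alpha> \<beta> \<mu> p \<longrightarrow> x \<in> {-1<..<1} \<longrightarrow> z \<in> {-1<..<1} \<longrightarrow>
     c \<le> \<mu> * (1 - x\<^sup>2) \<longrightarrow> c \<le> \<mu> * (1 - z\<^sup>2) \<longrightarrow> jacobi_energy \<alpha> \<beta> \<mu> p x \<le> C * jacobi_energy \<alpha> \<beta> \<mu> p z"
proof -
  define Q where "Q = \<bar>\<alpha> - \<beta>\<bar> + \<bar>\<alpha> + \<beta> + 1\<bar>"
  define K where "K = Q\<^sup>2"
  define K3 where "K3 = 2 * (K * (Q + 2) / sqrt c + K + Q)"
  define C2 where "C2 = 1 + K / c + Q / sqrt c"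
  \<comment> \<open>The factors \<open>2\<close> and \<open>C2\<close> pass between the energy and
    the corrected energy at the two points; the exponential comes from Gronwall, with
    \<open>k\<close> at most \<open>K3 / sqrt c\<close> in modulus at each of them.\<close>
  define C where "C = 2 * C2 * exp (2 * K3 / sqrt c)"
  have Q0: "Q \<ge> 0" and K0: "K \<ge> 0" by (auto simp: Q_def K_def)
  have K30: "K3 \<ge> 0" using Q0 K0 c by (auto simp: K3_def)
  have C21: "C2 \<ge> 1" using Q0 K0 c by (auto simp: C2_def)
  show ?thesis
  proof (intro exI[of _ C] conjI allI impI)
    have "1 * 1 \<le> (2 * C2) * exp (2 * K3 / sqrt c)" using C21 K30 c by (intro mult_mono) auto
    then show "C \<ge> 1" by (simp add: C_def)
  next
    fix \<mu> p x z
    assume \<mu>: "\<mu> > 0" and ode: "jacobi_ode \<alpha> \<beta> \<mu> p" and x: "x \<in> {-1<..<1}" and z: "z \<in> {-1<..<1}"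
      and cx: "c \<le> \<mu> * (1 - x\<^sup>2)" and cz: "c \<le> \<mu> * (1 - z\<^sup>2)"
    define m where "m x = \<alpha> - \<beta> + (\<alpha> + \<beta> + 1) * x" for x
    define \<omega> where "\<omega> = jacobi_weight (\<alpha> + 1/2) (\<beta> + 1/2)"
    define y where "y = poly p"
    define y1 where "y1 = poly (pderiv p)"
    define y2 where "y2 = poly (pderiv (pderiv p))"
    define g where "g x = (y x)\<^sup>2 + (1 - x\<^sup>2) * (y1 x)\<^sup>2 / \<mu>
      + K * (y x)\<^sup>2 / (\<mu> * (1 - x\<^sup>2)) - m x * y x * y1 x / \<mu>" for x
    define g' where "g' x = K * (2 * x - m x) * (y x)\<^sup>2 / (\<mu> * (1 - x\<^sup>2)\<^sup>2) +
      (2 * K - ((\<alpha> + \<beta> + 1) * (1 - x\<^sup>2) + m x * x)) * (y x * y1 x) / (\<mu> * (1 - x\<^sup>2))" for x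
    define k where "k x = K3 * (x / sqrt (\<mu> * (1 - x\<^sup>2)))" for x
    define R where "R = {x. x \<in> {-1<..<1} \<and> c \<le> \<mu> * (1 - x\<^sup>2)}"
    have mQ: "\<bar>m x\<bar> \<le> Q" if "\<bar>x\<bar> \<le> 1" for x
    proof -
      have "\<bar>(\<alpha> + \<beta> + 1) * x\<bar> \<le> \<bar>\<alpha> + \<beta> + 1\<bar> * 1" unfolding abs_mult using that by (intro mult_left_mono) auto
      then show ?thesis unfolding m_def Q_def
        by (intro order_trans[OF abs_triangle_ineq] add_left_mono) simp
    qed
    have Rx: "\<bar>x\<bar> < 1" "0 < 1 - x\<^sup>2" "1 - x\<^sup>2 \<le> 1" if "x \<in> R" for x
      using that by (auto simp: R_def abs_square_less_1)
    have Gd: "((\<lambda>x. \<omega> x * g x) has_real_derivative \<omega> x * g' x) (at x)" if xR: "x \<in> R" for x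
    proof -
      let ?v = "1 - x\<^sup>2"
      have v: "?v \<noteq> 0" using Rx[OF xR] by simp
      have xi: "x \<in> {-1<..<1}" using xR by (simp add: R_def)
      have dw: "(\<omega> has_real_derivative \<omega> x * (- m x / ?v)) (at x)"
        using jacobi_weight_DERIV[OF xi, of "\<alpha> + 1/2" "\<beta> + 1/2"]
        by (simp add: \<omega>_def m_def algebra_simps)
      have dy: "(y has_real_derivative y1 x) (at x)" "(y1 has_real_derivative y2 x) (at x)"
        by (simp_all add: y_def y1_def y2_def poly_DERIV)
      have dg: "(g has_real_derivative (2 * y x * y1 x + (2 * ?v * y1 x * y2 x - 2 * x * (y1 x)\<^sup>2) / \<mu>
          + K * (2 * y x * y1 x / ?v + 2 * x * (y x)\<^sup>2 / ?v\<^sup>2) / \<mu>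
          - ((\<alpha> + \<beta> + 1) * y x * y1 x + m x * (y1 x)\<^sup>2 + m x * y x * y2 x) / \<mu>)) (at x)"
        unfolding g_def m_def using v \<mu>
        by (auto intro!: derivative_eq_intros dy)
          (simp add: divide_simps, simp add: algebra_simps power2_eq_square)
      have ode': "?v * y2 x = (m x + x) * y1 x - \<mu> * y x"
        using ode[unfolded jacobi_ode_def, rule_format, of x]
        by (simp add: y_def y1_def y2_def m_def algebra_simps)
      show ?thesis
      proof (rule DERIV_cong[OF DERIV_mult[OF dw dg]])
        have "\<omega> x * (- m x / ?v) * g x + D * \<omega> x = \<omega> x * (- m x / ?v * g x + D)" for D
          by (simp add: algebra_simps)
        then show "\<omega> x * (- m x / ?v) * g x + (2 * y x * y1 x + (2 * ?v * y1 x * y2 x - 2 * x * (y1 x)\<^sup>2) / \<mu>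
          + K * (2 * y x * y1 x / ?v + 2 * x * (y x)\<^sup>2 / ?v\<^sup>2) / \<mu>
          - ((\<alpha> + \<beta> + 1) * y x * y1 x + m x * (y1 x)\<^sup>2 + m x * y x * y2 x) / \<mu>) * \<omega> x = \<omega> x * g' x"
          using corrected_energy_identity[OF v _ ode', where K = K and s = "\<alpha> + \<beta> + 1"] \<mu>
          by (simp only: g_def g'_def)
      qed
    qed
    have wpos: "\<omega> x > 0" if "x \<in> R" for x
      using that jacobi_weight_pos by (auto simp: \<omega>_def R_def)
    have sQ: "\<bar>\<alpha> + \<beta> + 1\<bar> \<le> Q" by (simp add: Q_def)
    note b = corrected_energy_bounds[OF Rx(2,3) \<mu> c _ mQ sQ _ K_def]
    have K3h: "K3 / 2 = K * (Q + 2) / sqrt c + K + Q" by (simp add: K3_def)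
    have h: "(y x)\<^sup>2 + (1 - x\<^sup>2) * (y1 x)\<^sup>2 / \<mu> \<le> 2 * g x"
        "g x \<le> C2 * ((y x)\<^sup>2 + (1 - x\<^sup>2) * (y1 x)\<^sup>2 / \<mu>)"
        "\<bar>g' x\<bar> \<le> K3 / 2 * ((y x)\<^sup>2 + (1 - x\<^sup>2) * (y1 x)\<^sup>2 / \<mu>) / (sqrt (\<mu> * (1 - x\<^sup>2)) * (1 - x\<^sup>2))"
      if xR: "x \<in> R" for x
      using b[OF xR xR, of x x "y x" "y1 x"] Rx(1)[OF xR] xR
      unfolding g_def g'_def C2_def K3h by (simp_all add: R_def)
    have E: "jacobi_energy \<alpha> \<beta> \<mu> p x \<le> 2 * (\<omega> x * g x)" "\<omega> x * g x \<le> C2 * jacobi_energy \<alpha> \<beta> \<mu> p x"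
      if xR: "x \<in> R" for x
      using mult_left_mono[OF h(1)[OF xR] less_imp_le[OF wpos[OF xR]]]
        mult_left_mono[OF h(2)[OF xR] less_imp_le[OF wpos[OF xR]]]
      by (simp_all add: jacobi_energy_def \<omega>_def y_def y1_def mult_ac)
    have kd: "(k has_real_derivative K3 / (sqrt (\<mu> * (1 - x\<^sup>2)) * (1 - x\<^sup>2))) (at x)" if xR: "x \<in> R" for x
      unfolding k_def using DERIV_cmult[OF DERIV_x_over_sqrt[OF Rx(1)[OF xR] \<mu>], of K3] by simp
    have le: "\<bar>\<omega> x * g' x\<bar> \<le> K3 / (sqrt (\<mu> * (1 - x\<^sup>2)) * (1 - x\<^sup>2)) * (\<omega> x * g x)" if xR: "x \<in> R" for x
    proof -
      have "\<bar>g' x\<bar> \<le> K3 / 2 * (2 * g x) / (sqrt (\<mu> * (1 - x\<^sup>2)) * (1 - x\<^sup>2))"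
        using Rx[OF xR] \<mu> K30 h(1)[OF xR]
        by (intro order_trans[OF h(3)[OF xR]] divide_right_mono mult_left_mono) auto
      from mult_left_mono[OF this less_imp_le[OF wpos[OF xR]]]
      show ?thesis using wpos[OF xR] by (simp add: abs_mult mult_ac)
    qed
    have kb: "\<bar>k x\<bar> \<le> K3 / sqrt c" if xR: "x \<in> R" for x
    proof -
      have "\<bar>k x\<bar> = K3 * (\<bar>x\<bar> / sqrt (\<mu> * (1 - x\<^sup>2)))" using K30 Rx[OF xR] \<mu> by (simp add: k_def abs_mult)
      also have "\<dots> \<le> K3 * (1 / sqrt c)"
        using K30 Rx[OF xR] c xR by (intro mult_left_mono frac_le) (auto simp: R_def)
      finally show ?thesis by simp
    qed
    have Rxz: "x \<in> R" "z \<in> R" using x z cx cz by (auto simp: R_def)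
    \<comment> \<open>The region is an interval, since \<open>1 - t\<^sup>2\<close> is at least the
      smaller of its values at the ends of a segment around \<open>t\<close>. Gronwall therefore
      applies on the whole segment.\<close>
    have sub: "{l..u} \<subseteq> R" if "l \<in> R" "u \<in> R" for l u
    proof
      fix t assume t: "t \<in> {l..u}"
      then have "\<bar>t\<bar> \<le> \<bar>l\<bar> \<or> \<bar>t\<bar> \<le> \<bar>u\<bar>" by auto
      then have "t\<^sup>2 \<le> l\<^sup>2 \<or> t\<^sup>2 \<le> u\<^sup>2" by (simp add: abs_le_square_iff)
      then have "1 - l\<^sup>2 \<le> 1 - t\<^sup>2 \<or> 1 - u\<^sup>2 \<le> 1 - t\<^sup>2" by auto
      then have "\<mu> * (1 - l\<^sup>2) \<le> \<mu> * (1 - t\<^sup>2) \<or> \<mu> * (1 - u\<^sup>2) \<le> \<mu> * (1 - t\<^sup>2)" using \<mu> by auto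
      then show "t \<in> R" using that t by (auto simp: R_def)
    qed
    have "(y z)\<^sup>2 + (1 - z\<^sup>2) * (y1 z)\<^sup>2 / \<mu> \<ge> 0" using Rx[OF Rxz(2)] \<mu> by simp
    then have gz: "g z \<ge> 0" using h(1)[OF Rxz(2)] by linarith
    have gron: "\<omega> x * g x \<le> \<omega> z * g z * exp \<bar>k x - k z\<bar>"
    proof (cases "x \<le> z")
      case True
      have "\<omega> x * g x \<le> \<omega> z * g z * exp (k z - k x)"
        by (rule gronwall_two_sided(2)[OF True Gd kd le]) (use sub[OF Rxz] in auto)
      also have "\<dots> \<le> \<omega> z * g z * exp \<bar>k x - k z\<bar>"
        using wpos[OF Rxz(2)] gz by (intro mult_left_mono mult_nonneg_nonneg) auto
      finally show ?thesis .
    next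
      case False
      then have zx: "z \<le> x" by simp
      have "\<omega> x * g x \<le> \<omega> z * g z * exp (k x - k z)"
        by (rule gronwall_two_sided(1)[OF zx Gd kd le]) (use sub[OF Rxz(2,1)] in auto)
      also have "\<dots> \<le> \<omega> z * g z * exp \<bar>k x - k z\<bar>"
        using wpos[OF Rxz(2)] gz by (intro mult_left_mono mult_nonneg_nonneg) auto
      finally show ?thesis .
    qed
    have Ez: "0 \<le> jacobi_energy \<alpha> \<beta> \<mu> p z"
      unfolding jacobi_energy_def using Rx[OF Rxz(2)] \<mu> wpos[OF Rxz(2)] by (simp add: \<omega>_def)
    have "\<bar>k x - k z\<bar> \<le> 2 * K3 / sqrt c" using kb[OF Rxz(1)] kb[OF Rxz(2)] by simp
    then have ex: "exp \<bar>k x - k z\<bar> \<le> exp (2 * K3 / sqrt c)" by simp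
    have "jacobi_energy \<alpha> \<beta> \<mu> p x \<le> 2 * (\<omega> z * g z * exp \<bar>k x - k z\<bar>)"
      using E(1)[OF Rxz(1)] gron by linarith
    also have "\<dots> \<le> 2 * (C2 * jacobi_energy \<alpha> \<beta> \<mu> p z * exp (2 * K3 / sqrt c))"
      by (intro mult_left_mono mult_mono[OF E(2)[OF Rxz(2)] ex]) (use Ez C21 in auto)
    finally show "jacobi_energy \<alpha> \<beta> \<mu> p x \<le> C * jacobi_energy \<alpha> \<beta> \<mu> p z"
      by (simp add: C_def mult_ac)
  qed
qed

text \<open>The divergence form, integrated from \<open>x\<close> to 1 where the weighted derivative
  vanishes, gives \<mu> M times the mass of the weight beyond \<open>x\<close>. That mass is of
  order \<open>(1 - x) powr (\<alpha> + 1)\<close>, the same as the factor in front of the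
  derivative. Monotonicity of \<open>W\<close> plus and minus \<open>B * S\<close> stands in for the
  integral, whose integrand may be singular at 1. At 1 itself the equation gives the derivative
  directly.\<close>

lemma jacobi_deriv_bound_near_1:
  assumes \<alpha>: "\<alpha> > -1" and \<mu>: "\<mu> > 0" and ode: "jacobi_ode \<alpha> \<beta> \<mu> p" and x: "0 \<le> x" "x \<le> 1"
    and M: "\<And>t. t \<in> {x..1} \<Longrightarrow> \<bar>poly p t\<bar> \<le> M" and \<beta>: "\<beta> > -1"
  shows "\<bar>poly (pderiv p) x\<bar> \<le> 2 powr \<bar>\<beta>\<bar> / (\<alpha> + 1) * \<mu> * M"
proof (cases "x = 1")
  case True
  have "2 * (\<alpha> + 1) * poly (pderiv p) 1 = \<mu> * poly p 1"
    using ode[unfolded jacobi_ode_def, rule_format, of 1] by (simp add: algebra_simps)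
  then have "\<bar>2 * (\<alpha> + 1) * poly (pderiv p) 1\<bar> = \<mu> * \<bar>poly p 1\<bar>" using \<mu> by (simp add: abs_mult)
  then have "2 * (\<alpha> + 1) * \<bar>poly (pderiv p) 1\<bar> = \<mu> * \<bar>poly p 1\<bar>" using \<alpha> by (simp add: abs_mult)
  also have "\<dots> \<le> \<mu> * M" using \<mu> M[of 1] x by (intro mult_left_mono) auto
  finally have "\<bar>poly (pderiv p) 1\<bar> \<le> \<mu> * M / (2 * (\<alpha> + 1))" using \<alpha> by (simp add: field_simps)
  also have "\<dots> \<le> \<mu> * M * 2 powr \<bar>\<beta>\<bar> / (\<alpha> + 1)"
  proof -
    have "1 / 2 \<le> (2::real) powr \<bar>\<beta>\<bar>" using ge_one_powr_ge_zero[of 2 "\<bar>\<beta>\<bar>"] by simp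
    moreover have "\<mu> * M / (\<alpha> + 1) \<ge> 0" using \<alpha> \<mu> order_trans[OF abs_ge_zero M[of 1]] x by simp
    ultimately have "\<mu> * M / (\<alpha> + 1) * (1 / 2) \<le> \<mu> * M / (\<alpha> + 1) * 2 powr \<bar>\<beta>\<bar>" by (rule mult_left_mono)
    moreover have "\<mu> * M / (2 * (\<alpha> + 1)) = \<mu> * M / (\<alpha> + 1) * (1 / 2)" by simp
    ultimately show ?thesis by (simp only: times_divide_eq_left)
  qed
  finally show ?thesis using True by (simp add: mult_ac)
next
  case False
  then have x1: "x < 1" using x by simp
  define B where "B = 2 powr \<bar>\<beta>\<bar> / (\<alpha> + 1) * \<mu> * M"
  define W where "W t = jacobi_weight (\<alpha> + 1) (\<beta> + 1) t * poly (pderiv p) t" for t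
  define S where "S t = (1 - t) powr (\<alpha> + 1)" for t :: real
  have M0: "M \<ge> 0" using order_trans[OF abs_ge_zero M[of 1]] x by simp
  have Wd: "(W has_real_derivative jacobi_weight \<alpha> \<beta> t * (- \<mu> * poly p t)) (at t)"
    if "x < t" "t < 1" for t
  proof -
    have "(1 - t\<^sup>2) * poly (pderiv (pderiv p)) t + (\<beta> - \<alpha> - (\<alpha> + \<beta> + 2) * t) * poly (pderiv p) t
      = - \<mu> * poly p t"
      using ode[unfolded jacobi_ode_def, rule_format, of t] by linarith
    then show ?thesis unfolding W_def
      using jacobi_operator_self_adjoint[of t \<alpha> \<beta> "pderiv p"] that x by simp
  qed
  have Sd: "(S has_real_derivative - ((\<alpha> + 1) * (1 - t) powr \<alpha>)) (at t)" if "x < t" "t < 1" for t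
  proof -
    have "((\<lambda>x. 1 - x) has_real_derivative - 1) (at t)" by (auto intro!: derivative_eq_intros)
    from DERIV_fun_powr[OF this, of "\<alpha> + 1"] that
    have "(S has_real_derivative (\<alpha> + 1) * (1 - t) powr (\<alpha> + 1 - of_nat 1) * - 1) (at t)"
      by (simp only: S_def[abs_def])
    then show ?thesis by (rule DERIV_cong) (simp add: algebra_simps)
  qed
  have cont: "continuous_on {x..1} W" "continuous_on {x..1} S"
    unfolding W_def S_def using \<alpha> \<beta> x
    by (auto intro!: continuous_intros continuous_on_subset[OF jacobi_weight_continuous] continuous_on_powr')
  have bd: "\<bar>jacobi_weight \<alpha> \<beta> t * (- \<mu> * poly p t)\<bar> \<le> B * ((\<alpha> + 1) * (1 - t) powr \<alpha>)"
    if t: "x < t" "t < 1" for t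
  proof -
    have "(1 + t) powr \<beta> \<le> (1 + t) powr \<bar>\<beta>\<bar>" using t x by (intro powr_mono) auto
    also have "\<dots> \<le> 2 powr \<bar>\<beta>\<bar>" using t x by (intro powr_mono2) auto
    finally have "(1 - t) powr \<alpha> * (1 + t) powr \<beta> * (\<mu> * \<bar>poly p t\<bar>) \<le> (1 - t) powr \<alpha> * 2 powr \<bar>\<beta>\<bar> * (\<mu> * M)"
      using t \<mu> M[of t] M0 by (intro mult_mono mult_left_mono) auto
    then show ?thesis using \<alpha> \<mu> by (simp add: B_def jacobi_weight_def abs_mult mult_ac)
  qed
  have "W 1 + B * S 1 \<le> W x + B * S x"
  proof (rule DERIV_nonpos_imp_decreasing_open[OF less_imp_le[OF x1]])
    fix t assume t: "x < t" "t < 1"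
    have "((\<lambda>t. W t + B * S t) has_real_derivative
       jacobi_weight \<alpha> \<beta> t * (- \<mu> * poly p t) + B * (- ((\<alpha> + 1) * (1 - t) powr \<alpha>))) (at t)"
      by (intro DERIV_add DERIV_cmult Wd Sd t)
    moreover have "jacobi_weight \<alpha> \<beta> t * (- \<mu> * poly p t) + B * (- ((\<alpha> + 1) * (1 - t) powr \<alpha>)) \<le> 0"
      using abs_le_D1[OF bd[OF t]] by simp
    ultimately show "\<exists>y. ((\<lambda>t. W t + B * S t) has_real_derivative y) (at t) \<and> y \<le> 0" by blast
  qed (intro continuous_intros cont)
  moreover have "W x - B * S x \<le> W 1 - B * S 1"
  proof (rule DERIV_nonneg_imp_increasing_open[OF less_imp_le[OF x1]])
    fix t assume t: "x < t" "t < 1"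
    have "((\<lambda>t. W t - B * S t) has_real_derivative
       jacobi_weight \<alpha> \<beta> t * (- \<mu> * poly p t) - B * (- ((\<alpha> + 1) * (1 - t) powr \<alpha>))) (at t)"
      by (intro DERIV_diff DERIV_cmult Wd Sd t)
    moreover have "0 \<le> jacobi_weight \<alpha> \<beta> t * (- \<mu> * poly p t) - B * (- ((\<alpha> + 1) * (1 - t) powr \<alpha>))"
      using abs_le_D2[OF bd[OF t]] by simp
    ultimately show "\<exists>y. ((\<lambda>t. W t - B * S t) has_real_derivative y) (at t) \<and> 0 \<le> y" by blast
  qed (intro continuous_intros cont)
  moreover have "W 1 = 0" "B * S 1 = 0" by (auto simp: W_def S_def)
  ultimately have WS: "\<bar>W x\<bar> \<le> B * S x" by linarith
  have S0: "S x > 0" using x1 by (simp add: S_def)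
  have "1 \<le> (1 + x) powr (\<beta> + 1)" using x \<beta> by (intro ge_one_powr_ge_zero) auto
  then have "S x * 1 * \<bar>poly (pderiv p) x\<bar> \<le> S x * (1 + x) powr (\<beta> + 1) * \<bar>poly (pderiv p) x\<bar>"
    using S0 by (intro mult_right_mono mult_left_mono) auto
  also have "\<dots> = \<bar>W x\<bar>" using x x1 by (simp add: W_def S_def jacobi_weight_def abs_mult)
  finally have "S x * \<bar>poly (pderiv p) x\<bar> \<le> S x * B" using WS by (simp add: mult_ac)
  then have "\<bar>poly (pderiv p) x\<bar> \<le> B" using S0 by simp
  then show ?thesis by (simp add: B_def)
qed

text \<open>Let M be the maximum of the modulus of \<open>p\<close> on an interval of length
  \<open>c / \<mu>\<close> ending at 1. The derivative bound makes \<open>p\<close> vary there by at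
  most \<open>\<kappa> * c * M\<close>, which is at most M/3 by the choice of \<open>c\<close>.
  Hence M is at most 3/2 times the modulus of the value at 1, and M/3 at most half of it.\<close>

lemma jacobi_near_1:
  assumes \<alpha>: "\<alpha> > -1" and \<beta>: "\<beta> > -1"
  shows "\<exists>c C. 0 < c \<and> c \<le> 1/2 \<and> 0 < C \<and> (\<forall>\<mu>\<ge>1. \<forall>p. jacobi_ode \<alpha> \<beta> \<mu> p \<longrightarrow>
    (\<forall>x\<in>{1 - c / \<mu>..1}. \<bar>poly p x - poly p 1\<bar> \<le> \<bar>poly p 1\<bar> / 2 \<and> \<bar>poly (pderiv p) x\<bar> \<le> C * \<mu> * \<bar>poly p 1\<bar>))"
proof -
  define \<kappa> where "\<kappa> = 2 powr \<bar>\<beta>\<bar> / (\<alpha> + 1)"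
  define c where "c = min (1/2) (1 / (3 * \<kappa>))"
  have \<kappa>: "\<kappa> > 0" using \<alpha> by (simp add: \<kappa>_def)
  have c: "0 < c" "c \<le> 1/2" "c \<le> 1 / (3 * \<kappa>)" using \<kappa> by (auto simp: c_def)
  have c\<kappa>: "\<kappa> * c \<le> 1/3" using c(3) \<kappa> by (simp add: field_simps)
  have main: "\<bar>poly p x - poly p 1\<bar> \<le> \<bar>poly p 1\<bar> / 2 \<and> \<bar>poly (pderiv p) x\<bar> \<le> 3/2 * \<kappa> * \<mu> * \<bar>poly p 1\<bar>"
    if \<mu>: "\<mu> \<ge> 1" and ode: "jacobi_ode \<alpha> \<beta> \<mu> p" and x: "x \<in> {1 - c / \<mu>..1}" for \<mu> p x
  proof -
    define l where "l = 1 - c / \<mu>"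
    have "c / \<mu> \<le> (1/2) / 1" using c \<mu> by (intro frac_le) auto
    then have l: "1/2 \<le> l" "l \<le> 1" using c \<mu> by (auto simp: l_def)
    have "\<exists>\<xi>\<in>{l..1}. \<forall>t\<in>{l..1}. \<bar>poly p t\<bar> \<le> \<bar>poly p \<xi>\<bar>"
      using l by (intro continuous_attains_sup) (auto intro!: continuous_intros)
    then obtain \<xi> where \<xi>: "\<xi> \<in> {l..1}" "\<And>t. t \<in> {l..1} \<Longrightarrow> \<bar>poly p t\<bar> \<le> \<bar>poly p \<xi>\<bar>" by blast
    define M where "M = \<bar>poly p \<xi>\<bar>"
    have d: "\<bar>poly (pderiv p) t\<bar> \<le> \<kappa> * \<mu> * M" if "t \<in> {l..1}" for t
      unfolding \<kappa>_def M_def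
      by (rule jacobi_deriv_bound_near_1[OF \<alpha> _ ode]) (use that l \<mu> \<xi> \<beta> in auto)
    have diff: "\<bar>poly p t - poly p 1\<bar> \<le> M / 3" if t: "t \<in> {l..1}" for t
    proof -
      have "norm (poly p t - poly p 1) \<le> (\<kappa> * \<mu> * M) * norm (t - 1)"
        by (rule field_differentiable_bound[of "{l..1}"])
           (use d t l in \<open>auto intro!: DERIV_subset[OF poly_DERIV]\<close>)
      also have "\<dots> \<le> (\<kappa> * \<mu> * M) * (c / \<mu>)"
        using t \<kappa> \<mu> by (intro mult_left_mono) (auto simp: l_def M_def)
      also have "\<dots> = (\<kappa> * c) * M" using \<mu> by simp
      also have "\<dots> \<le> (1/3) * M" using c\<kappa> by (intro mult_right_mono) (auto simp: M_def)
      finally show ?thesis by simp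
    qed
    have "M \<le> \<bar>poly p 1\<bar> + M / 3" using diff[OF \<xi>(1)] unfolding M_def by linarith
    then have M: "M \<le> 3/2 * \<bar>poly p 1\<bar>" by simp
    have xl: "x \<in> {l..1}" using x by (simp add: l_def)
    have "\<kappa> * \<mu> * M \<le> \<kappa> * \<mu> * (3/2 * \<bar>poly p 1\<bar>)" using \<kappa> \<mu> M by (intro mult_left_mono) auto
    then show ?thesis using diff[OF xl] d[OF xl] M by auto
  qed
  show ?thesis
    by (rule exI[of _ c], rule exI[of _ "3/2 * \<kappa>"]) (use c \<kappa> main in auto)
qed

section \<open>Size of solutions up to the ends of the interval\<close>

lemma powr_le_of_ratio:
  fixes u v e K :: real
  assumes "u > 0" "v > 0" "u \<le> K * v" "v \<le> K * u"
  shows "u powr e \<le> K powr \<bar>e\<bar> * v powr e"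
proof -
  have K: "K > 0" using assms by (smt (verit) mult_nonpos_nonneg)
  show ?thesis
  proof (cases "e \<ge> 0")
    case True
    have "u powr e \<le> (K * v) powr e" using assms True by (intro powr_mono2) auto
    then show ?thesis using True K assms by (simp add: powr_mult)
  next
    case False
    have "u powr e \<le> (v / K) powr e" using assms False K by (intro powr_mono2') (auto simp: field_simps)
    then show ?thesis using False K assms by (simp add: powr_divide powr_minus_divide)
  qed
qed

lemma jacobi_energy_reflect:
  "jacobi_energy \<beta> \<alpha> \<mu> (pcompose p [:0, -1:]) (- x) = jacobi_energy \<alpha> \<beta> \<mu> p x"
proof -
  have "pderiv [:0, -1::real:] = [:-1:]" by (simp add: pderiv_pCons)
  then show ?thesis
    by (simp add: jacobi_energy_def jacobi_weight_def pderiv_pcompose poly_pcompose mult_ac)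
qed

lemma jacobi_energy_nonneg: "\<mu> > 0 \<Longrightarrow> x \<in> {-1..1} \<Longrightarrow> jacobi_energy \<alpha> \<beta> \<mu> p x \<ge> 0"
  unfolding jacobi_energy_def jacobi_weight_def
  by (intro mult_nonneg_nonneg add_nonneg_nonneg divide_nonneg_pos) (auto simp: abs_square_le_1)

lemma poly_eq_0_of_zero_on_interval:
  fixes p :: "real poly"
  assumes "l < u" "\<And>x. x \<in> {l..u} \<Longrightarrow> poly p x = 0"
  shows "p = 0"
proof (rule ccontr)
  assume "p \<noteq> 0"
  then have "finite {x. poly p x = 0}" by (rule poly_roots_finite)
  moreover have "{l..u} \<subseteq> {x. poly p x = 0}" using assms by auto
  moreover have "infinite {l..u}" using assms by (simp add: infinite_Icc)
  ultimately show False using finite_subset by blast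
qed

text \<open>A substitute for uniqueness in the initial value problem: if the energy vanished at one
  point, comparability would spread this to an interval of zeros of \<open>p\<close>.\<close>

lemma jacobi_energy_pos:
  assumes "\<mu> > 0" "jacobi_ode \<alpha> \<beta> \<mu> p" "p \<noteq> 0" "x \<in> {-1<..<1}"
  shows "jacobi_energy \<alpha> \<beta> \<mu> p x > 0"
proof (rule ccontr)
  assume "\<not> ?thesis"
  moreover have "jacobi_energy \<alpha> \<beta> \<mu> p x \<ge> 0" by (rule jacobi_energy_nonneg) (use assms in auto)
  ultimately have e0: "jacobi_energy \<alpha> \<beta> \<mu> p x = 0" by linarith
  \<comment> \<open>Small enough for \<open>x\<close> and all of \<open>[0, 1/2]\<close> to lie in
    one region of comparability; \<open>3/4\<close> is the least value of
    \<open>1 - z\<^sup>2\<close> on that interval.\<close>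
  define c where "c = \<mu> * min (1 - x\<^sup>2) (3/4)"
  have "1 - x\<^sup>2 > 0" using assms by (simp add: abs_square_less_1 abs_less_iff)
  then have c: "c > 0" "c \<le> \<mu> * (1 - x\<^sup>2)" "c \<le> \<mu> * (3/4)"
    using assms(1) min.cobounded2[of "1 - x\<^sup>2" "3/4"] by (auto simp: c_def)
  obtain C where C: "\<forall>\<mu> p x z. \<mu> > 0 \<longrightarrow> jacobi_ode \<alpha> \<beta> \<mu> p \<longrightarrow> x \<in> {-1<..<1} \<longrightarrow> z \<in> {-1<..<1} \<longrightarrow>
     c \<le> \<mu> * (1 - x\<^sup>2) \<longrightarrow> c \<le> \<mu> * (1 - z\<^sup>2) \<longrightarrow> jacobi_energy \<alpha> \<beta> \<mu> p x \<le> C * jacobi_energy \<alpha> \<beta> \<mu> p z"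
    using jacobi_energy_comparable[OF c(1)] by blast
  have "poly p z = 0" if z: "z \<in> {0..1/2}" for z
  proof -
    have "z\<^sup>2 \<le> (1/2)\<^sup>2" using z by (intro power_mono) auto
    then have "3/4 \<le> 1 - z\<^sup>2" by (simp add: power2_eq_square)
    then have "\<mu> * (3/4) \<le> \<mu> * (1 - z\<^sup>2)" using assms(1) by (intro mult_left_mono) auto
    then have "c \<le> \<mu> * (1 - z\<^sup>2)" using c by linarith
    then have "jacobi_energy \<alpha> \<beta> \<mu> p z \<le> 0"
      using C[rule_format, OF assms(1,2) _ assms(4) _ c(2), of z] z e0 by auto
    moreover have "jacobi_weight (\<alpha> + 1/2) (\<beta> + 1/2) z > 0" using z by (intro jacobi_weight_pos) auto
    moreover have "(1 - z\<^sup>2) * (poly (pderiv p) z)\<^sup>2 / \<mu> \<ge> 0"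
      using \<open>3/4 \<le> 1 - z\<^sup>2\<close> assms(1) by simp
    ultimately have "(poly p z)\<^sup>2 + (1 - z\<^sup>2) * (poly (pderiv p) z)\<^sup>2 / \<mu> \<le> 0"
      unfolding jacobi_energy_def by (simp add: mult_le_0_iff)
    then have "(poly p z)\<^sup>2 \<le> 0" using \<open>(1 - z\<^sup>2) * (poly (pderiv p) z)\<^sup>2 / \<mu> \<ge> 0\<close> by linarith
    then show ?thesis by simp
  qed
  then show False using poly_eq_0_of_zero_on_interval[of 0 "1/2" p] assms(3) by auto
qed

text \<open>The energy at 0 serves as the common scale. Comparability reaches up to distance
  \<open>c / \<mu>\<close> from 1; beyond, \<open>p\<close> lies between one half and three halves
  of its end value, so it has no zero there and changes by a factor of at most 3. The shift by
  \<open>1/\<mu>\<close> in the weight freezes it at this distance, so that one formula holds up to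
  the end.\<close>

lemma jacobi_estimates_right:
  assumes \<alpha>: "\<alpha> > -1" and \<beta>: "\<beta> > -1"
  shows "\<exists>c C. 0 < c \<and> c \<le> 1/2 \<and> 0 < C \<and> (\<forall>\<mu>\<ge>1. \<forall>p. jacobi_ode \<alpha> \<beta> \<mu> p \<longrightarrow> p \<noteq> 0 \<longrightarrow>
     (\<forall>x\<in>{0..1}. (poly p x)\<^sup>2 * ((1 - x + 1/\<mu>) powr (\<alpha> + 1/2) * (1 + x + 1/\<mu>) powr (\<beta> + 1/2))
       \<le> C * jacobi_energy \<alpha> \<beta> \<mu> p 0) \<and>
     (\<forall>x\<in>{0..1}. poly p x = 0 \<longrightarrow> c \<le> \<mu> * (1 - x)) \<and>
     jacobi_energy \<alpha> \<beta> \<mu> p 0 \<le> C * \<mu> powr (- (\<alpha> + 1/2)) * (poly p 1)\<^sup>2)"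
proof -
  obtain c C1 where c: "0 < c" "c \<le> 1/2" and C1: "0 < C1"
    and near: "\<And>\<mu> p x. \<mu> \<ge> 1 \<Longrightarrow> jacobi_ode \<alpha> \<beta> \<mu> p \<Longrightarrow> x \<in> {1 - c / \<mu>..1} \<Longrightarrow>
      \<bar>poly p x - poly p 1\<bar> \<le> \<bar>poly p 1\<bar> / 2 \<and> \<bar>poly (pderiv p) x\<bar> \<le> C1 * \<mu> * \<bar>poly p 1\<bar>"
    using jacobi_near_1[OF \<alpha> \<beta>] by metis
  obtain D where D: "D \<ge> 1" and comp: "\<And>\<mu> p x z. \<mu> > 0 \<Longrightarrow> jacobi_ode \<alpha> \<beta> \<mu> p \<Longrightarrow> x \<in> {-1<..<1} \<Longrightarrow> z \<in> {-1<..<1} \<Longrightarrow>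
     c \<le> \<mu> * (1 - x\<^sup>2) \<Longrightarrow> c \<le> \<mu> * (1 - z\<^sup>2) \<Longrightarrow> jacobi_energy \<alpha> \<beta> \<mu> p x \<le> D * jacobi_energy \<alpha> \<beta> \<mu> p z"
    using jacobi_energy_comparable[OF c(1), of \<alpha> \<beta>] by metis
  define a where "a = \<alpha> + 1/2"
  define b where "b = \<beta> + 1/2"
  define P where "P = (3 / c) powr \<bar>a\<bar> * 3 powr \<bar>b\<bar>"
  define C3 where "C3 = 9 * D * P"
  define C4 where "C4 = D * (c powr a * 2 powr \<bar>b\<bar>) * (9/4 + 2 * c * C1\<^sup>2)"
  have P0: "P > 0" using c by (simp add: P_def)
  have main: "(\<forall>x\<in>{0..1}. (poly p x)\<^sup>2 * ((1 - x + 1/\<mu>) powr a * (1 + x + 1/\<mu>) powr b)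
    \<le> C3 * jacobi_energy \<alpha> \<beta> \<mu> p 0) \<and>
     (\<forall>x\<in>{0..1}. poly p x = 0 \<longrightarrow> c \<le> \<mu> * (1 - x)) \<and>
     jacobi_energy \<alpha> \<beta> \<mu> p 0 \<le> C4 * \<mu> powr (- a) * (poly p 1)\<^sup>2"
    if \<mu>: "\<mu> \<ge> 1" and ode: "jacobi_ode \<alpha> \<beta> \<mu> p" and p: "p \<noteq> 0" for \<mu> p
  proof -
    let ?E = "jacobi_energy \<alpha> \<beta> \<mu> p"
    define x0 where "x0 = 1 - c / \<mu>"
    have c\<mu>: "0 < c / \<mu>" "c / \<mu> \<le> 1/2" using c \<mu> frac_le[of c "1/2" 1 \<mu>] by auto
    have x0: "1/2 \<le> x0" "x0 < 1" using c\<mu> by (auto simp: x0_def)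
    have mid: "c \<le> \<mu> * (1 - x\<^sup>2)" if "0 \<le> x" "x \<le> x0" for x
    proof -
      have "c = \<mu> * (c / \<mu>)" using \<mu> by simp
      also have "\<dots> \<le> \<mu> * ((1 - x) * 1)" using that \<mu> by (intro mult_left_mono) (auto simp: x0_def)
      also have "\<dots> \<le> \<mu> * ((1 - x) * (1 + x))" using that \<mu> x0 by (intro mult_left_mono) auto
      finally show ?thesis by (simp add: power2_eq_square algebra_simps)
    qed
    have E0: "?E 0 \<ge> 0" by (rule jacobi_energy_nonneg) (use \<mu> in auto)
    have en: "(poly p x)\<^sup>2 * jacobi_weight a b x \<le> D * ?E 0" if x: "0 \<le> x" "x \<le> x0" for x
    proof -
      have "jacobi_weight a b x * ((poly p x)\<^sup>2 + 0) \<le> ?E x"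
        unfolding jacobi_energy_def a_def b_def using x x0 \<mu>
        by (intro mult_left_mono add_left_mono divide_nonneg_nonneg mult_nonneg_nonneg less_imp_le[OF
          jacobi_weight_pos])
           (auto simp: abs_square_le_1)
      also have "\<dots> \<le> D * ?E 0" by (rule comp) (use \<mu> ode x x0 mid[of x] mid[of 0] in auto)
      finally show ?thesis by (simp add: mult.commute)
    qed
    have p1: "poly p 1 \<noteq> 0"
    proof
      assume z: "poly p 1 = 0"
      have "poly p x = 0" if "x \<in> {x0..1}" for x
        using near[OF \<mu> ode, of x] that z by (auto simp: x0_def)
      then show False using p poly_eq_0_of_zero_on_interval[OF x0(2)] by blast
    qed
    have close: "\<bar>poly p 1\<bar> / 2 \<le> \<bar>poly p x\<bar>" "\<bar>poly p x\<bar> \<le> 3/2 * \<bar>poly p 1\<bar>" if "x \<in> {x0..1}" for x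
      using near[OF \<mu> ode, of x] that by (auto simp: x0_def abs_if split: if_splits)
    have U: "(poly p x)\<^sup>2 * ((1 - x + 1/\<mu>) powr a * (1 + x + 1/\<mu>) powr b) \<le> C3 * ?E 0" if x: "x \<in> {0..1}" for x
    proof -
      have xb: "0 \<le> x" "x \<le> 1" using x by auto
      \<comment> \<open>The point is pulled back to where comparability holds. The shifted weight
        changes by bounded factors, and the square of \<open>p\<close> by at most
        \<open>9 = 3\<^sup>2\<close>.\<close>
      define x' where "x' = min x x0"
      have x': "0 \<le> x'" "x' \<le> x0" "x' \<le> x" using x x0 by (auto simp: x'_def)
      have \<mu>1: "0 < 1 / \<mu>" "1 / \<mu> \<le> 1" using \<mu> by auto
      have cx: "1 / \<mu> \<le> (1 - x') / c"
      proof -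
        have "c / \<mu> \<le> 1 - x'" using x' by (simp add: x0_def)
        then have "c / \<mu> / c \<le> (1 - x') / c" using c by (intro divide_right_mono) auto
        then show ?thesis using c by simp
      qed
      have s1: "1 - x \<le> 1 - x'" using x' by simp
      have "1 - x' \<le> (1 - x') / c" using c x' x0 by (simp add: le_divide_eq mult_left_le)
      then have r1: "1 - x + 1 / \<mu> \<le> 3 / c * (1 - x')"
      proof -
        have "1 - x + 1 / \<mu> \<le> (1 - x') / c + (1 - x') / c" using cx s1 \<open>1 - x' \<le> (1 - x') / c\<close> by linarith
        also have "\<dots> = 2 / c * (1 - x')" by simp
        also have "\<dots> \<le> 3 / c * (1 - x')" using c x' x0 by (intro mult_right_mono divide_right_mono) auto
        finally show ?thesis .
      qed
      have r2: "1 - x' \<le> 3 / c * (1 - x + 1/\<mu>)"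
      proof -
        have "1 - x' \<le> 1 - x + 1 / \<mu>"
        proof (cases "x \<le> x0")
          case False
          then have "1 - x' = c / \<mu>" by (simp add: x'_def x0_def)
          also have "\<dots> \<le> 1 / \<mu>" using c \<mu> by (intro divide_right_mono) auto
          finally show ?thesis using x by auto
        qed (use \<mu>1 in \<open>auto simp: x'_def\<close>)
        also have "\<dots> = 1 * (1 - x + 1 / \<mu>)" by simp
        also have "\<dots> \<le> 3 / c * (1 - x + 1/\<mu>)" using c x \<mu>1 by (intro mult_right_mono) auto
        finally show ?thesis .
      qed
      have q1: "(1 - x + 1/\<mu>) powr a \<le> (3 / c) powr \<bar>a\<bar> * (1 - x') powr a"
        by (rule powr_le_of_ratio[OF _ _ r1 r2]) (use xb x' x0 \<mu>1 in linarith)+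
      have q2: "(1 + x + 1/\<mu>) powr b \<le> 3 powr \<bar>b\<bar> * (1 + x') powr b"
        proof (rule powr_le_of_ratio)
        show "1 + x + 1/\<mu> \<le> 3 * (1 + x')" using xb x'(1) \<mu>1 unfolding distrib_left by linarith
        show "1 + x' \<le> 3 * (1 + x + 1/\<mu>)" using xb x' \<mu>1 unfolding distrib_left by linarith
      qed (use xb x' \<mu>1 in linarith)+
      have W: "(1 - x + 1/\<mu>) powr a * (1 + x + 1/\<mu>) powr b \<le> P * jacobi_weight a b x'"
        using mult_mono[OF q1 q2] by (simp add: P_def jacobi_weight_def mult_ac)
      have px: "(poly p x)\<^sup>2 \<le> 9 * (poly p x')\<^sup>2"
      proof -
        have "\<bar>poly p x\<bar> \<le> 3 * \<bar>poly p x'\<bar>"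
        proof (cases "x \<le> x0")
          case False
          then show ?thesis using close(2)[of x] close(1)[of x0] x x0 by (simp add: x'_def)
        qed (simp add: x'_def)
        then have "\<bar>poly p x\<bar>\<^sup>2 \<le> (3 * \<bar>poly p x'\<bar>)\<^sup>2" by (intro power_mono) auto
        then show ?thesis by (simp add: power_mult_distrib)
      qed
      have "(poly p x)\<^sup>2 * ((1 - x + 1/\<mu>) powr a * (1 + x + 1/\<mu>) powr b) \<le>
          (9 * (poly p x')\<^sup>2) * (P * jacobi_weight a b x')"
        by (rule mult_mono[OF px W]) auto
      also have "\<dots> = 9 * P * ((poly p x')\<^sup>2 * jacobi_weight a b x')" by simp
      also have "\<dots> \<le> 9 * P * (D * ?E 0)" using en[OF x'(1,2)] P0 by (intro mult_left_mono) auto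
      finally show ?thesis by (simp add: C3_def mult_ac)
    qed
    have Z: "c \<le> \<mu> * (1 - x)" if "x \<in> {0..1}" "poly p x = 0" for x
    proof (rule ccontr)
      assume "\<not> ?thesis"
      then have "1 - x < c / \<mu>" using \<mu> by (simp add: field_simps)
      then have "x \<in> {x0..1}" using that by (simp add: x0_def)
      then show False using close(1)[of x] that p1 by simp
    qed
    \<comment> \<open>At \<open>x0\<close> the end value controls the energy: the derivative is
      O(\<mu>) times the end value and \<open>1 - x0\<^sup>2\<close> is O(1/\<mu>), so both summands
      are of the order of the squared end value. The weight supplies
      \<open>\<mu> powr (- a)\<close>.\<close>
    have "?E 0 \<le> D * ?E x0" by (rule comp) (use \<mu> ode x0 mid[of x0] mid[of 0] in auto)
    also have "?E x0 \<le> (c powr a * 2 powr \<bar>b\<bar> * \<mu> powr (- a)) * ((9/4 + 2 * c * C1\<^sup>2) * (poly p 1)\<^sup>2)"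
      unfolding jacobi_energy_def
    proof (rule mult_mono)
      have "(1 + x0) powr (\<beta> + 1/2) \<le> 2 powr \<bar>\<beta> + 1/2\<bar> * 1 powr (\<beta> + 1/2)"
        by (rule powr_le_of_ratio) (use x0 in auto)
      then have "jacobi_weight (\<alpha> + 1/2) (\<beta> + 1/2) x0 \<le> (c / \<mu>) powr a * 2 powr \<bar>b\<bar>"
        unfolding jacobi_weight_def a_def b_def by (intro mult_mono) (auto simp: x0_def)
      then show "jacobi_weight (\<alpha> + 1/2) (\<beta> + 1/2) x0 \<le> c powr a * 2 powr \<bar>b\<bar> * \<mu> powr (- a)"
        using c \<mu> by (simp add: powr_divide powr_minus_divide)
    next
      have x0i: "x0 \<in> {x0..1}" "x0 \<in> {1 - c / \<mu>..1}" using x0 by (auto simp: x0_def)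
      have "\<bar>poly p x0\<bar>\<^sup>2 \<le> (3/2 * \<bar>poly p 1\<bar>)\<^sup>2" using close[OF x0i(1)] by (intro power_mono) auto
      then have A: "(poly p x0)\<^sup>2 \<le> 9/4 * (poly p 1)\<^sup>2" by (simp add: power_mult_distrib power_divide)
      have "\<bar>poly (pderiv p) x0\<bar>\<^sup>2 \<le> (C1 * \<mu> * \<bar>poly p 1\<bar>)\<^sup>2"
        using near[OF \<mu> ode x0i(2)] by (intro power_mono) auto
      then have B1: "(poly (pderiv p) x0)\<^sup>2 \<le> C1\<^sup>2 * \<mu>\<^sup>2 * (poly p 1)\<^sup>2" by (simp add: power_mult_distrib)
      have B2: "1 - x0\<^sup>2 \<le> 2 * c / \<mu>"
      proof -
        have "1 - x0\<^sup>2 = (c / \<mu>) * (1 + x0)" by (simp add: x0_def power2_eq_square algebra_simps)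
        also have "\<dots> \<le> (c / \<mu>) * 2" using x0 c\<mu> by (intro mult_left_mono) auto
        finally show ?thesis by (simp add: mult_ac)
      qed
      have "(1 - x0\<^sup>2) * (poly (pderiv p) x0)\<^sup>2 / \<mu> \<le> (2 * c / \<mu>) * (C1\<^sup>2 * \<mu>\<^sup>2 * (poly p 1)\<^sup>2) / \<mu>"
        using B1 B2 \<mu> c by (intro divide_right_mono mult_mono) auto
      also have "\<dots> = 2 * c * C1\<^sup>2 * (poly p 1)\<^sup>2" using \<mu> by (simp add: power2_eq_square)
      finally show "(poly p x0)\<^sup>2 + (1 - x0\<^sup>2) * (poly (pderiv p) x0)\<^sup>2 / \<mu> \<le> (9/4 + 2 * c * C1\<^sup>2) * (poly p 1)\<^sup>2"
        using A by (simp add: distrib_right)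
    next
      show "0 \<le> (poly p x0)\<^sup>2 + (1 - x0\<^sup>2) * (poly (pderiv p) x0)\<^sup>2 / \<mu>"
        using x0 \<mu> by (intro add_nonneg_nonneg divide_nonneg_nonneg mult_nonneg_nonneg) (auto
          simp: abs_square_le_1)
    qed simp
    finally have "?E 0 \<le> C4 * \<mu> powr (- a) * (poly p 1)\<^sup>2"
      using D by (simp add: C4_def mult_ac)
    then show ?thesis using U Z by blast
  qed
  have C34: "C3 \<ge> 0" "C4 \<ge> 0" using D P0 c by (auto simp: C3_def C4_def)
  show ?thesis
  proof (rule exI[of _ c], rule exI[of _ "C3 + C4 + 1"], intro conjI allI impI ballI)
    fix \<mu> p assume \<mu>: "\<mu> \<ge> 1" and ode: "jacobi_ode \<alpha> \<beta> \<mu> p" and p: "p \<noteq> 0"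
    have E0: "jacobi_energy \<alpha> \<beta> \<mu> p 0 \<ge> 0" by (rule jacobi_energy_nonneg) (use \<mu> in auto)
    note m = main[OF \<mu> ode p, unfolded a_def b_def]
    show "(poly p x)\<^sup>2 * ((1 - x + 1/\<mu>) powr (\<alpha> + 1/2) * (1 + x + 1/\<mu>) powr (\<beta> + 1/2))
        \<le> (C3 + C4 + 1) * jacobi_energy \<alpha> \<beta> \<mu> p 0" if "x \<in> {0..1}" for x
      using m that E0 C34 mult_right_mono[of C3 "C3 + C4 + 1", OF _ E0] by (smt (verit))
    show "c \<le> \<mu> * (1 - x)" if "x \<in> {0..1}" "poly p x = 0" for x using m that by blast
    have "C4 * (\<mu> powr (- (\<alpha> + 1/2)) * (poly p 1)\<^sup>2) \<le> (C3 + C4 + 1) * (\<mu> powr (- (\<alpha> + 1/2)) * (poly p 1)\<^sup>2)"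
      using C34 by (intro mult_right_mono) auto
    then show "jacobi_energy \<alpha> \<beta> \<mu> p 0 \<le> (C3 + C4 + 1) * \<mu> powr (- (\<alpha> + 1/2)) * (poly p 1)\<^sup>2"
      using m by (simp add: mult.assoc)
  qed (use c C34 in auto)
qed

text \<open>Both ends at once, with the energy at 0 as \<open>A\<close>, since reflection preserves
  it. The interior region is cut off at \<open>c / 2\<close>, not \<open>c\<close>, so that it also
  contains points that are closer to an end than a zero by a factor of up to 2, as the mean value
  theorem will produce.\<close>

lemma jacobi_estimates:
  assumes \<alpha>: "\<alpha> > -1" and \<beta>: "\<beta> > -1"
  shows "\<exists>c C. 0 < c \<and> c \<le> 1/2 \<and> 0 < C \<and> (\<forall>\<mu>\<ge>1. \<forall>p. jacobi_ode \<alpha> \<beta> \<mu> p \<longrightarrow> p \<noteq> 0 \<longrightarrow> (\<exists>A>0.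
     (\<forall>x\<in>{-1..1}. (poly p x)\<^sup>2 * ((1 - x + 1/\<mu>) powr (\<alpha> + 1/2) * (1 + x + 1/\<mu>) powr (\<beta> + 1/2)) \<le> C * A) \<and>
     (\<forall>x\<in>{-1..1}. poly p x = 0 \<longrightarrow> c \<le> \<mu> * (1 - x) \<and> c \<le> \<mu> * (1 + x)) \<and>
     (\<forall>x\<in>{-1..1}. c / 2 \<le> \<mu> * (1 - x) \<longrightarrow> c / 2 \<le> \<mu> * (1 + x) \<longrightarrow>
        jacobi_energy \<alpha> \<beta> \<mu> p x \<le> C * A \<and> A \<le> C * jacobi_energy \<alpha> \<beta> \<mu> p x) \<and>
     A \<le> C * \<mu> powr (- (\<alpha> + 1/2)) * (poly p 1)\<^sup>2))"
proof -
  obtain c1 C1 where c1: "0 < c1" "c1 \<le> 1/2" "0 < C1" and R: "\<And>\<mu> p. \<mu> \<ge> 1 \<Longrightarrow> jacobi_ode \<alpha> \<beta> \<mu> p \<Longrightarrow> p \<noteq> 0 \<Longrightarrow>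
     (\<forall>x\<in>{0..1}. (poly p x)\<^sup>2 * ((1 - x + 1/\<mu>) powr (\<alpha> + 1/2) * (1 + x + 1/\<mu>) powr (\<beta> + 1/2))
       \<le> C1 * jacobi_energy \<alpha> \<beta> \<mu> p 0) \<and>
     (\<forall>x\<in>{0..1}. poly p x = 0 \<longrightarrow> c1 \<le> \<mu> * (1 - x)) \<and>
     jacobi_energy \<alpha> \<beta> \<mu> p 0 \<le> C1 * \<mu> powr (- (\<alpha> + 1/2)) * (poly p 1)\<^sup>2"
    using jacobi_estimates_right[OF \<alpha> \<beta>] by blast
  obtain c2 C2 where c2: "0 < c2" "c2 \<le> 1/2" "0 < C2" and L: "\<And>\<mu> p. \<mu> \<ge> 1 \<Longrightarrow> jacobi_ode \<beta> \<alpha> \<mu> p \<Longrightarrow> p \<noteq> 0 \<Longrightarrow>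
     (\<forall>x\<in>{0..1}. (poly p x)\<^sup>2 * ((1 - x + 1/\<mu>) powr (\<beta> + 1/2) * (1 + x + 1/\<mu>) powr (\<alpha> + 1/2))
       \<le> C2 * jacobi_energy \<beta> \<alpha> \<mu> p 0) \<and>
     (\<forall>x\<in>{0..1}. poly p x = 0 \<longrightarrow> c2 \<le> \<mu> * (1 - x)) \<and>
     jacobi_energy \<beta> \<alpha> \<mu> p 0 \<le> C2 * \<mu> powr (- (\<beta> + 1/2)) * (poly p 1)\<^sup>2"
    using jacobi_estimates_right[OF \<beta> \<alpha>] by blast
  define c where "c = min c1 c2"
  have c: "0 < c" "c \<le> 1/2" "c \<le> c1" "c \<le> c2" using c1 c2 by (auto simp: c_def)
  then have c2': "c / 2 > 0" by simp
  obtain D where D: "D \<ge> 1" and comp: "\<And>\<mu> p x z. \<mu> > 0 \<Longrightarrow> jacobi_ode \<alpha> \<beta> \<mu> p \<Longrightarrow> x \<in> {-1<..<1} \<Longrightarrow> z \<in> {-1<..<1} \<Longrightarrow>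
     c / 2 \<le> \<mu> * (1 - x\<^sup>2) \<Longrightarrow> c / 2 \<le> \<mu> * (1 - z\<^sup>2) \<Longrightarrow> jacobi_energy \<alpha> \<beta> \<mu> p x \<le> D * jacobi_energy \<alpha> \<beta> \<mu> p z"
    using jacobi_energy_comparable[OF c2', of \<alpha> \<beta>] by metis
  define C where "C = C1 + C2 + D"
  show ?thesis
  proof (rule exI[of _ c], rule exI[of _ C], intro conjI allI impI)
    fix \<mu> p assume \<mu>: "\<mu> \<ge> 1" and ode: "jacobi_ode \<alpha> \<beta> \<mu> p" and p: "p \<noteq> 0"
    let ?E = "jacobi_energy \<alpha> \<beta> \<mu> p"
    define q where "q = pcompose p [:0, -1:]"
    have q: "jacobi_ode \<beta> \<alpha> \<mu> q" "q \<noteq> 0" "\<And>x. poly q x = poly p (-x)" "jacobi_energy \<beta> \<alpha> \<mu> q 0 = ?E 0"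
      using jacobi_ode_reflect[OF ode] p jacobi_energy_reflect[of \<beta> \<alpha> \<mu> p 0]
      by (auto simp: q_def poly_pcompose pcompose_eq_0_iff)
    have A: "?E 0 > 0" by (rule jacobi_energy_pos) (use \<mu> ode p in auto)
    note R' = R[OF \<mu> ode p] and L' = L[OF \<mu> q(1,2), unfolded q]
    have U: "(poly p x)\<^sup>2 * ((1 - x + 1/\<mu>) powr (\<alpha> + 1/2) * (1 + x + 1/\<mu>) powr (\<beta> + 1/2)) \<le> C * ?E 0"
      if x: "x \<in> {-1..1}" for x
    proof (cases "x \<ge> 0")
      case True
      have "C1 * ?E 0 \<le> C * ?E 0" using A c2 D by (intro mult_right_mono) (auto simp: C_def)
      then show ?thesis using R' x True by (meson atLeastAtMost_iff order_trans)
    next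
      case False
      have "C2 * ?E 0 \<le> C * ?E 0" using A c1 D by (intro mult_right_mono) (auto simp: C_def)
      then show ?thesis using L' x False by (auto dest!: bspec[of _ _ "-x"] simp: mult_ac)
    qed
    have Z: "c \<le> \<mu> * (1 - x) \<and> c \<le> \<mu> * (1 + x)" if x: "x \<in> {-1..1}" "poly p x = 0" for x
    proof (cases "x \<ge> 0")
      case True
      have "c \<le> \<mu> * (1 - x)" using R' x True c by force
      moreover have "\<mu> * (1 - x) \<le> \<mu> * (1 + x)" using True \<mu> by (intro mult_left_mono) auto
      ultimately show ?thesis by linarith
    next
      case False
      have "c \<le> \<mu> * (1 + x)" using L' x False c by (auto dest!: bspec[of _ _ "-x"])
      moreover have "\<mu> * (1 + x) \<le> \<mu> * (1 - x)" using False \<mu> by (intro mult_left_mono) auto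
      ultimately show ?thesis by linarith
    qed
    have M: "?E x \<le> C * ?E 0 \<and> ?E 0 \<le> C * ?E x"
      if x: "x \<in> {-1..1}" "c / 2 \<le> \<mu> * (1 - x)" "c / 2 \<le> \<mu> * (1 + x)" for x
    proof -
      have xi: "x \<in> {-1<..<1}" using x c by (cases "x = 1 \<or> x = -1") auto
      have "c / 2 \<le> \<mu> * (1 - x\<^sup>2)"
      proof (cases "x \<ge> 0")
        case True
        have "c / 2 \<le> \<mu> * ((1 - x) * 1)" using x by simp
        also have "\<dots> \<le> \<mu> * ((1 - x) * (1 + x))" using True xi \<mu> by (intro mult_left_mono) auto
        finally show ?thesis by (simp add: power2_eq_square algebra_simps)
      next
        case False
        have "c / 2 \<le> \<mu> * (1 * (1 + x))" using x by simp
        also have "\<dots> \<le> \<mu> * ((1 - x) * (1 + x))" using False xi \<mu>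
          by (intro mult_left_mono mult_right_mono) auto
        finally show ?thesis by (simp add: power2_eq_square algebra_simps)
      qed
      moreover have "c / 2 \<le> \<mu> * (1 - 0\<^sup>2)" using c \<mu> by simp
      ultimately have "?E x \<le> D * ?E 0" "?E 0 \<le> D * ?E x"
        using comp[OF _ ode xi, of 0] comp[OF _ ode _ xi, of 0] \<mu> by auto
      moreover have "?E x \<ge> 0" by (rule jacobi_energy_nonneg) (use \<mu> x in auto)
      moreover have "D \<le> C" using c1 c2 by (simp add: C_def)
      ultimately show ?thesis
        using A by (meson less_imp_le mult_right_mono order_trans)
    qed
    have "C1 * (\<mu> powr (- (\<alpha> + 1/2)) * (poly p 1)\<^sup>2) \<le> C * (\<mu> powr (- (\<alpha> + 1/2)) * (poly p 1)\<^sup>2)"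
      using c2 D by (intro mult_right_mono) (auto simp: C_def)
    then have N: "?E 0 \<le> C * \<mu> powr (- (\<alpha> + 1/2)) * (poly p 1)\<^sup>2"
      using R' by (simp add: mult.assoc)
    show "\<exists>A>0.
     (\<forall>x\<in>{-1..1}. (poly p x)\<^sup>2 * ((1 - x + 1/\<mu>) powr (\<alpha> + 1/2) * (1 + x + 1/\<mu>) powr (\<beta> + 1/2)) \<le> C * A) \<and>
     (\<forall>x\<in>{-1..1}. poly p x = 0 \<longrightarrow> c \<le> \<mu> * (1 - x) \<and> c \<le> \<mu> * (1 + x)) \<and>
     (\<forall>x\<in>{-1..1}. c / 2 \<le> \<mu> * (1 - x) \<longrightarrow> c / 2 \<le> \<mu> * (1 + x) \<longrightarrow>
        jacobi_energy \<alpha> \<beta> \<mu> p x \<le> C * A \<and> A \<le> C * jacobi_energy \<alpha> \<beta> \<mu> p x) \<and>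
     A \<le> C * \<mu> powr (- (\<alpha> + 1/2)) * (poly p 1)\<^sup>2"
      using A U Z M N by (intro exI[of _ "?E 0"]) blast
  qed (use c c1 c2 D in \<open>auto simp: C_def\<close>)
qed

section \<open>Interpolation of step functions\<close>

text \<open>The coefficients of the divided difference over \<open>Z\<close>.\<close>

definition node_wt :: "real set \<Rightarrow> real \<Rightarrow> real" where
  "node_wt Z z = 1 / (\<Prod>w\<in>Z - {z}. z - w)"

definition lagr :: "real set \<Rightarrow> real \<Rightarrow> real \<Rightarrow> real" where
  "lagr X b x = (\<Prod>w\<in>X - {b}. (x - w) / (b - w))"

text \<open>The classical recursion for divided differences. It reduces statements about sums of
  weights to sets with one node less.\<close>

lemma divided_difference_rec:
  assumes Z: "finite Z" and a: "a \<in> Z" and b: "b \<in> Z" and ab: "a \<noteq> b"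
  shows "(b - a) * (\<Sum>z\<in>Z. h z * node_wt Z z) =
    (\<Sum>z\<in>Z - {a}. h z * node_wt (Z - {a}) z) - (\<Sum>z\<in>Z - {b}. h z * node_wt (Z - {b}) z)"
proof -
  let ?wa = "\<lambda>z. if z = a then 0 else node_wt (Z - {a}) z"
  let ?wb = "\<lambda>z. if z = b then 0 else node_wt (Z - {b}) z"
  have key: "(b - a) * node_wt Z z = ?wa z - ?wb z" if z: "z \<in> Z" for z
  proof -
    have wa: "node_wt (Z - {a}) z = (z - a) * node_wt Z z" if "z \<noteq> a"
    proof -
      have "(\<Prod>w\<in>Z - {z}. z - w) = (z - a) * (\<Prod>w\<in>Z - {a} - {z}. z - w)"
        using Z a that by (subst prod.remove[of _ a]) (auto intro!: prod.cong)
      then show ?thesis using that by (simp add: node_wt_def)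
    qed
    have wb: "node_wt (Z - {b}) z = (z - b) * node_wt Z z" if "z \<noteq> b"
    proof -
      have "(\<Prod>w\<in>Z - {z}. z - w) = (z - b) * (\<Prod>w\<in>Z - {b} - {z}. z - w)"
        using Z b that by (subst prod.remove[of _ b]) (auto intro!: prod.cong)
      then show ?thesis using that by (simp add: node_wt_def)
    qed
    show ?thesis using wa wb ab by (auto simp: algebra_simps)
  qed
  have "(b - a) * (\<Sum>z\<in>Z. h z * node_wt Z z) = (\<Sum>z\<in>Z. h z * ((b - a) * node_wt Z z))"
    by (simp add: sum_distrib_left mult_ac)
  also have "\<dots> = (\<Sum>z\<in>Z. h z * ?wa z) - (\<Sum>z\<in>Z. h z * ?wb z)"
    unfolding sum_subtractf[symmetric]
    by (rule sum.cong[OF refl], subst key) (auto simp: right_diff_distrib)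
  also have "(\<Sum>z\<in>Z. h z * ?wa z) = (\<Sum>z\<in>Z - {a}. h z * node_wt (Z - {a}) z)"
    using Z by (intro sum.mono_neutral_cong_right) auto
  also have "(\<Sum>z\<in>Z. h z * ?wb z) = (\<Sum>z\<in>Z - {b}. h z * node_wt (Z - {b}) z)"
    using Z by (intro sum.mono_neutral_cong_right) auto
  finally show ?thesis .
qed

text \<open>The divided difference, of order at least 1, of the constant 1.\<close>

lemma sum_node_wt_eq_0:
  assumes "finite Z" "card Z \<ge> 2"
  shows "(\<Sum>z\<in>Z. node_wt Z z) = 0"
  using assms
proof (induction "card Z" arbitrary: Z rule: less_induct)
  case less
  obtain a where a: "a \<in> Z" using less.prems by fastforce
  have "card (Z - {a}) \<ge> 1" using a less.prems by simp
  then obtain b where b: "b \<in> Z - {a}" by (metis card.empty equals0I not_one_le_zero)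
  have ca: "card (Z - {a}) = card Z - 1" "card (Z - {b}) = card Z - 1" using a b less.prems by auto
  have eq: "(b - a) * (\<Sum>z\<in>Z. node_wt Z z) =
      (\<Sum>z\<in>Z - {a}. node_wt (Z - {a}) z) - (\<Sum>z\<in>Z - {b}. node_wt (Z - {b}) z)"
    using divided_difference_rec[of Z a b "\<lambda>_. 1"] a b less.prems by auto
  show ?case
  proof (cases "card Z = 2")
    case True
    then have "card (Z - {a}) = 1" "card (Z - {b}) = 1" using ca by auto
    then obtain u v where "Z - {a} = {u}" "Z - {b} = {v}" by (meson card_1_singletonE)
    then show ?thesis using eq b by (auto simp: node_wt_def)
  next
    case False
    then have "(\<Sum>z\<in>Z - {a}. node_wt (Z - {a}) z) = 0" "(\<Sum>z\<in>Z - {b}. node_wt (Z - {b}) z) = 0"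
      using less.prems ca by (auto intro!: less.hyps)
    then show ?thesis using eq b by auto
  qed
qed

text \<open>For a step between the extreme nodes the recursion expresses the divided difference
  through the sets without the smallest and without the largest node. Dropping the smallest keeps
  the number of nodes right of the step, dropping the largest lowers it by one; this change of sign
  offsets the minus sign in the recursion, so both contributions have the same sign.\<close>

lemma divided_difference_step_sign:
  assumes "finite Z" "Z \<noteq> {}"
  shows "(-1) ^ card {z\<in>Z. y \<le> z} * (\<Sum>z\<in>{z\<in>Z. y \<le> z}. node_wt Z z) \<le> 0"
  using assms
proof (induction "card Z" arbitrary: Z rule: less_induct)
  case less
  define p where "p Z = card {z\<in>Z. y \<le> z}" for Z
  define S where "S Z = (\<Sum>z\<in>{z\<in>Z. y \<le> z}. node_wt Z z)" for Z
  have S_alt: "S Z = (\<Sum>z\<in>Z. of_bool (y \<le> z) * node_wt Z z)" if "finite Z" for Z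
    unfolding S_def using that by (intro sum.mono_neutral_cong_left) auto
  let ?a = "Min Z" and ?b = "Max Z"
  have a: "?a \<in> Z" and b: "?b \<in> Z" using less.prems by auto
  have ab: "?a \<le> ?b" using less.prems by simp
  consider "?b < y" | "y \<le> ?a" | "?a < y" "y \<le> ?b" by linarith
  then show ?case
  proof cases
    case 1
    have "z \<le> ?b" if "z \<in> Z" for z using that less.prems by simp
    with 1 have no: "{z\<in>Z. y \<le> z} = {}" by force
    show ?thesis unfolding no by simp
  next
    case 2
    then have all: "{z\<in>Z. y \<le> z} = Z" using less.prems by auto
    show ?thesis
    proof (cases "card Z \<ge> 2")
      case True
      then show ?thesis using all sum_node_wt_eq_0 less.prems by simp
    next
      case False
      moreover have "card Z > 0" using less.prems by (simp add: card_gt_0_iff)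
      ultimately have "card Z = 1" by linarith
      then obtain u where "Z = {u}" by (meson card_1_singletonE)
      then show ?thesis using all by (simp add: node_wt_def)
    qed
  next
    case 3
    have ne: "?a \<noteq> ?b" using 3 by linarith
    have eq: "(?b - ?a) * S Z = S (Z - {?a}) - S (Z - {?b})"
      using divided_difference_rec[OF less.prems(1) a b ne, of "\<lambda>z. of_bool (y \<le> z)"] less.prems
      by (simp add: S_alt)
    have "{z\<in>Z - {?a}. y \<le> z} = {z\<in>Z. y \<le> z}" using 3 by auto
    then have pa: "p (Z - {?a}) = p Z" by (simp add: p_def)
    have "{z\<in>Z - {?b}. y \<le> z} = {z\<in>Z. y \<le> z} - {?b}" by auto
    moreover have "?b \<in> {z\<in>Z. y \<le> z}" using 3 b by simp
    ultimately have pb: "p Z = Suc (p (Z - {?b}))"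
      using less.prems(1) card_Suc_Diff1[of "{z\<in>Z. y \<le> z}" ?b] unfolding p_def by simp
    have IH: "(-1) ^ p (Z - {c}) * S (Z - {c}) \<le> 0" if "c \<in> Z" "Z - {c} \<noteq> {}" for c
      unfolding p_def S_def using less.hyps[OF card_Diff1_less[OF less.prems(1) that(1)]] less.prems that
      by simp
    have "?b \<in> Z - {?a}" "?a \<in> Z - {?b}" using a b ne by simp_all
    then have "Z - {?a} \<noteq> {}" "Z - {?b} \<noteq> {}" by (metis empty_iff)+
    with a b have I: "(-1) ^ p (Z - {?a}) * S (Z - {?a}) \<le> 0" "(-1) ^ p (Z - {?b}) * S (Z - {?b}) \<le> 0"
      by (simp_all add: IH)
    have "(-1) ^ p Z * ((?b - ?a) * S Z) =
        (-1) ^ p (Z - {?a}) * S (Z - {?a}) + (-1) ^ p (Z - {?b}) * S (Z - {?b})"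
      unfolding eq pa pb by (simp add: right_diff_distrib)
    then have "(?b - ?a) * ((-1) ^ p Z * S Z) \<le> 0" using I by (simp add: mult.left_commute)
    then show ?thesis using ab ne by (simp add: mult_le_0_iff p_def S_def)
  qed
qed

lemma lagr_node:
  assumes "b \<in> X" "finite X" "x \<in> X"
  shows "lagr X b x = of_bool (x = b)"
  using assms by (auto simp: lagr_def intro!: prod.neutral)

text \<open>
  Writing the interpolation error of a step function as a divided difference, the errors for two
  adjacent positions of the step have opposite signs and differ by a single fundamental polynomial,
  so each of them is dominated by it.
\<close>

lemma step_interpolation_error:
  fixes x y :: real
  assumes X: "finite X"
  defines "e \<equiv> of_bool (y \<le> x) - (\<Sum>b\<in>{b\<in>X. y \<le> b}. lagr X b x)"
  shows "e = 0 \<or> (y \<le> x \<and> (\<forall>w\<in>X. y \<le> w \<longrightarrow> x \<le> w) \<and> \<bar>e\<bar> \<le> 1) \<or>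
    (\<exists>b\<in>X. y \<le> b \<and> (\<forall>w\<in>X. y \<le> w \<longrightarrow> b \<le> w) \<and> \<bar>e\<bar> \<le> \<bar>lagr X b x\<bar>)"
proof (cases "x \<in> X")
  case True
  have "(\<Sum>b\<in>{b\<in>X. y \<le> b}. lagr X b x) = (\<Sum>b\<in>{b\<in>X. y \<le> b}. of_bool (x = b))"
    using True X by (intro sum.cong) (auto simp: lagr_node)
  also have "\<dots> = of_bool (y \<le> x)" using True X by (auto simp: sum.delta of_bool_def)
  finally show ?thesis by (simp add: e_def)
next
  case False
  define Z where "Z = insert x X"
  \<comment> \<open>The error at \<open>x\<close> is \<open>W\<close> times the divided difference
    of the step over the nodes together with \<open>x\<close>.\<close>
  define W where "W = (\<Prod>w\<in>X. x - w)"
  define S where "S A = (\<Sum>z\<in>A. node_wt Z z)" for A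
  define U where "U = {z\<in>Z. y \<le> z}"
  have fZ: "finite Z" "finite U" using X by (auto simp: Z_def U_def)
  have W0: "W \<noteq> 0" using False X by (auto simp: W_def)
  have wx: "W * node_wt Z x = 1"
    using W0 False by (simp add: node_wt_def Z_def W_def)
  have wb: "W * node_wt Z b = - lagr X b x" if b: "b \<in> X" for b
  proof -
    have xb: "x \<noteq> b" using b False by auto
    define P where "P = (\<Prod>w\<in>X - {b}. b - w)"
    define Q where "Q = (\<Prod>w\<in>X - {b}. x - w)"
    have P0: "P \<noteq> 0" using X by (auto simp: P_def)
    have *: "(\<Prod>w\<in>Z - {b}. b - w) = (b - x) * P" unfolding P_def
      using X xb False by (subst prod.remove[of _ x]) (auto simp: Z_def intro!: prod.cong)
    have W: "W = (x - b) * Q"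
      unfolding W_def Q_def using X b by (subst prod.remove[of _ b]) auto
    have "lagr X b x = Q / P" by (simp add: lagr_def prod_dividef P_def Q_def)
    moreover have "(x - b) * Q * (1 / ((b - x) * P)) = - (Q / P)" using xb P0 by
      (simp add: divide_simps) (simp add: algebra_simps)
    ultimately show ?thesis by (simp only: node_wt_def * W)
  qed
  have e: "e = W * S U"
  proof -
    have "W * S U = (\<Sum>z\<in>U. W * node_wt Z z)" by (simp add: S_def sum_distrib_left)
    also have "\<dots> = (\<Sum>z\<in>U \<inter> {x}. W * node_wt Z z) + (\<Sum>z\<in>{b\<in>X. y \<le> b}. W * node_wt Z z)"
      using X False by (subst sum.union_disjoint[symmetric]) (auto simp: U_def Z_def intro!: sum.cong)
    also have "(\<Sum>z\<in>U \<inter> {x}. W * node_wt Z z) = of_bool (y \<le> x)"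
      using wx by (auto simp: U_def Z_def)
    also have "(\<Sum>z\<in>{b\<in>X. y \<le> b}. W * node_wt Z z) = - (\<Sum>b\<in>{b\<in>X. y \<le> b}. lagr X b x)"
      by (simp add: wb sum_negf)
    finally show ?thesis by (simp add: e_def)
  qed
  show ?thesis
  proof (cases "U = {}")
    case True
    then show ?thesis by (simp add: e S_def)
  next
    case ne: False
    \<comment> \<open>The first point not left of the step. The conclusion records that it is the
      first one, because at the Chebyshev nodes this keeps it close to the step.\<close>
    define b where "b = Min U"
    have bU: "b \<in> U" and bmin: "\<And>w. w \<in> U \<Longrightarrow> b \<le> w" using ne fZ by (auto simp: b_def)
    have adj: "{z\<in>Z. b < z} = U - {b}" using bU bmin by (force simp: U_def)
    \<comment> \<open>The next position of the step, just past \<open>b\<close>; any number above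
      \<open>b\<close> will do if no point follows.\<close>
    define y' where "y' = (if U - {b} = {} then b + 1 else Min (U - {b}))"
    have U': "{z\<in>Z. y' \<le> z} = U - {b}"
    proof (cases "U - {b} = {}")
      case True
      then show ?thesis using adj by (force simp: y'_def)
    next
      case F: False
      have "y' = Min (U - {b})" using F by (simp only: y'_def if_False)
      moreover have "Min (U - {b}) \<in> U - {b}" using F fZ by (intro Min_in) auto
      moreover have "\<And>w. w \<in> U - {b} \<Longrightarrow> Min (U - {b}) \<le> w" using fZ by (intro Min_le) auto
      ultimately have y': "y' \<in> U - {b}" "\<And>w. w \<in> U - {b} \<Longrightarrow> y' \<le> w" by metis+
      then have "b < y'" using bmin[of y'] by auto
      then show ?thesis using adj y'(2) U_def by auto
    qed
    have s1: "(-1) ^ card U * S U \<le> 0"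
      using divided_difference_step_sign[of Z y] fZ by (auto simp: S_def U_def Z_def)
    have s2: "(-1) ^ card (U - {b}) * S (U - {b}) \<le> 0"
      using divided_difference_step_sign[of Z y'] fZ unfolding U' by (auto simp: S_def Z_def)
    have c: "card U = Suc (card (U - {b}))" using bU fZ card_Suc_Diff1[of U b] by simp
    have d: "S U = S (U - {b}) + node_wt Z b" using bU fZ unfolding S_def by (subst sum.remove[of U b]) auto
    have "\<bar>S U\<bar> \<le> \<bar>node_wt Z b\<bar>"
      using s1 s2 d unfolding c by (cases "even (card (U - {b}))") auto
    then have le: "\<bar>e\<bar> \<le> \<bar>W * node_wt Z b\<bar>" unfolding e abs_mult by (intro mult_left_mono) auto
    show ?thesis
    proof (cases "b = x")
      case True
      then show ?thesis using le wx bU bmin by (auto simp: U_def Z_def)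
    next
      case F: False
      then have "b \<in> X" using bU by (auto simp: U_def Z_def)
      then show ?thesis using le wb bU bmin by (intro disjI2 bexI[of _ b]) (auto simp: U_def Z_def)
    qed
  qed
qed

section \<open>Bounds for the fundamental polynomials at the Jacobi nodes\<close>

text \<open>The order of magnitude, squared, of the largest value of the fundamental polynomials.\<close>

definition lagr_growth :: "real \<Rightarrow> real \<Rightarrow> real \<Rightarrow> real" where
  "lagr_growth a b \<mu> = 1 + \<mu> powr (- a) + \<mu> powr (b - 1) + \<mu> powr (a - 3) + \<mu> powr (b - a)"

text \<open>On \<open>[c / \<mu>, 3]\<close> a power is largest at one of the ends, where it has
  order 1 or \<open>\<mu> powr (- e)\<close>. The common exponent \<open>E\<close> gives one
  constant for all powers that occur.\<close>

lemma powr_le_two_sided: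
  fixes c \<mu> u e E :: real
  assumes c: "0 < c" "c \<le> 1" and \<mu>: "\<mu> \<ge> 1" and u: "c / \<mu> \<le> u" "u \<le> 3" and e: "\<bar>e\<bar> \<le> E"
  shows "u powr e \<le> (3 / c) powr E * (1 + \<mu> powr (- e))"
proof -
  have u0: "u > 0" using u c \<mu> by (smt (verit) divide_pos_pos)
  have K: "3 / c \<ge> 1" using c by simp
  have "u powr e \<le> (3 / c) powr \<bar>e\<bar> * (1 + \<mu> powr (- e))"
  proof (cases "e \<ge> 0")
    case True
    have "u * c \<le> 3 * 1" using u c u0 by (intro mult_mono) auto
    then have "u \<le> 3 / c" using c by (simp add: le_divide_eq)
    then have "u powr e \<le> (3 / c) powr \<bar>e\<bar> * 1" using True u0 by (simp add: powr_mono2)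
    also have "\<dots> \<le> (3 / c) powr \<bar>e\<bar> * (1 + \<mu> powr (- e))" by (intro mult_left_mono) auto
    finally show ?thesis .
  next
    case False
    have "u powr e \<le> (c / \<mu>) powr e" using False u c \<mu> by (intro powr_mono2') auto
    also have "\<dots> = (1 / c) powr \<bar>e\<bar> * \<mu> powr (- e)"
      using False c \<mu> by (simp add: powr_divide powr_minus_divide)
    also have "\<dots> \<le> (3 / c) powr \<bar>e\<bar> * (1 + \<mu> powr (- e))"
      using c by (intro mult_mono powr_mono2 divide_right_mono) auto
    finally show ?thesis .
  qed
  also have "\<dots> \<le> (3 / c) powr E * (1 + \<mu> powr (- e))"
    using K e by (intro mult_right_mono powr_mono) auto
  finally show ?thesis .
qed

text \<open>For \<open>q \<le> 0\<close> the power of \<open>S\<close> may be replaced by that of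
  \<open>t\<close>, and \<open>1 / (t * \<mu>)\<close> remains. For \<open>q > 0\<close> the worst
  \<open>S\<close> is \<open>1 / \<mu>\<close>, and then \<open>t\<close> lies at one of its two
  ends.\<close>

lemma powr_product_le_small:
  fixes c \<mu> t S q E :: real
  assumes c: "0 < c" "c \<le> 1" and \<mu>: "\<mu> \<ge> 1" and t: "c / \<mu> \<le> t" "t \<le> 3"
    and S: "1 / \<mu> \<le> S" "S \<le> 3 / c * t" and q: "\<bar>q\<bar> \<le> E" "\<bar>q - 1\<bar> \<le> E" "1 \<le> E"
  shows "S powr (- q) * t powr (q - 1) / \<mu> \<le> ((3 / c) powr E)\<^sup>2 * (1 + \<mu> powr (q - 1))"
proof -
  define P where "P = (3 / c) powr E"
  have c\<mu>: "c / \<mu> > 0" using c \<mu> by simp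
  then have pos: "t > 0" "S > 0" using t S \<mu> by (auto intro: less_le_trans[of 0 "1 / \<mu>"])
  have K: "3 / c \<ge> 1" using c by simp
  have P3: "3 / c \<le> P" unfolding P_def using K q(3) powr_mono[of 1 E "3 / c"] c by simp
  then have P1: "P \<ge> 1" using K by linarith
  show ?thesis
  proof (cases "q \<le> 0")
    case True
    have "S powr (- q) \<le> (3 / c * t) powr (- q)" using True S pos by (intro powr_mono2) auto
    also have "\<dots> = (3 / c) powr (- q) * t powr (- q)" by (rule powr_mult)
    also have "\<dots> \<le> P * t powr (- q)" unfolding P_def using K q by (intro mult_right_mono powr_mono) auto
    finally have "S powr (- q) * t powr (q - 1) / \<mu> \<le> P * t powr (- q) * t powr (q - 1) / \<mu>"
      using \<mu> by (intro divide_right_mono mult_right_mono) auto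
    also have "\<dots> = P * (1 / (t * \<mu>))"
    proof -
      have "t powr (- q) * t powr (q - 1) = 1 / t" using pos unfolding powr_add[symmetric] by
        (simp add: powr_minus_divide)
      then have "P * t powr (- q) * t powr (q - 1) = P * (1 / t)" by (simp only: mult.assoc)
      then show ?thesis by simp
    qed
    also have "\<dots> \<le> P * P"
    proof (rule mult_left_mono)
      have "c \<le> t * \<mu>" using t \<mu> by (simp add: field_simps)
      then have "1 / (t * \<mu>) \<le> 1 / c" using c by (intro divide_left_mono) auto
      also have "\<dots> \<le> 3 / c" using c by (intro divide_right_mono) auto
      finally show "1 / (t * \<mu>) \<le> P" using P3 by linarith
    qed (use P1 in simp)
    also have "\<dots> = P\<^sup>2 * 1" by (simp add: power2_eq_square)
    also have "\<dots> \<le> P\<^sup>2 * (1 + \<mu> powr (q - 1))" by (intro mult_left_mono) auto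
    finally show ?thesis by (simp add: P_def)
  next
    case False
    have "S powr (- q) \<le> (1 / \<mu>) powr (- q)" using False S \<mu> by (intro powr_mono2') auto
    also have "\<dots> = \<mu> * \<mu> powr (q - 1)" using \<mu> by (simp add: powr_divide powr_diff powr_minus_divide)
    finally have "S powr (- q) * t powr (q - 1) / \<mu> \<le> \<mu> * \<mu> powr (q - 1) * (P * (1 + \<mu> powr (- (q - 1)))) / \<mu>"
      unfolding P_def using \<mu> powr_le_two_sided[OF c \<mu> t q(2)] by (intro divide_right_mono mult_mono) auto
    also have "\<dots> = P * (\<mu> powr (q - 1) + \<mu> powr (q - 1) * \<mu> powr (- (q - 1)))"
      using \<mu> by (simp add: distrib_left add_divide_distrib mult_ac del: minus_diff_eq)
    also have "\<mu> powr (q - 1) * \<mu> powr (- (q - 1)) = 1" using \<mu> unfolding powr_add[symmetric] by simp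
    also have "P * (\<mu> powr (q - 1) + 1) \<le> P\<^sup>2 * (1 + \<mu> powr (q - 1))"
      using P1 by (simp add: add.commute power2_eq_square mult_right_mono)
    finally show ?thesis by (simp add: P_def)
  qed
qed

text \<open>The counterpart for \<open>t \<le> S\<close>: now \<open>q \<ge> 0\<close> is the
  harmless sign, and for \<open>q < 0\<close> the worst case has \<open>S\<close> of order 1 and
  \<open>t\<close> of order \<open>1 / \<mu>\<close>.\<close>

lemma powr_product_le_large:
  fixes c \<mu> t S q E :: real
  assumes c: "0 < c" "c \<le> 1" and \<mu>: "\<mu> \<ge> 1" and t: "c / \<mu> \<le> t" "t \<le> S" "S \<le> 3"
    and q: "\<bar>q\<bar> \<le> E" "\<bar>q - 1\<bar> \<le> E" "1 \<le> E"
  shows "S powr (- q) * t powr (q - 1) / \<mu> \<le> ((3 / c) powr E)\<^sup>2 * (1 + \<mu> powr (- q))"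
proof (cases "q \<ge> 0")
  case True
  have "c / \<mu> > 0" using c \<mu> by simp
  then have tpos: "t > 0" using t by linarith
  have "S powr (- q) * t powr (q - 1) / \<mu> \<le> t powr (- q) * t powr (q - 1) / \<mu>"
    using True tpos t \<mu> by (intro divide_right_mono mult_right_mono powr_mono2') auto
  also have "\<dots> = 1 / (t * \<mu>)" using tpos unfolding powr_add[symmetric] by (simp add: powr_minus_divide)
  also have "\<dots> \<le> 3 / c"
  proof -
    have "c \<le> t * \<mu>" using t \<mu> by (simp add: field_simps)
    then have "1 / (t * \<mu>) \<le> 1 / c" using c by (intro divide_left_mono) auto
    also have "\<dots> \<le> 3 / c" using c by (intro divide_right_mono) auto
    finally show ?thesis .
  qed
  also have "\<dots> \<le> ((3 / c) powr E)\<^sup>2 * 1"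
  proof -
    have K: "3 / c \<ge> 1" using c by simp
    have "3 / c \<le> (3 / c) powr E" using K q(3) powr_mono[of 1 E "3 / c"] c by simp
    also have "\<dots> \<le> (3 / c) powr E * (3 / c) powr E" using K q(3)
      by (intro mult_left_le_one_le[THEN order_trans] mult_le_cancel_left1[THEN iffD2]) (auto
        intro: ge_one_powr_ge_zero)
    finally show ?thesis by (simp add: power2_eq_square)
  qed
  also have "\<dots> \<le> ((3 / c) powr E)\<^sup>2 * (1 + \<mu> powr (- q))" by (intro mult_left_mono) auto
  finally show ?thesis .
next
  case False
  define P where "P = (3 / c) powr E"
  have c\<mu>: "c / \<mu> > 0" "c / \<mu> \<le> S" using c \<mu> t by auto
  have "S powr (- q) \<le> 3 powr (- q)" using False t c\<mu> by (intro powr_mono2) auto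
  also have "\<dots> \<le> (3 / c) powr (- q)" using False c by (intro powr_mono2) (auto simp: le_divide_eq)
  also have "\<dots> \<le> P" unfolding P_def using c q by (intro powr_mono) auto
  finally have "S powr (- q) * t powr (q - 1) / \<mu> \<le> P * (P * (1 + \<mu> powr (- (q - 1)))) / \<mu>"
    unfolding P_def using \<mu> t powr_le_two_sided[OF c \<mu> t(1) _ q(2)]
      by (intro divide_right_mono mult_mono) auto
  also have "\<dots> = P\<^sup>2 * (1 / \<mu> + \<mu> powr (- q))"
  proof -
    have "\<mu> powr (- (q - 1)) = \<mu> * \<mu> powr (- q)" using \<mu> by (simp add: powr_diff powr_minus_divide)
    then show ?thesis using \<mu> by (simp add: power2_eq_square field_simps del: minus_diff_eq)
  qed
  also have "\<dots> \<le> P\<^sup>2 * (1 + \<mu> powr (- q))" using \<mu> by (intro mult_left_mono add_right_mono) auto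
  finally show ?thesis by (simp add: P_def)
qed

text \<open>Here \<open>s\<close>, \<open>s'\<close> are the distances of the point from 1 and -1,
  and \<open>t\<close>, \<open>t'\<close> those of the node. The cases account for the exponents in
  \<open>lagr_growth\<close>. With the node in the half at 1, a point closer to 1 gives
  \<open>a - 3\<close>, a point farther away in the same half \<open>- a\<close>, and a point in the
  other half \<open>- a\<close>, \<open>b - 1\<close> and \<open>b - a\<close>. With the node in the
  half at -1, a point closer to -1 gives \<open>b - 1\<close>, a point farther away in that half
  only a constant because \<open>b > -1/2\<close>, and a point in the other half
  \<open>a - 3\<close>.\<close>

lemma lagr_far_bound:
  fixes a b c s t s' t' \<mu> :: real
  assumes b: "b > -1/2" and c: "0 < c" "c \<le> 1/2" and \<mu>: "\<mu> \<ge> 1"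
    and s: "0 \<le> s" "0 \<le> s'" "s + s' = 2" and t: "t + t' = 2" "c \<le> \<mu> * t" "c \<le> \<mu> * t'"
    and far: "min t t' / 2 \<le> \<bar>s - t\<bar>"
  shows "s\<^sup>2 / (s - t)\<^sup>2 * (t powr (a - 1) * t' powr (b + 1) * ((s + 1/\<mu>) powr (- a) * (s'
    + 1/\<mu>) powr (- b))) / \<mu>
    \<le> 72 * ((3 / c) powr (\<bar>a\<bar> + \<bar>b\<bar> + 5)) ^ 5 * lagr_growth a b \<mu>"
proof -
  define E where "E = \<bar>a\<bar> + \<bar>b\<bar> + 5"
  define P where "P = (3 / c) powr E"
  define S where "S = s + 1/\<mu>"
  define S' where "S' = s' + 1/\<mu>"
  define B where "B = lagr_growth a b \<mu>"
  have c1: "c \<le> 1" using c by simp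
  have K: "3 / c \<ge> 3" using c by (simp add: le_divide_eq)
  have E1: "1 \<le> E" "0 \<le> E" by (auto simp: E_def)
  have P1: "P \<ge> 1" unfolding P_def using K E1 by (intro ge_one_powr_ge_zero) auto
  have \<mu>1: "0 < 1 / \<mu>" "1 / \<mu> \<le> 1" using \<mu> by auto
  have tc: "c / \<mu> \<le> t" "c / \<mu> \<le> t'" using t \<mu> by (auto simp: field_simps)
  have c\<mu>: "0 < c / \<mu>" "c / \<mu> \<le> 1 / \<mu>" using c \<mu> by (auto intro: divide_right_mono)
  have tpos: "t > 0" "t' > 0" using tc c\<mu> by linarith+
  have Sc: "c / \<mu> \<le> S" "c / \<mu> \<le> S'" "S \<le> 3" "S' \<le> 3" "S > 0" "S' > 0" "1 / \<mu> \<le> S" "1 / \<mu> \<le> S'"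
    "s \<le> S" "s' \<le> S'"
    using s \<mu>1 c\<mu> unfolding S_def S'_def by linarith+
  have t3: "t \<le> 3" "t' \<le> 3" using t(1) tpos by auto
  have t\<mu>: "1 / \<mu> \<le> t / c" "t \<le> t / c" "1 / \<mu> \<le> t' / c" "t' \<le> t' / c"
    using tc c tpos by (auto simp: field_simps)
  note two = powr_le_two_sided[OF c(1) c1 \<mu>, of _ _ E, folded P_def]
  note small = powr_product_le_small[OF c(1) c1 \<mu>, of _ _ _ E, folded P_def]
  note large = powr_product_le_large[OF c(1) c1 \<mu>, of _ _ _ E, folded P_def]
  have pos: "\<mu> powr e > 0" for e using \<mu> by simp
  have B1: "1 + \<mu> powr (- a) \<le> B" "1 + \<mu> powr (b - 1) \<le> B" "1 + \<mu> powr (a - 3) \<le> B"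
    "1 + \<mu> powr (- a) + \<mu> powr (b - 1) + \<mu> powr (b - a) \<le> B" "1 \<le> B"
    using pos[of "-a"] pos[of "b-1"] pos[of "a-3"] pos[of "b-a"] unfolding B_def lagr_growth_def by linarith+
  have bdd: "u powr e \<le> P" if "1 \<le> u" "u \<le> 3" "\<bar>e\<bar> \<le> E" for u e
  proof -
    have "1 * 1 \<le> 3 / c * u" using K c that by (intro mult_mono) auto
    then have "u powr e \<le> (3 / c) powr \<bar>e\<bar> * 1 powr e" using K c that by (intro powr_le_of_ratio) auto
    also have "\<dots> \<le> P" unfolding P_def using K that by (simp add: powr_mono)
    finally show ?thesis .
  qed
  \<comment> \<open>The constants \<open>72\<close> and \<open>P ^ 5\<close> are attained in the
    case \<open>3 / 2 * t' \<le> s' \<le> 1\<close>, as \<open>36 * P ^ 5\<close> times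
    \<open>2 * B\<close>.\<close>
  have fin: "k * P ^ i * X \<le> 72 * P ^ 5 * B" if "0 \<le> k" "k * l \<le> 72" "i \<le> 5" "0 \<le> X" "X \<le> l * B" "0 \<le> l"
    for k i l X
  proof -
    have "k * P ^ i * X \<le> k * P ^ 5 * (l * B)"
      using that P1 by (intro mult_mono mult_left_mono power_increasing) auto
    also have "\<dots> = (k * l) * (P ^ 5 * B)" by simp
    also have "\<dots> \<le> 72 * (P ^ 5 * B)" using that P1 B1 by (intro mult_right_mono) auto
    finally show ?thesis by simp
  qed
  have ab: "\<bar>a - 1\<bar> \<le> E" "\<bar>a - 3\<bar> \<le> E" "\<bar>2 - a\<bar> \<le> E" "\<bar>b + 1\<bar> \<le> E" "\<bar>b - 1\<bar> \<le> E" "\<bar>- a\<bar> \<le> E" "\<bar>- b\<bar> \<le> E"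
    "\<bar>a\<bar> \<le> E" "\<bar>b\<bar> \<le> E" "\<bar>a - 2\<bar> \<le> E" "\<bar>a - 2 - 1\<bar> \<le> E" "\<bar>b + 2\<bar> \<le> E" "\<bar>b + 2 - 1\<bar> \<le> E"
    unfolding E_def by linarith+
  have sq_div: "s\<^sup>2 / (s - t)\<^sup>2 \<le> k\<^sup>2 * s\<^sup>2 / d\<^sup>2" if "d \<le> k * \<bar>s - t\<bar>" "d > 0" for d k
  proof -
    have "k * \<bar>s - t\<bar> > 0" using that by linarith
    then have "s - t \<noteq> 0" "k \<noteq> 0" by auto
    have "d\<^sup>2 \<le> (k * \<bar>s - t\<bar>)\<^sup>2" using that by (intro power_mono) auto
    then have "d\<^sup>2 \<le> k\<^sup>2 * (s - t)\<^sup>2" by (simp add: power_mult_distrib)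
    then have "s\<^sup>2 * d\<^sup>2 \<le> s\<^sup>2 * (k\<^sup>2 * (s - t)\<^sup>2)" by (intro mult_left_mono) auto
    then show ?thesis using \<open>s - t \<noteq> 0\<close> that by (simp add: divide_simps mult_ac)
  qed
  define W where "W = s\<^sup>2 / (s - t)\<^sup>2 * (t powr (a - 1) * t' powr (b + 1) * (S powr (- a) * S' powr (- b))) / \<mu>"
  have W: "W \<le> f0 * (f1 * f2 * (f3 * f4)) / \<mu>"
    if "s\<^sup>2 / (s - t)\<^sup>2 \<le> f0" "t powr (a - 1) \<le> f1" "t' powr (b + 1) \<le> f2" "S powr (- a)
      \<le> f3" "S' powr (- b) \<le> f4"
    for f0 f1 f2 f3 f4
  proof -
    have "0 \<le> f0" "0 \<le> f1" "0 \<le> f2" "0 \<le> f3" "0 \<le> f4"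
      using that by (auto intro: order_trans[rotated])
    then show ?thesis unfolding W_def
      using that \<mu> by (intro divide_right_mono mult_mono mult_nonneg_nonneg) auto
  qed
  have st: "\<bar>s - t\<bar> = \<bar>s' - t'\<bar>" using s t by linarith
  have "W \<le> 72 * P ^ 5 * B"
  proof -
    \<comment> \<open>As \<open>t + t' = 2\<close>, the smaller of the two is the one that is at
      most 1; being far then means being at most one half or at least three halves of it.\<close>
    consider "t \<le> 1" "s \<le> t / 2" | "t \<le> 1" "3 / 2 * t \<le> s" | "t' \<le> 1" "s' \<le> t' / 2" | "t'
      \<le> 1" "3 / 2 * t' \<le> s'"
      using far s t by (auto simp: min_def abs_if split: if_splits)
    then show ?thesis
    proof cases
      case 1
      have "s\<^sup>2 / (s - t)\<^sup>2 \<le> 2\<^sup>2 * s\<^sup>2 / t\<^sup>2" using 1 tpos by (intro sq_div) auto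
      also have "\<dots> \<le> 4 * S\<^sup>2 / t\<^sup>2" using s Sc by (intro divide_right_mono) (auto
        intro!: mult_left_mono power_mono)
      finally have d: "s\<^sup>2 / (s - t)\<^sup>2 \<le> 4 * S\<^sup>2 / t\<^sup>2" .
      have "1 \<le> S'" "1 \<le> t'" using s t 1 Sc by linarith+
      then have "W \<le> (4 * S\<^sup>2 / t\<^sup>2) * (t powr (a - 1) * P * (S powr (- a) * P)) / \<mu>"
        by (intro W[OF d order_refl bdd order_refl bdd] t3 Sc ab)
      \<comment> \<open>The quotient \<open>S\<^sup>2 / t\<^sup>2\<close> shifts both exponents by
        2, which gives the product estimate with \<open>q = a - 2\<close>.\<close>
      also have "\<dots> = 4 * P ^ 2 * (S powr (- (a - 2)) * t powr (a - 2 - 1) / \<mu>)"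
        using Sc tpos by (simp add: powr_diff powr_minus_divide power2_eq_square divide_simps
          powr_numeral power3_eq_cube)
      also have "\<dots> \<le> 4 * P ^ 2 * (P ^ 2 * (1 + \<mu> powr (a - 2 - 1)))"
      proof (intro mult_left_mono small tc t3 Sc ab E1)
        have "S \<le> t / c + t / c" using 1 tpos t\<mu> unfolding S_def by linarith
        then show "S \<le> 3 / c * t" using tpos c by (simp add: field_simps)
      qed simp
      also have "\<dots> = 4 * P ^ 4 * (1 + \<mu> powr (a - 3))" by (simp add: power2_eq_square power4_eq_xxxx)
      also have "\<dots> \<le> 72 * P ^ 5 * B" by (rule fin[where l = 1]) (use B1 in auto)
      finally show ?thesis .
    next
      case 2
      have "s\<^sup>2 / (s - t)\<^sup>2 \<le> 3\<^sup>2 * s\<^sup>2 / s\<^sup>2" using 2 tpos by (intro sq_div) auto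
      then have d: "s\<^sup>2 / (s - t)\<^sup>2 \<le> 9" using 2 tpos by simp
      have t'1: "1 \<le> t'" using t 2 by simp
      show ?thesis
      proof (cases "s \<le> 1")
        case True
        then have "1 \<le> S'" using s Sc by linarith
        then have "W \<le> 9 * (t powr (a - 1) * P * (S powr (- a) * P)) / \<mu>"
          by (intro W[OF d order_refl bdd order_refl bdd] t'1 t3 Sc ab)
        also have "\<dots> = 9 * P ^ 2 * (S powr (- a) * t powr (a - 1) / \<mu>)" by (simp add: power2_eq_square)
        also have "\<dots> \<le> 9 * P ^ 2 * (P ^ 2 * (1 + \<mu> powr (- a)))"
        proof (intro mult_left_mono large tc t3 Sc ab E1)
          show "t \<le> S" using 2 tpos Sc by linarith
        qed simp
        also have "\<dots> = 9 * P ^ 4 * (1 + \<mu> powr (- a))" by (simp add: power2_eq_square power4_eq_xxxx)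
        also have "\<dots> \<le> 72 * P ^ 5 * B" by (rule fin[where l = 1]) (use B1 in auto)
        finally show ?thesis .
      next
        case False
        then have S1: "1 \<le> S" using Sc by linarith
        have "W \<le> 9 * ((P * (1 + \<mu> powr (- (a - 1)))) * P * (P * (P * (1 + \<mu> powr (- (- b)))))) / \<mu>"
          by (intro W[OF d two bdd bdd two] t'1 t3 Sc ab S1 tc)
        also have "\<dots> = 9 * P ^ 4 * (1 / \<mu> + \<mu> powr (- a) + \<mu> powr (b - 1) + \<mu> powr (b - a))"
        proof -
          have "\<mu> powr (- (a - 1)) = \<mu> * \<mu> powr (- a)" "\<mu> powr (- (- b)) = \<mu> * \<mu> powr (b - 1)"
            "\<mu> powr (b - a) = \<mu> * \<mu> powr (b - 1) * \<mu> powr (- a)"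
            using \<mu> by (simp_all add: powr_diff powr_minus_divide)
          then show ?thesis using \<mu> by (simp add: power4_eq_xxxx field_simps del: minus_diff_eq minus_minus)
        qed
        also have "\<dots> \<le> 72 * P ^ 5 * B"
        proof (rule fin[where l = 1])
          show "1 / \<mu> + \<mu> powr (- a) + \<mu> powr (b - 1) + \<mu> powr (b - a) \<le> 1 * B" using B1(4) \<mu>1 by linarith
        qed (use \<mu> in auto)
        finally show ?thesis .
      qed
    next
      case 3
      have "s\<^sup>2 / (s - t)\<^sup>2 \<le> 2\<^sup>2 * s\<^sup>2 / t'\<^sup>2" using 3 tpos st by (intro sq_div) auto
      also have "\<dots> \<le> 2\<^sup>2 * 2\<^sup>2 / t'\<^sup>2" using s by (intro divide_right_mono mult_left_mono power_mono) auto
      finally have d: "s\<^sup>2 / (s - t)\<^sup>2 \<le> 16 / t'\<^sup>2" by simp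
      have "1 \<le> S" "1 \<le> t" using s t 3 Sc by linarith+
      then have "W \<le> (16 / t'\<^sup>2) * (P * t' powr (b + 1) * (P * S' powr (- b))) / \<mu>"
        by (intro W[OF d bdd order_refl bdd order_refl] t3 Sc ab)
      also have "\<dots> = 16 * P ^ 2 * (S' powr (- b) * t' powr (b - 1) / \<mu>)"
        using tpos by (simp add: powr_diff powr_add power2_eq_square)
      also have "\<dots> \<le> 16 * P ^ 2 * (P ^ 2 * (1 + \<mu> powr (b - 1)))"
      proof (intro mult_left_mono small tc t3 Sc ab E1)
        have "S' \<le> t' / c + t' / c" using 3 tpos t\<mu> unfolding S'_def by linarith
        then show "S' \<le> 3 / c * t'" using tpos c by (simp add: field_simps)
      qed simp
      also have "\<dots> = 16 * P ^ 4 * (1 + \<mu> powr (b - 1))" by (simp add: power2_eq_square power4_eq_xxxx)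
      also have "\<dots> \<le> 72 * P ^ 5 * B" by (rule fin[where l = 1]) (use B1 in auto)
      finally show ?thesis .
    next
      case 4
      have s'0: "s' > 0" using 4 tpos by linarith
      have d: "s\<^sup>2 / (s - t)\<^sup>2 \<le> 9 * s\<^sup>2 / s'\<^sup>2" using sq_div[of s' 3] 4 tpos st by auto
      have t1: "1 \<le> t" using t 4 by simp
      show ?thesis
      proof (cases "s' \<le> 1")
        case True
        then have S1: "1 \<le> S" using s Sc by linarith
        \<comment> \<open>Here \<open>s'\<close> and \<open>S'\<close> are comparable. The bounded
          numerator leaves \<open>1 / S'\<^sup>2\<close>, which turns the exponent
          \<open>- b\<close> into \<open>- (b + 2)\<close>.\<close>
        have d2: "s\<^sup>2 / (s - t)\<^sup>2 \<le> 36 * P / S'\<^sup>2"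
        proof -
          have "t' / c \<le> s' / c" "s' \<le> s' / c" using c 4 s'0 tpos by (auto intro: divide_right_mono
            simp: le_divide_eq mult_left_le)
          then have "S' \<le> s' / c + s' / c" using t\<mu> unfolding S'_def by linarith
          then have "S' \<le> 3 / c * s'" using s'0 c by (simp add: field_simps)
          then have "S'\<^sup>2 \<le> (3 / c * s')\<^sup>2" using Sc by (intro power_mono) auto
          also have "\<dots> = (3 / c)\<^sup>2 * s'\<^sup>2" by (rule power_mult_distrib)
          also have "(3 / c)\<^sup>2 = (3 / c) powr 2" using K by (simp only: powr_numeral)
          also have "(3 / c) powr 2 * s'\<^sup>2 \<le> P * s'\<^sup>2" unfolding P_def using K
            by (intro mult_right_mono powr_mono) (auto simp: E_def)
          finally have "1 / s'\<^sup>2 \<le> P / S'\<^sup>2" using s'0 Sc by (simp add: field_simps)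
          then have "36 * (1 / s'\<^sup>2) \<le> 36 * (P / S'\<^sup>2)" by (intro mult_left_mono) auto
          moreover have "9 * s\<^sup>2 / s'\<^sup>2 \<le> 9 * 2\<^sup>2 / s'\<^sup>2" using s
            by (intro divide_right_mono mult_left_mono power_mono) auto
          ultimately show ?thesis using d by simp
        qed
        have "W \<le> (36 * P / S'\<^sup>2) * (P * t' powr (b + 1) * (P * S' powr (- b))) / \<mu>"
          by (intro W[OF d2 bdd order_refl bdd order_refl] t1 S1 t3 Sc ab)
        also have "\<dots> = 36 * P ^ 3 * (S' powr (- (b + 2)) * t' powr (b + 2 - 1) / \<mu>)"
        proof -
          have "S' powr (- (b + 2)) = S' powr (- b) / S'\<^sup>2" "b + 2 - 1 = b + 1"
            using Sc by (simp_all add: powr_diff powr_numeral)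
          then show ?thesis by (simp only:) (simp add: power3_eq_cube)
        qed
        also have "\<dots> \<le> 36 * P ^ 3 * (P ^ 2 * (1 + \<mu> powr (- (b + 2))))"
        proof (intro mult_left_mono large tc t3 Sc ab E1)
          show "t' \<le> S'" using 4 tpos Sc by linarith
        qed (use P1 in simp)
        also have "\<dots> = 36 * P ^ 5 * (1 + \<mu> powr (- (b + 2)))" by (simp add: power_add[symmetric])
        also have "\<dots> \<le> 72 * P ^ 5 * B"
        proof (rule fin[where l = 2])
          have "\<mu> powr (- (b + 2)) \<le> \<mu> powr 0" using \<mu> b by (intro powr_mono) auto
          then show "1 + \<mu> powr (- (b + 2)) \<le> 2 * B" using B1(5) \<mu> by simp
        qed auto
        finally show ?thesis .
      next
        case False
        then have S'1: "1 \<le> S'" using Sc by linarith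
        have "9 * s\<^sup>2 / s'\<^sup>2 \<le> 9 * S\<^sup>2 / 1"
          using s Sc False by (intro frac_le mult_left_mono power_mono) (auto simp: one_le_power)
        then have d2: "s\<^sup>2 / (s - t)\<^sup>2 \<le> 9 * S\<^sup>2" using d by simp
        have tb: "t' powr (b + 1) \<le> 1" using 4 tpos b by (intro powr_le1) auto
        have "W \<le> (9 * S\<^sup>2) * (P * 1 * (S powr (- a) * P)) / \<mu>"
          by (intro W[OF d2 bdd tb order_refl bdd] t1 S'1 t3 Sc ab)
        also have "\<dots> = 9 * P ^ 2 * (S powr (2 - a) / \<mu>)"
          using Sc by (simp add: powr_diff powr_minus_divide power2_eq_square powr_numeral)
        also have "\<dots> \<le> 9 * P ^ 2 * (P * (1 + \<mu> powr (- (2 - a))) / \<mu>)"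
          using \<mu> by (intro mult_left_mono divide_right_mono two Sc ab) auto
        also have "\<dots> = 9 * P ^ 3 * (1 / \<mu> + \<mu> powr (a - 3))"
        proof -
          have "\<mu> powr (- (2 - a)) = \<mu> * \<mu> powr (a - 3)"
            using \<mu> by (simp add: powr_diff divide_simps powr_numeral power2_eq_square power3_eq_cube)
          then show ?thesis using \<mu> by (simp add: power2_eq_square power3_eq_cube field_simps del:
            minus_diff_eq)
        qed
        also have "\<dots> \<le> 72 * P ^ 5 * B"
        proof (rule fin[where l = 1])
          show "1 / \<mu> + \<mu> powr (a - 3) \<le> 1 * B" using B1(3) \<mu>1 by linarith
        qed (use \<mu> in auto)
        finally show ?thesis .
      qed
    qed
  qed
  then show ?thesis unfolding W_def S_def S'_def B_def P_def E_def .
qed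

section \<open>Node polynomial, zeros and fundamental polynomials\<close>

lemma prod_linear_dvd:
  fixes w :: "real poly"
  assumes "finite Y" "\<And>x. x \<in> Y \<Longrightarrow> poly w x = 0"
  shows "(\<Prod>z\<in>Y. [:- z, 1:]) dvd w"
  using assms
proof (induction Y rule: finite_induct)
  case (insert y Y)
  then obtain v where v: "w = (\<Prod>z\<in>Y. [:- z, 1:]) * v" by auto
  have "poly (\<Prod>z\<in>Y. [:- z, 1:]) y \<noteq> 0" using insert by (auto simp: poly_prod)
  moreover have "poly w y = 0" using insert by auto
  ultimately have "poly v y = 0" unfolding v by simp
  then have "[:- y, 1:] dvd v" by (simp add: poly_eq_0_iff_dvd)
  then have "(\<Prod>z\<in>Y. [:- z, 1:]) * [:- y, 1:] dvd w" unfolding v by (intro mult_dvd_mono dvd_refl)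
  then show ?case unfolding prod.insert[OF insert(1,2)] by (subst mult.commute)
qed simp

text \<open>By its degree \<open>w\<close> is a multiple of the node polynomial, and both sides
  scale alike with it. Multiplied out, the formula also covers \<open>x = b\<close>.\<close>

lemma lagr_eq_poly_quotient:
  assumes X: "finite X" and b: "b \<in> X" and w: "\<And>x. x \<in> X \<Longrightarrow> poly w x = 0" and deg: "degree w \<le> card X"
  shows "lagr X b x * (x - b) * poly (pderiv w) b = poly w x"
proof -
  have "(\<Prod>z\<in>X. [:- z, 1:]) dvd w" using X w by (rule prod_linear_dvd)
  then obtain v where v: "w = (\<Prod>z\<in>X. [:- z, 1:]) * v" by (rule dvdE)
  have degP: "degree (\<Prod>z\<in>X. [:- z, 1:]) = card X" by (subst degree_prod_eq_sum_degree) auto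
  have "\<exists>k. w = smult k (\<Prod>z\<in>X. [:- z, 1:])"
  proof (cases "v = 0")
    case False
    moreover have "(\<Prod>z\<in>X. [:- z, 1:]) \<noteq> 0" using X by (simp add: prod_zero_iff)
    ultimately have "degree v = 0" using deg degP unfolding v by (simp add: degree_mult_eq)
    then obtain k where "v = [:k:]" using degree_eq_zeroE by blast
    then show ?thesis using v by (intro exI[of _ k]) simp
  qed (use v in auto)
  then obtain k where k: "w = smult k (\<Prod>z\<in>X. [:- z, 1:])" by blast
  define Q where "Q = (\<Prod>z\<in>X - {b}. [:- z, 1:])"
  have PQ: "(\<Prod>z\<in>X. [:- z, 1:]) = [:- b, 1:] * Q" unfolding Q_def by (rule prod.remove[OF X b])
  have "poly (pderiv w) b = k * poly Q b"
    unfolding k PQ pderiv_smult pderiv_mult by (simp add: pderiv_pCons)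
  moreover have "poly w x = k * ((x - b) * poly Q x)" unfolding k PQ poly_smult poly_mult by simp
  moreover have "lagr X b x = poly Q x / poly Q b" by (simp add: lagr_def Q_def poly_prod prod_dividef)
  moreover have "poly Q b \<noteq> 0" using X by (auto simp: Q_def poly_prod)
  ultimately show ?thesis by simp
qed

text \<open>The source of \<open>n \<ge> 2\<close>: the sum \<open>\<alpha> + \<beta> + 1\<close> is
  only known to exceed -1.\<close>

lemma jacobi_eigenvalue_ge:
  assumes "\<alpha> > -1" "\<beta> > -1" "n \<ge> 2"
  shows "jacobi_eigenvalue \<alpha> \<beta> n \<ge> 1"
proof -
  have "1 * 1 \<le> real n * (real n + \<alpha> + \<beta> + 1)" using assms by (intro mult_mono) auto
  then show ?thesis by (simp add: jacobi_eigenvalue_def)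
qed

text \<open>The zeros in the open interval are simple because the energy is positive there. If there
  were fewer than \<open>n\<close>, the product \<open>q\<close> of their linear factors would be
  orthogonal to \<open>p\<close>. But the cofactor \<open>h\<close> has no zero in the interval, so
  the product of \<open>p\<close> and \<open>q\<close> has constant sign there, which is
  impossible.\<close>

lemma jacobi_nodes_structure:
  assumes \<alpha>: "\<alpha> > -1" and \<beta>: "\<beta> > -1" and n: "n \<ge> 2"
  shows "finite (jacobi_nodes \<alpha> \<beta> n)" "card (jacobi_nodes \<alpha> \<beta> n) = n + 1"
    "jacobi_nodes \<alpha> \<beta> n = insert 1 {z. poly (jacobi_poly \<alpha> \<beta> n) z = 0}"
    "{z. poly (jacobi_poly \<alpha> \<beta> n) z = 0} \<subseteq> {-1<..<1}"
proof -
  define p where "p = jacobi_poly \<alpha> \<beta> n"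
  define \<mu> where "\<mu> = jacobi_eigenvalue \<alpha> \<beta> n"
  have \<mu>: "\<mu> \<ge> 1" unfolding \<mu>_def by (rule jacobi_eigenvalue_ge[OF assms])
  have p: "degree p = n" "p \<noteq> 0" "jacobi_ode \<alpha> \<beta> \<mu> p"
    using jacobi_poly_props[OF \<alpha> \<beta>, of n] by (simp_all add: p_def \<mu>_def)
  define R where "R = {z. poly p z = 0} \<inter> {-1<..<1}"
  have fin: "finite {z. poly p z = 0}" using p(2) by (rule poly_roots_finite)
  then have finR: "finite R" by (simp add: R_def)
  have simple: "poly (pderiv p) z \<noteq> 0" if "z \<in> R" for z
  proof
    assume "poly (pderiv p) z = 0"
    then have "jacobi_energy \<alpha> \<beta> \<mu> p z = 0" using that by (simp add: jacobi_energy_def R_def)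
    moreover have "jacobi_energy \<alpha> \<beta> \<mu> p z > 0" by (rule jacobi_energy_pos) (use that \<mu> p in \<open>auto
      simp: R_def\<close>)
    ultimately show False by simp
  qed
  have "card R \<ge> n"
  proof (rule ccontr)
    assume "\<not> card R \<ge> n"
    define q where "q = (\<Prod>z\<in>R. [:- z, 1::real:])"
    have "degree q = card R" unfolding q_def by (subst degree_prod_eq_sum_degree) auto
    then have dq: "degree q < n" using \<open>\<not> card R \<ge> n\<close> by simp
    have q0: "q \<noteq> 0" unfolding q_def using finR by (simp add: prod_zero_iff)
    have "q dvd p" unfolding q_def using finR by (rule prod_linear_dvd) (simp add: R_def)
    then obtain h where h: "p = q * h" by (rule dvdE)
    have hz: "poly h z \<noteq> 0" if z: "z \<in> {-1<..<1}" for z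
    proof
      assume h0: "poly h z = 0"
      then have "poly p z = 0" by (simp add: h)
      then have zR: "z \<in> R" using z by (simp add: R_def)
      then have "poly q z = 0" unfolding q_def using finR by (auto simp: poly_prod)
      then have "poly (pderiv p) z = 0" using h0 by (simp add: h pderiv_mult)
      then show False using simple[OF zR] by simp
    qed
    have sgn: "\<not> (poly h u < 0 \<and> poly h v > 0)" if "u \<in> {-1<..<1}" "v \<in> {-1<..<1}" for u v
    proof
      assume uv: "poly h u < 0 \<and> poly h v > 0"
      then consider "u < v" | "v < u" by (cases u v rule: linorder_cases) auto
      then show False
      proof cases
        case 1
        then obtain z where "u < z" "z < v" "poly h z = 0" using poly_IVT_pos[of u v h] uv by auto
        then show False using hz[of z] that by auto
      next
        case 2
        then obtain z where "v < z" "z < u" "poly h z = 0" using poly_IVT_neg[of v u h] uv by auto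
        then show False using hz[of z] that by auto
      qed
    qed
    have pq: "poly (p * q) x = (poly q x)\<^sup>2 * poly h x" for x by (simp add: h power2_eq_square)
    have int: "((\<lambda>x. poly (p * q) x * jacobi_weight \<alpha> \<beta> x) has_integral 0) {-1..1}"
      using jacobi_ode_orthogonal[OF \<alpha> \<beta> p(3)[unfolded \<mu>_def] dq] by simp
    have "p * q = 0"
    proof (cases "\<exists>v\<in>{-1<..<1}. poly h v > 0")
      case True
      then have h0: "poly h x \<ge> 0" if "x \<in> {-1<..<1}" for x using sgn[OF that] by fastforce
      show ?thesis
      proof (rule nonneg_poly_integral_0_imp_0[OF int])
        show "poly (p * q) x \<ge> 0" if "x \<in> {-1<..<1}" for x unfolding pq using h0[OF that] by simp
      qed
    next
      case False
      have "((\<lambda>x. poly (- (p * q)) x * jacobi_weight \<alpha> \<beta> x) has_integral 0) {-1..1}"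
        using has_integral_neg[OF int] by simp
      then have "- (p * q) = 0"
      proof (rule nonneg_poly_integral_0_imp_0)
        fix x :: real assume "x \<in> {-1<..<1}"
        then have "poly h x \<le> 0" using False by force
        then show "0 \<le> poly (- (p * q)) x" using pq[of x] by (simp add: mult_nonneg_nonpos)
      qed
      then show ?thesis by simp
    qed
    then show False using p(2) q0 by simp
  qed
  moreover have "card {z. poly p z = 0} \<le> n" using card_poly_roots_bound[OF p(2)] p(1) by simp
  moreover have "R \<subseteq> {z. poly p z = 0}" by (simp add: R_def)
  ultimately have eq: "R = {z. poly p z = 0}" "card R = n"
    using fin card_mono[OF fin, of R] card_subset_eq[OF fin, of R] by auto
  then show sub: "{z. poly (jacobi_poly \<alpha> \<beta> n) z = 0} \<subseteq> {-1<..<1}" by (auto simp: p_def[symmetric] R_def)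
  show nodes: "jacobi_nodes \<alpha> \<beta> n = insert 1 {z. poly (jacobi_poly \<alpha> \<beta> n) z = 0}"
    by (auto simp: jacobi_nodes_def)
  have "1 \<notin> R" by (simp add: R_def)
  then show "finite (jacobi_nodes \<alpha> \<beta> n)" "card (jacobi_nodes \<alpha> \<beta> n) = n + 1"
    unfolding nodes p_def[symmetric] using eq finR by auto
qed

text \<open>The case of the node 1, where the fundamental polynomial is \<open>p\<close> divided by
  its value at 1 and that value brings in \<open>\<mu> powr (- a)\<close>. The base \<open>6\<close>
  is \<open>3 / c\<close> for \<open>c = 1/2\<close>; \<open>3\<close> bounds the distance to the
  farther end.\<close>

lemma lagr_end_bound:
  fixes a b x \<mu> :: real
  assumes \<mu>: "\<mu> \<ge> 1" and x: "x \<in> {-1..1}"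
  shows "\<mu> powr (- a) * ((1 - x + 1/\<mu>) powr (- a) * (1 + x + 1/\<mu>) powr (- b))
    \<le> 6 powr (\<bar>a\<bar> + \<bar>b\<bar>) * 3 powr (\<bar>a\<bar> + \<bar>b\<bar>) * lagr_growth a b \<mu>"
proof -
  define S where "S = 1 - x + 1/\<mu>"
  define S' where "S' = 1 + x + 1/\<mu>"
  define P where "P = (6::real) powr (\<bar>a\<bar> + \<bar>b\<bar>)"
  define Q where "Q = (3::real) powr (\<bar>a\<bar> + \<bar>b\<bar>)"
  have PQ: "P > 0" "Q > 0" by (auto simp: P_def Q_def)
  have xb: "-1 \<le> x" "x \<le> 1" using x by auto
  have \<mu>1: "0 < 1 / \<mu>" "1 / \<mu> \<le> 1" "1/2 / \<mu> \<le> 1 / \<mu>" using \<mu> by (auto simp: field_simps)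
  have S: "1/2 / \<mu> \<le> S" "S \<le> 3" "1/2 / \<mu> \<le> S'" "S' \<le> 3" using xb \<mu>1 unfolding S_def S'_def by linarith+
  have two: "u powr e \<le> P * (1 + \<mu> powr (- e))" if "1/2 / \<mu> \<le> u" "u \<le> 3" "\<bar>e\<bar> \<le> \<bar>a\<bar> + \<bar>b\<bar>" for u e
    using powr_le_two_sided[of "1/2" \<mu> u e "\<bar>a\<bar> + \<bar>b\<bar>"] that \<mu> by (simp add: P_def)
  have bdd: "u powr e \<le> Q" if "1 \<le> u" "u \<le> 3" "\<bar>e\<bar> \<le> \<bar>a\<bar> + \<bar>b\<bar>" for u e
  proof -
    have "u powr e \<le> 3 powr \<bar>e\<bar> * 1 powr e" using that by (intro powr_le_of_ratio) auto
    also have "\<dots> \<le> Q" using that by (simp add: Q_def)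
    finally show ?thesis .
  qed
  have gr: "\<mu> powr (- a) * (1 + \<mu> powr a) \<le> lagr_growth a b \<mu>" "\<mu> powr (- a) * (1 + \<mu> powr b)
    \<le> lagr_growth a b \<mu>"
    using \<mu> by (simp_all add: lagr_growth_def distrib_left powr_add[symmetric] powr_diff powr_minus_divide)
  have "\<mu> powr (- a) * (S powr (- a) * S' powr (- b)) \<le> P * Q * lagr_growth a b \<mu>"
  proof (cases "x \<ge> 0")
    case True
    then have "1 \<le> S'" using \<mu>1 unfolding S'_def by linarith
    then have "\<mu> powr (- a) * (S powr (- a) * S' powr (- b)) \<le> \<mu> powr (- a) * (P * (1
      + \<mu> powr (- (- a))) * Q)"
      using S PQ by (intro mult_left_mono mult_mono two bdd) auto
    also have "\<dots> = P * Q * (\<mu> powr (- a) * (1 + \<mu> powr a))" by simp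
    also have "\<dots> \<le> P * Q * lagr_growth a b \<mu>" using gr PQ by (intro mult_left_mono) auto
    finally show ?thesis .
  next
    case False
    then have "1 \<le> S" using \<mu>1 unfolding S_def by linarith
    then have "\<mu> powr (- a) * (S powr (- a) * S' powr (- b)) \<le> \<mu> powr (- a) * (Q * (P * (1
      + \<mu> powr (- (- b)))))"
      using S PQ by (intro mult_left_mono mult_mono two bdd) auto
    also have "\<dots> = P * Q * (\<mu> powr (- a) * (1 + \<mu> powr b))" by simp
    also have "\<dots> \<le> P * Q * lagr_growth a b \<mu>" using gr PQ by (intro mult_left_mono) auto
    finally show ?thesis .
  qed
  then show ?thesis by (simp add: S_def S'_def P_def Q_def)
qed

text \<open>For a node z other than 1 the energy at z bounds the derivative of \<open>p\<close>
  there from below. Far from z this meets the upper bound for \<open>p\<close>. Close to z the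
  quotient p(x) / (x - z) is a value of the derivative between them, and comparability of the
  energies leaves only a constant.\<close>

lemma jacobi_lagr_bound:
  assumes \<alpha>: "\<alpha> > -1" and \<beta>: "\<beta> > -1"
  shows "\<exists>C>0. \<forall>n\<ge>2. \<forall>b\<in>jacobi_nodes \<alpha> \<beta> n. \<forall>x\<in>{-1..1}. (lagr (jacobi_nodes \<alpha> \<beta> n) b x)\<^sup>2
     \<le> C * lagr_growth (\<alpha> + 1/2) (\<beta> + 1/2) (jacobi_eigenvalue \<alpha> \<beta> n)"
proof -
  define a where "a = \<alpha> + 1/2"
  define b where "b = \<beta> + 1/2"
  have ab: "a > -1/2" "b > -1/2" using \<alpha> \<beta> by (auto simp: a_def b_def)
  obtain c C where c: "0 < c" "c \<le> 1/2" and C: "0 < C" and est: "\<And>\<mu> p. \<mu> \<ge> 1 \<Longrightarrow> jacobi_ode \<alpha> \<beta> \<mu> p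
    \<Longrightarrow> p \<noteq> 0 \<Longrightarrow> (\<exists>A>0.
     (\<forall>x\<in>{-1..1}. (poly p x)\<^sup>2 * ((1 - x + 1/\<mu>) powr a * (1 + x + 1/\<mu>) powr b) \<le> C * A) \<and>
     (\<forall>x\<in>{-1..1}. poly p x = 0 \<longrightarrow> c \<le> \<mu> * (1 - x) \<and> c \<le> \<mu> * (1 + x)) \<and>
     (\<forall>x\<in>{-1..1}. c / 2 \<le> \<mu> * (1 - x) \<longrightarrow> c / 2 \<le> \<mu> * (1 + x) \<longrightarrow>
        jacobi_energy \<alpha> \<beta> \<mu> p x \<le> C * A \<and> A \<le> C * jacobi_energy \<alpha> \<beta> \<mu> p x) \<and>
     A \<le> C * \<mu> powr (- a) * (poly p 1)\<^sup>2)"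
    using jacobi_estimates[OF \<alpha> \<beta>] unfolding a_def b_def by blast
  \<comment> \<open>\<open>K1\<close> belongs to the node 1, \<open>K2\<close> to points far from
    the node and \<open>K3\<close> to points close to it; the summand 1 in the final constant covers
    the node itself.\<close>
  define K1 where "K1 = C\<^sup>2 * (6 powr (\<bar>a\<bar> + \<bar>b\<bar>) * 3 powr (\<bar>a\<bar> + \<bar>b\<bar>))"
  define K2 where "K2 = C\<^sup>2 * (72 * ((3 / c) powr (\<bar>a\<bar> + \<bar>b\<bar> + 5)) ^ 5)"
  define K3 where "K3 = C\<^sup>2 * (9/4) * (2 powr \<bar>a + 1\<bar> * 2 powr \<bar>b + 1\<bar>)"
  have K0: "K1 \<ge> 0" "K2 \<ge> 0" "K3 \<ge> 0" by (auto simp: K1_def K2_def K3_def)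
  have main: "(lagr (jacobi_nodes \<alpha> \<beta> n) z x)\<^sup>2 \<le> (1 + K1 + K2
    + K3) * lagr_growth a b (jacobi_eigenvalue \<alpha> \<beta> n)"
    if n: "n \<ge> 2" and z: "z \<in> jacobi_nodes \<alpha> \<beta> n" and x: "x \<in> {-1..1}" for n z x
  proof -
    define p where "p = jacobi_poly \<alpha> \<beta> n"
    define \<mu> where "\<mu> = jacobi_eigenvalue \<alpha> \<beta> n"
    define X where "X = jacobi_nodes \<alpha> \<beta> n"
    define H where "H = lagr_growth a b \<mu>"
    have \<mu>: "\<mu> \<ge> 1" unfolding \<mu>_def by (rule jacobi_eigenvalue_ge[OF \<alpha> \<beta> n])
    have p: "degree p = n" "p \<noteq> 0" "jacobi_ode \<alpha> \<beta> \<mu> p"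
      using jacobi_poly_props[OF \<alpha> \<beta>, of n] by (simp_all add: p_def \<mu>_def)
    note st = jacobi_nodes_structure[OF \<alpha> \<beta> n, folded X_def p_def]
    have H1: "H \<ge> 1" by (simp add: H_def lagr_growth_def)
    obtain A where A: "A > 0"
      and up: "\<And>x. x \<in> {-1..1} \<Longrightarrow> (poly p x)\<^sup>2 * ((1 - x + 1/\<mu>) powr a * (1 + x + 1/\<mu>) powr b) \<le> C * A"
      and rt: "\<And>x. x \<in> {-1..1} \<Longrightarrow> poly p x = 0 \<Longrightarrow> c \<le> \<mu> * (1 - x) \<and> c \<le> \<mu> * (1 + x)"
      and en: "\<And>x. x \<in> {-1..1} \<Longrightarrow> c / 2 \<le> \<mu> * (1 - x) \<Longrightarrow> c / 2 \<le> \<mu> * (1 + x) \<Longrightarrow>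
        jacobi_energy \<alpha> \<beta> \<mu> p x \<le> C * A \<and> A \<le> C * jacobi_energy \<alpha> \<beta> \<mu> p x"
      and p1: "A \<le> C * \<mu> powr (- a) * (poly p 1)\<^sup>2"
      using est[OF \<mu> p(3,2)] by blast
    define w where "w = [:1, -1:] * p"
    have w: "poly w y = (1 - y) * poly p y" "poly (pderiv w) y = (1 - y) * poly (pderiv p) y - poly p y" for y
      unfolding w_def pderiv_mult by (simp_all add: pderiv_pCons algebra_simps)
    have degw: "degree w \<le> card X" using degree_mult_le[of "[:1, -1::real:]" p] p(1) st(2) by
      (simp add: w_def)
    have quot: "lagr X z x * (x - z) * ((1 - z) * poly (pderiv p) z - poly p z) = (1 - x) * poly p x"
      using lagr_eq_poly_quotient[OF st(1) z[folded X_def] _ degw, of x] st(3) by (auto simp: w)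
    define S where "S = 1 - x + 1/\<mu>"
    define S' where "S' = 1 + x + 1/\<mu>"
    have \<mu>1: "0 < 1 / \<mu>" using \<mu> by simp
    have Spos: "S > 0" "S' > 0" using x \<mu>1 unfolding S_def S'_def by (auto intro: add_nonneg_pos)
    have px: "(poly p x)\<^sup>2 \<le> C * A * (S powr (- a) * S' powr (- b))"
    proof -
      have "(poly p x)\<^sup>2 * (S powr a * S' powr b) \<le> C * A" using up[OF x] by (simp only: S_def S'_def)
      then show ?thesis using Spos by (simp add: powr_minus_divide field_simps)
    qed
    have "(lagr X z x)\<^sup>2 \<le> (1 + K1 + K2 + K3) * H"
    proof (cases "x = z")
      case True
      then have "lagr X z x = 1" using lagr_node[OF z[folded X_def] st(1) z[folded X_def]] by simp
      moreover have "1 * 1 \<le> (1 + K1 + K2 + K3) * H" using H1 K0 by (intro mult_mono) auto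
      ultimately show ?thesis by simp
    next
      case xz: False
      show ?thesis
      proof (cases "z = 1")
        case True
        have p10: "poly p 1 \<noteq> 0" using st(4) by auto
        have "lagr X z x * poly p 1 = poly p x"
        proof -
          have "(1 - x) * (lagr X z x * poly p 1) = (1 - x) * poly p x" using quot True by
            (simp add: algebra_simps)
          then show ?thesis using xz True by simp
        qed
        then have "(lagr X z x)\<^sup>2 * (poly p 1)\<^sup>2 = (poly p x)\<^sup>2" by (metis power_mult_distrib)
        also have "\<dots> \<le> C * A * (S powr (- a) * S' powr (- b))" by (rule px)
        also have "\<dots> \<le> C * (C * \<mu> powr (- a) * (poly p 1)\<^sup>2) * (S powr (- a) * S' powr (- b))"
          using p1 C by (intro mult_right_mono mult_left_mono) auto
        also have "\<dots> = C\<^sup>2 * (\<mu> powr (- a) * (S powr (- a) * S' powr (- b))) * (poly p 1)\<^sup>2"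
          by (simp add: power2_eq_square mult_ac)
        finally have "(lagr X z x)\<^sup>2 \<le> C\<^sup>2 * (\<mu> powr (- a) * (S powr (- a) * S' powr (- b)))"
          using p10 by simp
        also have "\<dots> \<le> K1 * H"
          using mult_left_mono[OF lagr_end_bound[OF \<mu> x, of a b], of "C\<^sup>2"]
          by (simp add: K1_def H_def S_def S'_def mult_ac)
        also have "\<dots> \<le> (1 + K1 + K2 + K3) * H" using K0 H1 by (intro mult_right_mono) auto
        finally show ?thesis .
      next
        case z1: False
        then have pz: "poly p z = 0" using z st(3) by (auto simp: X_def)
        then have zi: "-1 < z" "z < 1" using st(4) by auto
        define t where "t = 1 - z"
        define t' where "t' = 1 + z"
        define d where "d = poly (pderiv p) z"
        have t: "t > 0" "t' > 0" "t + t' = 2" using zi by (auto simp: t_def t'_def)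
        have rz: "c \<le> \<mu> * t" "c \<le> \<mu> * t'" using rt[of z] zi pz by (auto simp: t_def t'_def)
        have energy: "jacobi_energy \<alpha> \<beta> \<mu> p y = (1 - y) powr a * (1 + y) powr b * ((poly p y)\<^sup>2
          + (1 - y) * (1 + y) * (poly (pderiv p) y)\<^sup>2 / \<mu>)" for y
          by (simp add: jacobi_energy_def jacobi_weight_def a_def b_def power2_eq_square algebra_simps)
        have "A \<le> C * jacobi_energy \<alpha> \<beta> \<mu> p z" using en[of z] rz c zi by (auto simp: t_def t'_def)
        also have "jacobi_energy \<alpha> \<beta> \<mu> p z = t powr (a + 1) * t' powr (b + 1) * d\<^sup>2 / \<mu>"
          using t pz by (simp add: energy t_def[symmetric] t'_def[symmetric] d_def powr_add)
        finally have Ad: "A \<le> C * (t powr (a + 1) * t' powr (b + 1) * d\<^sup>2 / \<mu>)" .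
        have d0: "d \<noteq> 0" using Ad A by auto
        have q1: "lagr X z x * (x - z) * (t * d) = (1 - x) * poly p x" using quot pz by
          (simp add: t_def d_def)
        show ?thesis
        proof (cases "min t t' / 2 \<le> \<bar>(1 - x) - t\<bar>")
          case True
          define s where "s = 1 - x"
          have pos: "(x - z)\<^sup>2 * (t\<^sup>2 * d\<^sup>2) > 0" using xz t d0 by simp
          have "(lagr X z x)\<^sup>2 * ((x - z)\<^sup>2 * (t\<^sup>2 * d\<^sup>2)) = s\<^sup>2 * (poly p x)\<^sup>2"
            using arg_cong[OF q1, of "\<lambda>u. u\<^sup>2"] by (simp add: power_mult_distrib mult_ac s_def)
          also have "\<dots> \<le> s\<^sup>2 * (C * (C * (t powr (a + 1) * t' powr (b
            + 1) * d\<^sup>2 / \<mu>)) * (S powr (- a) * S' powr (- b)))"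
            using C Ad by (intro mult_left_mono order_trans[OF px] mult_right_mono) auto
          finally have "(lagr X z x)\<^sup>2 \<le> s\<^sup>2 * (C * (C * (t powr (a + 1) * t' powr (b
            + 1) * d\<^sup>2 / \<mu>)) * (S powr (- a) * S' powr (- b))) / ((x - z)\<^sup>2 * (t\<^sup>2 * d\<^sup>2))"
            using pos by (simp only: pos_le_divide_eq)
          also have "\<dots> = C\<^sup>2 * (s\<^sup>2 / (s - t)\<^sup>2 * (t powr (a - 1) * t' powr (b
            + 1) * (S powr (- a) * S' powr (- b))) / \<mu>)"
          proof -
            have "(x - z)\<^sup>2 = (s - t)\<^sup>2" by (simp add: s_def t_def power2_commute)
            moreover have "t powr (a + 1) = t powr (a - 1) * t\<^sup>2" using t by
              (simp add: powr_add powr_diff power2_eq_square)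
            ultimately show ?thesis using t d0 by (simp add: power2_eq_square mult_ac)
          qed
          also have "\<dots> \<le> C\<^sup>2 * (72 * ((3 / c) powr (\<bar>a\<bar> + \<bar>b\<bar> + 5)) ^ 5 * H)"
            unfolding H_def S_def S'_def s_def
            by (intro mult_left_mono lagr_far_bound) (use ab c \<mu> x t rz True in auto)
          also have "\<dots> = K2 * H" by (simp add: K2_def)
          also have "\<dots> \<le> (1 + K1 + K2 + K3) * H" using K0 H1 by (intro mult_right_mono) auto
          finally show ?thesis .
        next
          case False
          \<comment> \<open>Everything between \<open>x\<close> and \<open>z\<close> then has
            distances from both ends that agree with those of \<open>z\<close> up to a factor
            2.\<close>
          have near: "\<bar>x - z\<bar> < t / 2" "\<bar>x - z\<bar> < t' / 2" using False by (auto simp: t_def abs_minus_commute)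
          have "\<exists>\<xi>. (x < \<xi> \<and> \<xi> < z \<or> z < \<xi> \<and> \<xi> < x) \<and> poly p x = (x - z) * poly (pderiv p) \<xi>"
          proof (cases "x < z")
            case True
            from poly_MVT[OF this, of p] obtain \<xi> where "x < \<xi>" "\<xi> < z" "poly p z - poly p x
              = (z - x) * poly (pderiv p) \<xi>" by auto
            then show ?thesis using pz by (intro exI[of _ \<xi>]) (auto simp: algebra_simps)
          next
            case False
            then have "z < x" using xz by simp
            from poly_MVT[OF this, of p] obtain \<xi> where "z < \<xi>" "\<xi> < x" "poly p x - poly p z
              = (x - z) * poly (pderiv p) \<xi>" by auto
            then show ?thesis using pz by auto
          qed
          then obtain \<xi> where \<xi>: "x < \<xi> \<and> \<xi> < z \<or> z < \<xi> \<and> \<xi> < x" "poly p x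
            = (x - z) * poly (pderiv p) \<xi>" by blast
          define \<tau> where "\<tau> = 1 - \<xi>"
          define \<tau>' where "\<tau>' = 1 + \<xi>"
          define e where "e = poly (pderiv p) \<xi>"
          have \<tau>: "t / 2 \<le> \<tau>" "\<tau> \<le> 2 * t" "t' / 2 \<le> \<tau>'" "\<tau>' \<le> 2 * t'" "\<xi> \<in> {-1..1}"
            using \<xi>(1) near x zi by (auto simp: \<tau>_def \<tau>'_def t_def t'_def abs_if split: if_splits)
          have \<tau>0: "\<tau> > 0" "\<tau>' > 0" using \<tau> t by linarith+
          have "\<mu> * (t / 2) \<le> \<mu> * \<tau>" "\<mu> * (t' / 2) \<le> \<mu> * \<tau>'" using \<tau> \<mu> by (auto intro!: mult_left_mono)
          then have r\<xi>: "c / 2 \<le> \<mu> * \<tau>" "c / 2 \<le> \<mu> * \<tau>'" using rz by linarith+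
          have "\<tau> powr a * \<tau>' powr b * (\<tau> * \<tau>' * e\<^sup>2 / \<mu>) \<le> \<tau> powr a * \<tau>' powr b * ((poly p \<xi>)\<^sup>2
            + \<tau> * \<tau>' * e\<^sup>2 / \<mu>)"
            by (intro mult_left_mono) auto
          also have "\<dots> = jacobi_energy \<alpha> \<beta> \<mu> p \<xi>" by (simp add: energy \<tau>_def \<tau>'_def e_def)
          also have "\<dots> \<le> C * A" using en[OF \<tau>(5)] r\<xi> by (auto simp: \<tau>_def \<tau>'_def)
          also have "\<dots> \<le> C * (C * (t powr (a + 1) * t' powr (b + 1) * d\<^sup>2 / \<mu>))" using Ad C
            by (intro mult_left_mono) auto
          finally have "\<tau> powr (a + 1) * \<tau>' powr (b + 1) * e\<^sup>2 / \<mu> \<le> C\<^sup>2 * (t powr (a + 1) * t' powr (b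
            + 1)) * d\<^sup>2 / \<mu>"
            using \<tau>0 by (simp add: powr_add power2_eq_square mult_ac)
          then have e1: "\<tau> powr (a + 1) * \<tau>' powr (b + 1) * e\<^sup>2 \<le> C\<^sup>2 * (t powr (a + 1) * t' powr (b + 1)) * d\<^sup>2"
            using \<mu> by (simp add: divide_le_cancel)
          have "t powr (a + 1) * t' powr (b + 1) \<le> (2 powr \<bar>a + 1\<bar> * \<tau> powr (a + 1)) * (2 powr \<bar>b
            + 1\<bar> * \<tau>' powr (b + 1))"
            using \<tau> \<tau>0 t by (intro mult_mono powr_le_of_ratio) auto
          then have "\<tau> powr (a + 1) * \<tau>' powr (b + 1) * e\<^sup>2 \<le> C\<^sup>2 * ((2 powr \<bar>a + 1\<bar> * \<tau> powr (a
            + 1)) * (2 powr \<bar>b + 1\<bar> * \<tau>' powr (b + 1))) * d\<^sup>2"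
            by (intro order_trans[OF e1] mult_right_mono mult_left_mono) auto
          then have "(\<tau> powr (a + 1) * \<tau>' powr (b + 1)) * e\<^sup>2 \<le> (\<tau> powr (a + 1) * \<tau>' powr (b
            + 1)) * (C\<^sup>2 * (2 powr \<bar>a + 1\<bar> * 2 powr \<bar>b + 1\<bar>) * d\<^sup>2)"
            by (simp add: mult_ac)
          then have e2: "e\<^sup>2 \<le> C\<^sup>2 * (2 powr \<bar>a + 1\<bar> * 2 powr \<bar>b + 1\<bar>) * d\<^sup>2"
            using \<tau>0 by (subst (asm) mult_le_cancel_left_pos) auto
          have "(x - z) * (lagr X z x * (t * d)) = (x - z) * ((1 - x) * e)" using q1 \<xi>(2) by
            (simp add: e_def mult_ac)
          then have "lagr X z x * (t * d) = (1 - x) * e" using xz by simp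
          then have "(lagr X z x)\<^sup>2 * (t\<^sup>2 * d\<^sup>2) = (1 - x)\<^sup>2 * e\<^sup>2" by (metis power_mult_distrib)
          also have "\<dots> \<le> (3/2 * t)\<^sup>2 * (C\<^sup>2 * (2 powr \<bar>a + 1\<bar> * 2 powr \<bar>b + 1\<bar>) * d\<^sup>2)"
            using near(1) x by (intro mult_mono power_mono e2) (auto simp: t_def abs_if split: if_splits)
          also have "\<dots> = K3 * (t\<^sup>2 * d\<^sup>2)" by (simp add: K3_def power2_eq_square)
          finally have "(lagr X z x)\<^sup>2 \<le> K3 * 1" using t d0 by simp
          also have "\<dots> \<le> (1 + K1 + K2 + K3) * H" using K0 H1 by (intro mult_mono) auto
          finally show ?thesis .
        qed
      qed
    qed
    then show ?thesis by (simp add: X_def H_def \<mu>_def)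
  qed
  show ?thesis
    by (rule exI[of _ "1 + K1 + K2 + K3"]) (use main K0 in \<open>auto simp: a_def b_def\<close>)
qed

section \<open>Approximation of step functions in the mean\<close>

lemma chebyshev_poly_exists:
  "\<exists>T :: real poly. degree T \<le> m \<and> (\<forall>\<theta>. poly T (cos \<theta>) = cos (real m * \<theta>))"
proof (induction m rule: less_induct)
  case (less m)
  consider "m = 0" | "m = 1" | k where "m = Suc (Suc k)" by (metis One_nat_def not0_implies_Suc)
  then show ?case
  proof cases
    case 1
    then show ?thesis by (intro exI[of _ 1]) auto
  next
    case 2
    then show ?thesis by (intro exI[of _ "[:0, 1:]"]) auto
  next
    case 3
    obtain T where T: "degree T \<le> k" "\<And>\<theta>. poly T (cos \<theta>) = cos (real k * \<theta>)"
      using less[of k] 3 by auto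
    obtain U where U: "degree U \<le> Suc k" "\<And>\<theta>. poly U (cos \<theta>) = cos (real (Suc k) * \<theta>)"
      using less[of "Suc k"] 3 by auto
    have "degree ([:0, 2:] * U) \<le> m" using degree_mult_le[of "[:0, 2::real:]" U] U 3 by simp
    then have "degree ([:0, 2:] * U - T) \<le> m" using T 3 by (intro degree_diff_le) auto
    moreover have "poly ([:0, 2:] * U - T) (cos \<theta>) = cos (real m * \<theta>)" for \<theta>
    proof -
      have "cos (real (Suc k) * \<theta> + \<theta>) + cos (real (Suc k) * \<theta> - \<theta>) = 2 * cos \<theta> * cos (real (Suc k) * \<theta>)"
        by (simp add: cos_add cos_diff)
      moreover have "real (Suc k) * \<theta> + \<theta> = real m * \<theta>" "real (Suc k) * \<theta> - \<theta> = real k * \<theta>"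
        using 3 by (simp_all add: algebra_simps)
      ultimately show ?thesis by (simp add: T U algebra_simps)
    qed
    ultimately show ?thesis by blast
  qed
qed

text \<open>Jordan's inequality, from the concavity of the sine.\<close>

lemma sin_half_lower:
  fixes x :: real
  assumes "0 \<le> x" "x \<le> pi"
  shows "x / pi \<le> sin (x / 2)"
proof -
  have "convex_on {0..pi} (\<lambda>x. - sin x)"
    by (rule f''_ge0_imp_convex[where f' = "\<lambda>x. - cos x" and f'' = sin])
       (auto intro!: derivative_eq_intros sin_ge_zero)
  then have "- sin ((1 - x / pi) *\<^sub>R 0 + (x / pi) *\<^sub>R (pi / 2)) \<le> (1 - x / pi) * - sin 0
    + (x / pi) * - sin (pi / 2)"
    using assms by (intro convex_onD) auto
  then show ?thesis by simp
qed

text \<open>The difference of cosines is, up to sign, twice the product of the sines of half the sum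
  and of half the difference. The former is at least \<open>sin \<phi> / 2\<close>, the latter is
  bounded below by Jordan's inequality.\<close>

lemma sin_mult_diff_le:
  fixes \<theta> \<phi> :: real
  assumes "0 \<le> \<theta>" "\<theta> \<le> pi" "0 \<le> \<phi>" "\<phi> \<le> pi"
  shows "sin \<phi> * \<bar>\<theta> - \<phi>\<bar> \<le> pi * \<bar>cos \<theta> - cos \<phi>\<bar>"
proof -
  have r: "sin (\<theta> / 2) \<ge> 0" "cos (\<theta> / 2) \<ge> 0" "sin (\<phi> / 2) \<ge> 0" "cos (\<phi> / 2) \<ge> 0"
    using assms by (auto intro!: sin_ge_zero cos_ge_zero)
  have "(sin (\<theta> / 2) + cos (\<theta> / 2))\<^sup>2 = (sin (\<theta> / 2))\<^sup>2 + (cos (\<theta> / 2))\<^sup>2 + 2 * (sin (\<theta> / 2) * cos (\<theta> / 2))"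
    by (simp add: power2_sum)
  moreover have "0 \<le> sin (\<theta> / 2) * cos (\<theta> / 2)" using r by simp
  ultimately have "1\<^sup>2 \<le> (sin (\<theta> / 2) + cos (\<theta> / 2))\<^sup>2" by simp
  then have one: "1 \<le> sin (\<theta> / 2) + cos (\<theta> / 2)" by (rule power2_le_imp_le) (use r in simp)
  have "sin \<phi> / 2 = sin (\<phi> / 2) * cos (\<phi> / 2)" using sin_double[of "\<phi> / 2"] by simp
  also have "\<dots> \<le> (sin (\<theta> / 2) + cos (\<theta> / 2)) * (sin (\<phi> / 2) * cos (\<phi> / 2))"
    using one r mult_right_mono[OF one, of "sin (\<phi> / 2) * cos (\<phi> / 2)"] by simp
  also have "\<dots> = sin (\<theta> / 2) * (sin (\<phi> / 2) * cos (\<phi> / 2)) + cos (\<theta> / 2) * (sin (\<phi> / 2) * cos (\<phi> / 2))"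
    by (simp add: distrib_right)
  also have "\<dots> \<le> sin (\<theta> / 2) * (1 * cos (\<phi> / 2)) + cos (\<theta> / 2) * (sin (\<phi> / 2) * 1)"
    using r by (intro add_mono mult_left_mono mult_right_mono) auto
  also have "\<dots> = sin ((\<theta> + \<phi>) / 2)" by (simp add: add_divide_distrib sin_add)
  finally have A: "sin \<phi> \<le> 2 * sin ((\<theta> + \<phi>) / 2)" by simp
  have "\<bar>\<theta> - \<phi>\<bar> / pi \<le> sin (\<bar>\<theta> - \<phi>\<bar> / 2)" using assms by (intro sin_half_lower) auto
  also have "\<dots> \<le> \<bar>sin ((\<theta> - \<phi>) / 2)\<bar>"
  proof (cases "\<theta> \<ge> \<phi>")
    case False
    have "(\<theta> - \<phi>) / 2 = - ((\<phi> - \<theta>) / 2)" by (simp add: field_simps)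
    then have "\<bar>sin ((\<theta> - \<phi>) / 2)\<bar> = \<bar>sin ((\<phi> - \<theta>) / 2)\<bar>" by (simp only: sin_minus abs_minus_cancel)
    then show ?thesis using False by simp
  qed simp
  finally have B: "\<bar>\<theta> - \<phi>\<bar> \<le> pi * \<bar>sin ((\<theta> - \<phi>) / 2)\<bar>" by (simp add: field_simps)
  have "sin \<phi> * \<bar>\<theta> - \<phi>\<bar> \<le> (2 * sin ((\<theta> + \<phi>) / 2)) * (pi * \<bar>sin ((\<theta> - \<phi>) / 2)\<bar>)"
    using assms A by (intro mult_mono B A) (auto intro!: sin_ge_zero mult_nonneg_nonneg)
  also have "\<dots> = pi * \<bar>cos \<theta> - cos \<phi>\<bar>"
  proof -
    have "cos \<theta> - cos \<phi> = - 2 * (sin ((\<theta> + \<phi>) / 2) * sin ((\<theta> - \<phi>) / 2))"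
    proof -
      have "(\<phi> - \<theta>) / 2 = - ((\<theta> - \<phi>) / 2)" by (simp add: field_simps)
      then have "sin ((\<phi> - \<theta>) / 2) = - sin ((\<theta> - \<phi>) / 2)" by (simp only: sin_minus)
      then show ?thesis by (subst cos_diff_cos) simp
    qed
    moreover have "sin ((\<theta> + \<phi>) / 2) \<ge> 0" using assms by (intro sin_ge_zero) auto
    ultimately show ?thesis by (simp add: abs_mult)
  qed
  finally show ?thesis .
qed

lemma abs_cos_diff_le: "\<bar>cos x - cos y\<bar> \<le> \<bar>x - y\<bar>" for x y :: real
  using field_differentiable_bound[of UNIV cos "\<lambda>x. - sin x" 1 x y]
  by (auto intro!: derivative_eq_intros)

text \<open>At the zeros of \<open>cos (N * \<theta>)\<close> the derivative of the Chebyshev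
  polynomial times \<open>sin (\<phi> j)\<close> has modulus \<open>N\<close>, so the quotient
  formula gives the decay at once; the bound by pi uses in addition that the numerator vanishes at
  \<open>\<phi> j\<close>. Consecutive angles differ by \<open>pi / N\<close>, and so do the nodes
  at most. The first alternative of the gap condition covers \<open>y\<close> beyond the last
  node.\<close>

lemma chebyshev_nodes:
  assumes N: "N \<ge> 1"
  obtains X :: "real set" where "finite X" "card X = N"
    "\<And>y. y \<in> {-1..1} \<Longrightarrow> (\<forall>w\<in>X. w < y) \<and> 1 \<le> y + pi / N \<or> (\<exists>w\<in>X. y \<le> w \<and> w \<le> y + pi / N)"
    "\<And>b x. b \<in> X \<Longrightarrow> x \<in> {-1..1} \<Longrightarrow> \<bar>lagr X b x\<bar> \<le> pi"
    "\<And>b x. b \<in> X \<Longrightarrow> x \<in> {-1..1} \<Longrightarrow> \<bar>lagr X b x\<bar> * (real N * \<bar>x - b\<bar>) \<le> 1"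
proof -
  define \<phi> where "\<phi> j = (2 * real j + 1) * pi / (2 * N)" for j :: nat
  define X where "X = (\<lambda>j. cos (\<phi> j)) ` {..<N}"
  have \<phi>0: "\<phi> j > 0" for j using N by (simp add: \<phi>_def)
  have \<phi>pi: "\<phi> j < pi" if "j < N" for j
  proof -
    have "2 * real j + 1 < 2 * real N" using that by linarith
    then have "(2 * real j + 1) * pi < (2 * real N) * pi" by (intro mult_strict_right_mono) auto
    then show ?thesis using N by (simp add: \<phi>_def divide_less_eq mult.commute)
  qed
  have fin: "finite X" by (simp add: X_def)
  have inj: "inj_on (\<lambda>j. cos (\<phi> j)) {..<N}"
  proof (rule inj_onI)
    fix i j assume ij: "i \<in> {..<N}" "j \<in> {..<N}" "cos (\<phi> i) = cos (\<phi> j)"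
    have "\<phi> i \<ge> 0" "\<phi> j \<ge> 0" "\<phi> i \<le> pi" "\<phi> j \<le> pi"
      using \<phi>0[of i] \<phi>0[of j] \<phi>pi[of i] \<phi>pi[of j] ij by auto
    then have "\<phi> i = \<phi> j" using cos_inj_pi[of "\<phi> i" "\<phi> j"] ij(3) by simp
    then show "i = j" using N by (simp add: \<phi>_def)
  qed
  have card: "card X = N" unfolding X_def using card_image[OF inj] by simp
  obtain T where T: "degree T \<le> N" "\<And>\<theta>. poly T (cos \<theta>) = cos (real N * \<theta>)"
    using chebyshev_poly_exists[of N] by blast
  have cosN: "cos (real N * \<phi> j) = 0" for j
  proof -
    have "real N * \<phi> j = real j * pi + pi / 2" using N by (simp add: \<phi>_def field_simps)
    then show ?thesis by (simp add: cos_add)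
  qed
  have T0: "poly T w = 0" if "w \<in> X" for w using that by (auto simp: X_def T cosN)
  have dT: "\<bar>poly (pderiv T) (cos (\<phi> j))\<bar> * sin (\<phi> j) = N" if "j < N" for j
  proof -
    have "((\<lambda>\<theta>. poly T (cos \<theta>)) has_real_derivative poly (pderiv T) (cos (\<phi> j)) * (- sin (\<phi> j))) (at (\<phi> j))"
      by (rule DERIV_chain2[OF poly_DERIV]) (auto intro!: derivative_eq_intros)
    moreover have "((\<lambda>\<theta>. poly T (cos \<theta>)) has_real_derivative - sin (real N * \<phi> j) * real N) (at (\<phi> j))"
      unfolding T by (auto intro!: derivative_eq_intros)
    ultimately have eq: "poly (pderiv T) (cos (\<phi> j)) * (- sin (\<phi> j)) = - sin (real N * \<phi> j) * real N"
      by (rule DERIV_unique)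
    have "(sin (real N * \<phi> j))\<^sup>2 = 1" using sin_cos_squared_add[of "real N * \<phi> j"] cosN by simp
    then have "\<bar>sin (real N * \<phi> j)\<bar> = 1" by (auto simp: power2_eq_1_iff)
    moreover have "sin (\<phi> j) > 0" using \<phi>0 \<phi>pi that by (intro sin_gt_zero) auto
    ultimately show ?thesis using arg_cong[OF eq, of abs] by (simp add: abs_mult)
  qed
  have main: "\<bar>lagr X b x\<bar> * (real N * \<bar>x - b\<bar>) \<le> 1 \<and> \<bar>lagr X b x\<bar> \<le> pi" if b: "b \<in> X" and x: "x
    \<in> {-1..1}" for b x :: real
  proof -
    obtain j where j: "j < N" "b = cos (\<phi> j)" using b by (auto simp: X_def)
    define \<theta> where "\<theta> = arccos x"
    have \<theta>: "x = cos \<theta>" "0 \<le> \<theta>" "\<theta> \<le> pi" using x by (auto simp: \<theta>_def arccos_lbound arccos_ubound)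
    have s: "sin (\<phi> j) > 0" using \<phi>0 \<phi>pi j by (intro sin_gt_zero) auto
    have l: "lagr X b x * (x - b) * poly (pderiv T) b = cos (real N * \<theta>)"
      using lagr_eq_poly_quotient[OF fin b T0, of x] T card \<theta> by simp
    have "\<bar>lagr X b x\<bar> * (real N * \<bar>x - b\<bar>) = \<bar>lagr X b x\<bar> * ((\<bar>poly (pderiv T) b\<bar> * sin (\<phi> j)) * \<bar>x - b\<bar>)"
      using dT[OF j(1)] j(2) by simp
    also have "\<dots> = \<bar>lagr X b x * (x - b) * poly (pderiv T) b\<bar> * sin (\<phi> j)" by (simp add: abs_mult mult_ac)
    finally have eq: "\<bar>lagr X b x\<bar> * (real N * \<bar>x - b\<bar>) = \<bar>cos (real N * \<theta>)\<bar> * sin (\<phi> j)" unfolding l .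
    have "\<bar>cos (real N * \<theta>)\<bar> * sin (\<phi> j) \<le> 1 * 1" by (intro mult_mono) (use s in auto)
    then have A: "\<bar>lagr X b x\<bar> * (real N * \<bar>x - b\<bar>) \<le> 1" using eq by simp
    have "\<bar>lagr X b x\<bar> \<le> pi"
    proof (cases "x = b")
      case True
      then have "lagr X b x = 1" using lagr_node[OF b fin b] by simp
      then show ?thesis using pi_gt3 by simp
    next
      case False
      have "\<bar>cos (real N * \<theta>)\<bar> = \<bar>cos (real N * \<theta>) - cos (real N * \<phi> j)\<bar>" using cosN by simp
      also have "\<dots> \<le> \<bar>real N * \<theta> - real N * \<phi> j\<bar>" by (rule abs_cos_diff_le)
      also have "\<dots> = real N * \<bar>\<theta> - \<phi> j\<bar>" by (simp add: abs_mult right_diff_distrib[symmetric])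
      finally have "\<bar>cos (real N * \<theta>)\<bar> * sin (\<phi> j) \<le> real N * \<bar>\<theta> - \<phi> j\<bar> * sin (\<phi> j)"
        using s by (intro mult_right_mono) auto
      also have "\<dots> = real N * (sin (\<phi> j) * \<bar>\<theta> - \<phi> j\<bar>)" by simp
      also have "\<dots> \<le> real N * (pi * \<bar>cos \<theta> - cos (\<phi> j)\<bar>)"
        using \<theta> \<phi>0[of j] \<phi>pi[OF j(1)] by (intro mult_left_mono sin_mult_diff_le) auto
      finally have "\<bar>cos (real N * \<theta>)\<bar> * sin (\<phi> j) \<le> pi * (real N * \<bar>x - b\<bar>)"
        using \<theta>(1) j(2) by (simp add: mult_ac)
      then have "\<bar>lagr X b x\<bar> * (real N * \<bar>x - b\<bar>) \<le> pi * (real N * \<bar>x - b\<bar>)" unfolding eq .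
      moreover have "real N * \<bar>x - b\<bar> > 0" using False N by simp
      ultimately show ?thesis by (rule mult_right_le_imp_le)
    qed
    then show ?thesis using A by simp
  qed
  have gap: "(\<forall>w\<in>X. w < y) \<and> 1 \<le> y + pi / N \<or> (\<exists>w\<in>X. y \<le> w \<and> w \<le> y + pi / N)" if y: "y \<in> {-1..1}" for y
  proof -
    define \<tau> where "\<tau> = arccos y"
    have \<tau>: "y = cos \<tau>" "0 \<le> \<tau>" "\<tau> \<le> pi" using y by (auto simp: \<tau>_def arccos_lbound arccos_ubound)
    show ?thesis
    proof (cases "\<tau> < pi / (2 * N)")
      case True
      have "cos (\<phi> j) < cos \<tau>" if "j < N" for j
      proof (rule cos_monotone_0_pi)
        have "pi / (2 * N) \<le> \<phi> j" by (simp add: \<phi>_def divide_right_mono)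
        then show "\<tau> < \<phi> j" using True by simp
      qed (use \<tau> \<phi>pi[OF that] in auto)
      moreover have "\<bar>cos 0 - cos \<tau>\<bar> \<le> \<bar>0 - \<tau>\<bar>" by (rule abs_cos_diff_le)
      moreover have "pi / (2 * N) \<le> pi / N" using N by (intro divide_left_mono) auto
      ultimately show ?thesis using True \<tau> by (auto simp: X_def)
    next
      case False
      \<comment> \<open>The fractional index at which the angle equals \<open>\<tau>\<close>; its
        integer part is the index of a node just right of \<open>y\<close>.\<close>
      define u where "u = N * \<tau> / pi - 1/2"
      have u0: "u \<ge> 0" using False N by (simp add: u_def field_simps)
      have "real N * \<tau> \<le> real N * pi" using \<tau> by (intro mult_left_mono) auto
      then have "N * \<tau> / pi \<le> N" by (simp add: divide_le_eq)
      then have uN: "u < N" unfolding u_def by linarith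
      define j where "j = nat \<lfloor>u\<rfloor>"
      have jr: "real j = of_int \<lfloor>u\<rfloor>" using u0 by (simp add: j_def)
      have ju: "real j \<le> u" "u < real j + 1" using of_int_floor_le[of u] floor_correct[of u] jr by linarith+
      have j: "j < N" using ju uN by linarith
      have \<tau>u: "\<tau> = (2 * u + 1) * pi / (2 * N)" using N by (simp add: u_def field_simps)
      have le: "\<phi> j \<le> \<tau>" unfolding \<tau>u \<phi>_def using ju by (intro divide_right_mono mult_right_mono) auto
      have "\<tau> - \<phi> j = (u - real j) * pi / N" unfolding \<tau>u \<phi>_def using N by (simp add: field_simps)
      also have "\<dots> \<le> 1 * pi / N" using ju by (intro divide_right_mono mult_right_mono) auto
      finally have d: "\<tau> - \<phi> j \<le> pi / N" by simp
      have "cos \<tau> \<le> cos (\<phi> j)" using le \<phi>0[of j] \<tau> by (intro cos_monotone_0_pi_le) auto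
      moreover have "\<bar>cos (\<phi> j) - cos \<tau>\<bar> \<le> \<bar>\<phi> j - \<tau>\<bar>" by (rule abs_cos_diff_le)
      ultimately show ?thesis using d le j \<tau> by (intro disjI2 bexI[of _ "cos (\<phi> j)"]) (auto simp: X_def)
    qed
  qed
  show thesis using that[OF fin card gap] main by blast
qed

lemma lagr_poly:
  assumes "finite X" "b \<in> X"
  obtains L where "degree L \<le> card X - 1" "\<And>x. poly L x = lagr X b x"
proof
  let ?L = "smult (1 / (\<Prod>w\<in>X - {b}. b - w)) (\<Prod>w\<in>X - {b}. [:- w, 1:])"
  have "degree (\<Prod>w\<in>X - {b}. [:- w, 1:]) \<le> (\<Sum>w\<in>X - {b}. degree [:- w, 1:])"
    using degree_prod_sum_le[of "X - {b}" "\<lambda>w. [:- w, 1:]"] assms by (simp add: o_def)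
  also have "\<dots> = card X - 1" using assms by simp
  finally show "degree ?L \<le> card X - 1" using degree_smult_le order_trans by blast
  show "poly ?L x = lagr X b x" for x
    by (simp add: lagr_def poly_prod prod_dividef)
qed

text \<open>
  The Chebyshev interpolant of a step decays only like \<open>1/(m |x - y|)\<close> away from the jump, which is
  not summable; composing it with \<open>3t\<^sup>2 - 2t\<^sup>3\<close>, which fixes 0 and 1 to second order, squares the error.
\<close>

lemma step_poly_approx:
  "\<exists>C>0. \<forall>m\<ge>1. \<forall>y\<in>{-1..1::real}. \<exists>q. degree q \<le> m \<and>
     (\<forall>x\<in>{-1..1}. \<bar>of_bool (y \<le> x) - poly q x\<bar> \<le> C / (1 + (real m * (x - y))\<^sup>2))"
proof -
  \<comment> \<open>The first summand covers points within \<open>2 * pi / N\<close> of the jump,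
    where \<open>m * d \<le> 6 * pi\<close>. Farther away the error is at most
    \<open>6 / (m * d)\<close>, which adds the \<open>36\<close>.\<close>
  define K where "K = pi\<^sup>2 * (1 + 36 * pi\<^sup>2) + 36"
  define C where "C = (3 + 2 * pi) * K"
  have K0: "K > 0" by (simp add: K_def add_pos_pos)
  show ?thesis
  proof (intro exI[of _ C] conjI allI impI ballI)
    show "C > 0" using K0 by (simp add: C_def add_pos_pos)
  next
    fix m :: nat and y :: real assume m: "m \<ge> 1" and y: "y \<in> {-1..1}"
    \<comment> \<open>The interpolant has degree at most \<open>N - 1\<close>, so that the cubic in
      it stays within degree \<open>m\<close>, while \<open>N\<close> remains of order
      \<open>m\<close>.\<close>
    define N where "N = m div 3 + 1"
    have N: "N \<ge> 1" "3 * (N - 1) \<le> m" "m \<le> 3 * N" by (auto simp: N_def)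
    obtain X :: "real set" where X: "finite X" "card X = N"
      and gap': "\<And>y. y \<in> {-1..1} \<Longrightarrow> (\<forall>w\<in>X. w < y) \<and> 1 \<le> y + pi / N \<or> (\<exists>w\<in>X. y \<le> w \<and> w \<le> y + pi / N)"
      and l1: "\<And>b x. b \<in> X \<Longrightarrow> x \<in> {-1..1} \<Longrightarrow> \<bar>lagr X b x\<bar> \<le> pi"
      and l2: "\<And>b x. b \<in> X \<Longrightarrow> x \<in> {-1..1} \<Longrightarrow> \<bar>lagr X b x\<bar> * (real N * \<bar>x - b\<bar>) \<le> 1"
      by (rule chebyshev_nodes[OF N(1)]) (rule that, assumption+)
    note gap = gap'[OF y]
    have "\<forall>b\<in>X. \<exists>L. degree L \<le> card X - 1 \<and> (\<forall>x. poly L x = lagr X b x)" using lagr_poly[OF X(1)] by metis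
    then obtain L where L: "\<And>b. b \<in> X \<Longrightarrow> degree (L b) \<le> N - 1" "\<And>b x. b \<in> X \<Longrightarrow> poly (L b) x = lagr X b x"
      using X(2) by metis
    define q0 where "q0 = (\<Sum>b\<in>{b\<in>X. y \<le> b}. L b)"
    define q where "q = q0 * q0 * [:3:] - q0 * q0 * q0 * [:2:]"
    have d0: "degree q0 \<le> N - 1" unfolding q0_def using L(1) X(1) by (intro degree_sum_le) auto
    have "degree (q0 * q0) \<le> 2 * (N - 1)" using degree_mult_le[of q0 q0] d0 by simp
    moreover have "degree (q0 * q0 * q0) \<le> 3 * (N - 1)"
      using degree_mult_le[of "q0 * q0" q0] calculation d0 by simp
    ultimately have "degree q \<le> 3 * (N - 1)"
      unfolding q_def using degree_mult_le[of "q0 * q0" "[:3:]"] degree_mult_le[of "q0 * q0 * q0" "[:2:]"]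
      by (intro degree_diff_le) auto
    then have dq: "degree q \<le> m" using N by simp
    have "\<bar>of_bool (y \<le> x) - poly q x\<bar> \<le> C / (1 + (real m * (x - y))\<^sup>2)" if x: "x \<in> {-1..1}" for x
    proof -
      define e where "e = of_bool (y \<le> x) - (\<Sum>b\<in>{b\<in>X. y \<le> b}. lagr X b x)"
      have q0x: "poly q0 x = of_bool (y \<le> x) - e" unfolding q0_def e_def using L(2) by (simp add: poly_sum)
      define d where "d = \<bar>x - y\<bar>"
      have md: "m * d \<le> 3 * (N * d)" using N(3) by (simp add: d_def mult_right_mono flip: mult.assoc)
      have small: "1 + (m * d)\<^sup>2 \<le> 1 + 36 * pi\<^sup>2" if "d \<le> 2 * pi / N"
      proof -
        have "N * d \<le> N * (2 * pi / N)" using that by (intro mult_left_mono) auto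
        then have "m * d \<le> 6 * pi" using md N by simp
        then have "(m * d)\<^sup>2 \<le> (6 * pi)\<^sup>2" by (intro power_mono) (auto simp: d_def)
        then show ?thesis by (simp add: power_mult_distrib)
      qed
      have pi1: "pi\<^sup>2 \<ge> 1" using pi_gt3 by (simp add: one_le_power)
      have e: "\<bar>e\<bar> \<le> pi \<and> e\<^sup>2 * (1 + (m * d)\<^sup>2) \<le> K"
        using step_interpolation_error[OF X(1), of y x, folded e_def]
      proof (elim disjE)
        assume "e = 0"
        then show ?thesis using K0 pi_gt_zero by simp
      next
        assume a: "y \<le> x \<and> (\<forall>w\<in>X. y \<le> w \<longrightarrow> x \<le> w) \<and> \<bar>e\<bar> \<le> 1"
        then have "x \<le> y + pi / N" using gap x by force
        moreover have "pi / N \<le> 2 * pi / N" by (intro divide_right_mono) auto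
        ultimately have "1 + (m * d)\<^sup>2 \<le> 1 + 36 * pi\<^sup>2" using a by (intro small) (auto simp: d_def)
        moreover have "e\<^sup>2 \<le> 1" using a by (simp add: abs_square_le_1)
        ultimately have "e\<^sup>2 * (1 + (m * d)\<^sup>2) \<le> pi\<^sup>2 * (1 + 36 * pi\<^sup>2)" using pi1 by (intro mult_mono) auto
        then show ?thesis using a pi_gt3 by (auto simp: K_def)
      next
        assume "\<exists>b\<in>X. y \<le> b \<and> (\<forall>w\<in>X. y \<le> w \<longrightarrow> b \<le> w) \<and> \<bar>e\<bar> \<le> \<bar>lagr X b x\<bar>"
        then obtain b where b: "b \<in> X" "y \<le> b" "\<And>w. w \<in> X \<Longrightarrow> y \<le> w \<Longrightarrow> b \<le> w" "\<bar>e\<bar> \<le> \<bar>lagr X b x\<bar>" by blast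
        have bup: "b \<le> y + pi / N" using gap b by force
        have epi: "\<bar>e\<bar> \<le> pi" using b(4) l1[OF b(1) x] by linarith
        then have "\<bar>e\<bar>\<^sup>2 \<le> pi\<^sup>2" by (intro power_mono) auto
        then have e2: "e\<^sup>2 \<le> pi\<^sup>2" by simp
        have "e\<^sup>2 * (1 + (m * d)\<^sup>2) \<le> K"
        proof (cases "d \<le> 2 * pi / N")
          case True
          have "e\<^sup>2 * (1 + (m * d)\<^sup>2) \<le> pi\<^sup>2 * (1 + 36 * pi\<^sup>2)" using e2 small[OF True] by (intro mult_mono) auto
          then show ?thesis by (simp add: K_def)
        next
          case False
          \<comment> \<open>The deciding node is within \<open>pi / N\<close> of the jump, so
            outside twice this distance it may replace the jump up to a factor 2.\<close>
          have "d / 2 \<le> \<bar>x - b\<bar>" using False bup b(2) by (auto simp: d_def abs_if split: if_splits)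
          then have "\<bar>e\<bar> * (N * (d / 2)) \<le> \<bar>lagr X b x\<bar> * (real N * \<bar>x - b\<bar>)"
            using b(4) by (intro mult_mono mult_left_mono) (auto simp: d_def)
          then have "\<bar>e\<bar> * (N * d) \<le> 2" using l2[OF b(1) x] by simp
          moreover have "\<bar>e\<bar> * (m * d) \<le> \<bar>e\<bar> * (3 * (N * d))" using md by (intro mult_left_mono) auto
          ultimately have "\<bar>e\<bar> * (m * d) \<le> 6" by linarith
          then have "(\<bar>e\<bar> * (m * d))\<^sup>2 \<le> 6\<^sup>2" by (intro power_mono) (auto simp: d_def)
          then have "e\<^sup>2 * (m * d)\<^sup>2 \<le> 36" by (simp add: power_mult_distrib)
          moreover have "pi\<^sup>2 * 1 \<le> pi\<^sup>2 * (1 + 36 * pi\<^sup>2)" by (intro mult_left_mono) auto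
          moreover have "e\<^sup>2 * (1 + (m * d)\<^sup>2) = e\<^sup>2 + e\<^sup>2 * (m * d)\<^sup>2" by (simp add: distrib_left)
          ultimately show ?thesis using e2 unfolding K_def by linarith
        qed
        then show ?thesis using epi by simp
      qed
      have dd: "(m * d)\<^sup>2 = (real m * (x - y))\<^sup>2" by (simp add: d_def power_mult_distrib)
      \<comment> \<open>After composition with the cubic an error \<open>e\<close> becomes
        \<open>3 * e\<^sup>2 - 2 * e ^ 3\<close> right of the jump and the negative of
        \<open>3 * e\<^sup>2 + 2 * e ^ 3\<close> left of it; since \<open>e\<close> is bounded by
        pi, both are of order \<open>e\<^sup>2\<close>.\<close>
      have e3: "\<bar>3 * e\<^sup>2 + s * (2 * e ^ 3)\<bar> \<le> (3 + 2 * pi) * e\<^sup>2" if "\<bar>s\<bar> = 1" for s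
      proof -
        have "\<bar>3 * e\<^sup>2 + s * (2 * e ^ 3)\<bar> \<le> \<bar>3 * e\<^sup>2\<bar> + \<bar>s * (2 * e ^ 3)\<bar>" by (rule abs_triangle_ineq)
        also have "\<dots> = 3 * e\<^sup>2 + 2 * (\<bar>e\<bar> * e\<^sup>2)" using that by
          (simp add: abs_mult power3_eq_cube power2_eq_square)
        also have "\<dots> \<le> 3 * e\<^sup>2 + 2 * (pi * e\<^sup>2)" using e
          by (intro add_left_mono mult_left_mono mult_right_mono) auto
        finally show ?thesis by (simp add: algebra_simps)
      qed
      have "\<bar>of_bool (y \<le> x) - poly q x\<bar> \<le> (3 + 2 * pi) * e\<^sup>2"
      proof (cases "y \<le> x")
        case True
        then have "of_bool (y \<le> x) - poly q x = 3 * e\<^sup>2 + (- 1) * (2 * e ^ 3)"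
          by (simp add: q_def q0x power2_eq_square power3_eq_cube algebra_simps)
        then show ?thesis using e3[of "- 1"] by simp
      next
        case False
        then have "of_bool (y \<le> x) - poly q x = - (3 * e\<^sup>2 + 1 * (2 * e ^ 3))"
          by (simp add: q_def q0x power2_eq_square power3_eq_cube algebra_simps)
        then show ?thesis using e3[of 1] by simp
      qed
      also have "\<dots> \<le> (3 + 2 * pi) * (K / (1 + (m * d)\<^sup>2))"
        using e by (intro mult_left_mono) (auto simp: le_divide_eq add_pos_nonneg)
      finally show ?thesis by (simp add: C_def dd)
    qed
    then show "\<exists>q. degree q \<le> m \<and> (\<forall>x\<in>{-1..1}. \<bar>of_bool (y \<le> x) - poly q x\<bar> \<le> C / (1 + (real m * (x - y))\<^sup>2))"
      using dq by blast
  qed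
qed

section \<open>Peano kernels\<close>

lemma bounded_integrable_imp_absolutely_integrable:
  fixes k :: "real \<Rightarrow> real"
  assumes "k integrable_on {a..b}" "\<And>x. x \<in> {a..b} \<Longrightarrow> \<bar>k x\<bar> \<le> M"
  shows "k absolutely_integrable_on {a..b}"
  by (rule absolutely_integrable_integrable_bound[of _ _ "\<lambda>_. M"]) (use assms in auto)

text \<open>Boundedness makes \<open>k\<close> absolutely integrable. For a merely Henstock-Kurzweil
  integrable function the product with a continuous one need not be integrable.\<close>

lemma integrable_continuous_mult:
  fixes k h :: "real \<Rightarrow> real"
  assumes "k integrable_on {a..b}" "\<And>x. x \<in> {a..b} \<Longrightarrow> \<bar>k x\<bar> \<le> M" and h: "continuous_on {a..b} h"
  shows "(\<lambda>x. h x * k x) integrable_on {a..b}"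
proof -
  have "bounded (h ` {a..b})" using compact_continuous_image[OF h] compact_imp_bounded by blast
  moreover have "h \<in> borel_measurable (lebesgue_on {a..b})"
    using h by (intro continuous_imp_measurable_on_sets_lebesgue) auto
  ultimately have "(\<lambda>x. h x * k x) absolutely_integrable_on {a..b}"
    using bounded_integrable_imp_absolutely_integrable[OF assms(1,2)]
    by (intro absolutely_integrable_bounded_measurable_product_real) auto
  then show ?thesis using absolutely_integrable_on_def by blast
qed

lemma integrable_step_mult:
  fixes k :: "real \<Rightarrow> real"
  assumes k: "k integrable_on {a..b}" and y: "y \<in> {a..b}"
  shows "((\<lambda>x. of_bool (y \<le> x) * k x) has_integral integral {y..b} k) {a..b}"
proof -
  have "k integrable_on {y..b}" by (rule integrable_on_subinterval[OF k]) (use y in auto)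
  then have "(k has_integral integral {y..b} k) {y..b}" by (rule integrable_integral)
  then have "((\<lambda>x. if x \<in> {y..b} then k x else 0) has_integral integral {y..b} k) {a..b}"
    using y by (subst has_integral_restrict) auto
  then show ?thesis by (rule has_integral_eq[rotated]) auto
qed

text \<open>
  Here \<open>K(y)\<close> and \<open>G(y)\<close> are indefinite integrals of functions that need not be continuous, so the
  product rule is not available; instead the difference of both sides is \<open>O(h\<^sup>2)\<close> over steps of length \<open>h\<close>.
\<close>

lemma integral_by_parts_bounded:
  fixes k g K G :: "real \<Rightarrow> real"
  assumes ab: "a \<le> b"
    and k: "k integrable_on {a..b}" "\<And>x. x \<in> {a..b} \<Longrightarrow> \<bar>k x\<bar> \<le> M"
    and g: "g integrable_on {a..b}" "\<And>x. x \<in> {a..b} \<Longrightarrow> \<bar>g x\<bar> \<le> B"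
    and K: "\<And>s t. a \<le> s \<Longrightarrow> s \<le> t \<Longrightarrow> t \<le> b \<Longrightarrow> K t - K s = integral {s..t} k"
    and G: "\<And>s t. a \<le> s \<Longrightarrow> s \<le> t \<Longrightarrow> t \<le> b \<Longrightarrow> G t - G s = integral {s..t} g"
  shows "integral {a..b} (\<lambda>x. K x * g x) + integral {a..b} (\<lambda>x. G x * k x) = K b * G b - K a * G a"
    "(\<lambda>x. K x * g x) integrable_on {a..b}" "(\<lambda>x. G x * k x) integrable_on {a..b}"
proof -
  have M0: "M \<ge> 0" and B0: "B \<ge> 0" using k(2)[of a] g(2)[of a] ab by fastforce+
  have lipK: "\<bar>K t - K s\<bar> \<le> M * (t - s)" if "a \<le> s" "s \<le> t" "t \<le> b" for s t
  proof -
    have "k integrable_on {s..t}" using k(1) by (rule integrable_on_subinterval) (use that in auto)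
    then have "norm (integral {s..t} k) \<le> integral {s..t} (\<lambda>_. M)"
      by (rule integral_norm_bound_integral) (use k(2) that in auto)
    then show ?thesis using K[OF that] that by (simp add: mult.commute)
  qed
  have lipG: "\<bar>G t - G s\<bar> \<le> B * (t - s)" if "a \<le> s" "s \<le> t" "t \<le> b" for s t
  proof -
    have "g integrable_on {s..t}" using g(1) by (rule integrable_on_subinterval) (use that in auto)
    then have "norm (integral {s..t} g) \<le> integral {s..t} (\<lambda>_. B)"
      by (rule integral_norm_bound_integral) (use g(2) that in auto)
    then show ?thesis using G[OF that] that by (simp add: mult.commute)
  qed
  have contK: "continuous_on {a..b} K"
  proof (rule continuous_on_eq)
    show "continuous_on {a..b} (\<lambda>t. K a + integral {a..t} k)"
      by (intro continuous_intros indefinite_integral_continuous_1 k)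
    show "K a + integral {a..t} k = K t" if "t \<in> {a..b}" for t using K[of a t] that by auto
  qed
  have contG: "continuous_on {a..b} G"
  proof (rule continuous_on_eq)
    show "continuous_on {a..b} (\<lambda>t. G a + integral {a..t} g)"
      by (intro continuous_intros indefinite_integral_continuous_1 g)
    show "G a + integral {a..t} g = G t" if "t \<in> {a..b}" for t using G[of a t] that by auto
  qed
  show iKg: "(\<lambda>x. K x * g x) integrable_on {a..b}" by (rule integrable_continuous_mult[OF g contK])
  show iGk: "(\<lambda>x. G x * k x) integrable_on {a..b}" by (rule integrable_continuous_mult[OF k contG])
  define \<Phi> where "\<Phi> t = K t * G t - (integral {a..t} (\<lambda>x. K x * g x) + integral {a..t} (\<lambda>x. G x * k x))" for t
  have step: "\<bar>\<Phi> t - \<Phi> s\<bar> \<le> 2 * M * B * (t - s)\<^sup>2" if st: "a \<le> s" "s \<le> t" "t \<le> b" for s t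
  proof -
    have sub: "{s..t} \<subseteq> {a..b}" using st by auto
    note i = integrable_on_subinterval[OF _ sub]
    have ii: "(\<lambda>x. K x * g x) integrable_on {s..t}" "(\<lambda>x. G x * k x) integrable_on {s..t}"
      "k integrable_on {s..t}" "g integrable_on {s..t}"
      using i[OF iKg] i[OF iGk] i[OF k(1)] i[OF g(1)] by auto
    have c1: "integral {a..t} (\<lambda>x. K x * g x) = integral {a..s} (\<lambda>x. K x * g x)
      + integral {s..t} (\<lambda>x. K x * g x)"
      by (rule Henstock_Kurzweil_Integration.integral_combine[symmetric]) (use st in \<open>auto
        intro: integrable_on_subinterval[OF iKg]\<close>)
    have c2: "integral {a..t} (\<lambda>x. G x * k x) = integral {a..s} (\<lambda>x. G x * k x)
      + integral {s..t} (\<lambda>x. G x * k x)"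
      by (rule Henstock_Kurzweil_Integration.integral_combine[symmetric]) (use st in \<open>auto
        intro: integrable_on_subinterval[OF iGk]\<close>)
    \<comment> \<open>With one factor frozen at an end of the step the two integrals reproduce the
      increment of the product exactly. Unfreezing changes each integrand by at most
      \<open>M * B\<close> times the step length.\<close>
    have "K t * G t - K s * G s = K t * (G t - G s) + G s * (K t - K s)" by (simp add: algebra_simps)
    also have "\<dots> = integral {s..t} (\<lambda>x. K t * g x) + integral {s..t} (\<lambda>x. G s * k x)"
      using K[OF st] G[OF st] by simp
    finally have "\<Phi> t - \<Phi> s = (integral {s..t} (\<lambda>x. K t * g x) - integral {s..t} (\<lambda>x. K x * g x))
        + (integral {s..t} (\<lambda>x. G s * k x) - integral {s..t} (\<lambda>x. G x * k x))"
      unfolding \<Phi>_def c1 c2 by simp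
    also have "\<dots> = integral {s..t} (\<lambda>x. K t * g x - K x * g x) + integral {s..t} (\<lambda>x. G s * k x - G x * k x)"
      using ii by (simp add: integral_diff integrable_on_mult_right)
    finally have eq: "\<Phi> t - \<Phi> s = integral {s..t} (\<lambda>x. K t * g x - K x * g x)
      + integral {s..t} (\<lambda>x. G s * k x - G x * k x)" .
    have "norm (integral {s..t} (\<lambda>x. K t * g x - K x * g x)) \<le> integral {s..t} (\<lambda>_. M * (t - s) * B)"
    proof (rule integral_norm_bound_integral)
      show "norm (K t * g x - K x * g x) \<le> M * (t - s) * B" if x: "x \<in> {s..t}" for x
      proof -
        have "\<bar>K t - K x\<bar> \<le> M * (t - x)" using lipK[of x t] x st by auto
        also have "\<dots> \<le> M * (t - s)" using x M0 by (intro mult_left_mono) auto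
        finally have "\<bar>K t - K x\<bar> * \<bar>g x\<bar> \<le> M * (t - s) * B" using g(2)[of x] x st M0
          by (intro mult_mono) auto
        then show ?thesis by (simp add: abs_mult[symmetric] left_diff_distrib)
      qed
    qed (use ii in \<open>auto intro!: integrable_diff integrable_on_mult_right\<close>)
    moreover have "norm (integral {s..t} (\<lambda>x. G s * k x - G x * k x)) \<le> integral {s..t} (\<lambda>_. B * (t - s) * M)"
    proof (rule integral_norm_bound_integral)
      show "norm (G s * k x - G x * k x) \<le> B * (t - s) * M" if x: "x \<in> {s..t}" for x
      proof -
        have "\<bar>G s - G x\<bar> \<le> B * (x - s)" using lipG[of s x] x st by (auto simp: abs_minus_commute)
        also have "\<dots> \<le> B * (t - s)" using x B0 by (intro mult_left_mono) auto
        finally have "\<bar>G s - G x\<bar> * \<bar>k x\<bar> \<le> B * (t - s) * M" using k(2)[of x] x st B0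
          by (intro mult_mono) auto
        then show ?thesis by (simp add: abs_mult[symmetric] left_diff_distrib)
      qed
    qed (use ii in \<open>auto intro!: integrable_diff integrable_on_mult_right\<close>)
    ultimately have "\<bar>\<Phi> t - \<Phi> s\<bar> \<le> (t - s) * (M * (t - s) * B) + (t - s) * (B * (t - s) * M)"
      unfolding eq using st by (intro order_trans[OF abs_triangle_ineq] add_mono) (simp_all add: mult_ac)
    then show ?thesis by (simp add: power2_eq_square algebra_simps)
  qed
  have "(\<Phi> has_real_derivative 0) (at x within {a..b})" if x: "x \<in> {a..b}" for x
  proof -
    have bd: "\<bar>(\<Phi> y - \<Phi> x) / (y - x)\<bar> \<le> 2 * M * B * \<bar>y - x\<bar>" if y: "y \<in> {a..b}" "y \<noteq> x" for y
    proof -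
      have "\<bar>\<Phi> y - \<Phi> x\<bar> \<le> 2 * M * B * (y - x)\<^sup>2"
        using step[of x y] step[of y x] x y by (cases "x \<le> y") (auto simp: abs_minus_commute power2_commute)
      also have "\<dots> = 2 * M * B * \<bar>y - x\<bar> * \<bar>y - x\<bar>" by (simp add: power2_eq_square)
      finally show ?thesis using y by (simp add: divide_le_eq)
    qed
    have "((\<lambda>y. (\<Phi> y - \<Phi> x) / (y - x)) \<longlongrightarrow> 0) (at x within {a..b})"
    proof (rule Lim_null_comparison)
      show "\<forall>\<^sub>F y in at x within {a..b}. norm ((\<Phi> y - \<Phi> x) / (y - x)) \<le> 2 * M * B * \<bar>y - x\<bar>"
        unfolding eventually_at_filter using bd by (intro always_eventually) auto
      have "((\<lambda>y. 2 * M * B * \<bar>y - x\<bar>) \<longlongrightarrow> 2 * M * B * \<bar>x - x\<bar>) (at x within {a..b})"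
        by (intro tendsto_intros)
      then show "((\<lambda>y. 2 * M * B * \<bar>y - x\<bar>) \<longlongrightarrow> 0) (at x within {a..b})" by simp
    qed
    then show ?thesis by (simp add: has_field_derivative_iff)
  qed
  then have "\<exists>c. \<forall>x\<in>{a..b}. \<Phi> x = c"
    by (intro has_field_derivative_zero_constant) auto
  then have "\<Phi> a = \<Phi> b" using ab by auto
  then show "integral {a..b} (\<lambda>x. K x * g x) + integral {a..b} (\<lambda>x. G x * k x) = K b * G b - K a * G a"
    by (simp add: \<Phi>_def)
qed

lemma integrable_step_mult_left:
  fixes k :: "real \<Rightarrow> real"
  assumes k: "k integrable_on {a..b}" and y: "y \<in> {a..b}"
  shows "((\<lambda>x. of_bool (x \<le> y) * k x) has_integral integral {a..y} k) {a..b}"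
proof -
  have "k integrable_on {a..y}" by (rule integrable_on_subinterval[OF k]) (use y in auto)
  then have "(k has_integral integral {a..y} k) {a..y}" by (rule integrable_integral)
  then have "((\<lambda>x. if x \<in> {a..y} then k x else 0) has_integral integral {a..y} k) {a..b}"
    using y by (subst has_integral_restrict) auto
  then show ?thesis by (rule has_integral_eq[rotated]) auto
qed

section \<open>Tail integrals of kernels orthogonal to polynomials\<close>

definition orth_kernel :: "nat \<Rightarrow> real \<Rightarrow> (real \<Rightarrow> real) \<Rightarrow> bool" where
  "orth_kernel m M k \<longleftrightarrow> k integrable_on {-1..1} \<and> (\<forall>x\<in>{-1..1}. \<bar>k x\<bar> \<le> M) \<and>
     (\<forall>p. degree p \<le> m \<longrightarrow> integral {-1..1} (\<lambda>x. poly p x * k x) = 0)"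

definition tail_integral :: "(real \<Rightarrow> real) \<Rightarrow> real \<Rightarrow> real" where
  "tail_integral k y = integral {y..1} k"

lemma tail_integral_diff:
  fixes k :: "real \<Rightarrow> real"
  assumes "k integrable_on {-1..1}" "-1 \<le> s" "s \<le> t" "t \<le> 1"
  shows "- tail_integral k t - - tail_integral k s = integral {s..t} k"
proof -
  have "k integrable_on {s..1}" by (rule integrable_on_subinterval[OF assms(1)]) (use assms in auto)
  then have "integral {s..t} k + integral {t..1} k = integral {s..1} k"
    using assms by (intro Henstock_Kurzweil_Integration.integral_combine) auto
  then show ?thesis by (simp add: tail_integral_def)
qed

lemma poly_antiderivative_exists:
  fixes p :: "real poly"
  obtains P where "pderiv P = p" "degree P \<le> Suc (degree p)"
proof -
  define P where "P = pCons 0 (Poly (map (\<lambda>i. coeff p i / (real i + 1)) [0..<Suc (degree p)]))"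
  have "coeff (Poly (map (\<lambda>i. coeff p i / (real i + 1)) [0..<Suc (degree p)])) i = coeff p i / (real i
    + 1)" for i
    by (auto simp: nth_default_def coeff_eq_0 simp del: upt_Suc)
  then have c: "coeff P (Suc i) = coeff p i / (real i + 1)" for i by (simp add: P_def)
  have "pderiv P = p" by (rule poly_eqI) (simp add: coeff_pderiv c add.commute)
  moreover have "degree P \<le> Suc (degree p)"
  proof (rule degree_le, intro allI impI)
    fix i assume "Suc (degree p) < i"
    then obtain j where "i = Suc j" "degree p < j" by (cases i) auto
    then show "coeff P i = 0" by (simp add: c coeff_eq_0)
  qed
  ultimately show thesis by (rule that)
qed

lemma poly_diff_eq_integral:
  fixes P :: "real poly"
  assumes "s \<le> t"
  shows "poly P t - poly P s = integral {s..t} (poly (pderiv P))"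
proof -
  have "(poly (pderiv P) has_integral (poly P t - poly P s)) {s..t}"
    using assms by (intro fundamental_theorem_of_calculus)
      (auto simp: has_real_derivative_iff_has_vector_derivative[symmetric]
        intro!: DERIV_subset[OF poly_DERIV])
  then show ?thesis by (simp add: integral_unique)
qed

lemma poly_bounded_on:
  fixes p :: "real poly"
  obtains B where "\<And>x. x \<in> {-1..1} \<Longrightarrow> \<bar>poly p x\<bar> \<le> B"
proof -
  have "bounded (poly p ` {-1..1})" by (intro compact_imp_bounded compact_continuous_image) (auto
    intro!: continuous_intros)
  then obtain B where "\<forall>x\<in>{-1..1}. \<bar>poly p x\<bar> \<le> B" unfolding bounded_iff by auto
  then show thesis using that by blast
qed

text \<open>Both boundary terms vanish: the tail integral is an empty one at 1, and at -1 it is the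
  integral against the constant 1.\<close>

lemma tail_integral_by_parts:
  assumes k: "orth_kernel m M k" and g: "g integrable_on {-1..1}" "\<And>x. x \<in> {-1..1} \<Longrightarrow> \<bar>g x\<bar> \<le> B"
    and G: "\<And>s t. -1 \<le> s \<Longrightarrow> s \<le> t \<Longrightarrow> t \<le> 1 \<Longrightarrow> G t - G s = integral {s..t} g"
  shows "integral {-1..1} (\<lambda>x. g x * tail_integral k x) = integral {-1..1} (\<lambda>x. G x * k x)"
    "(\<lambda>x. g x * tail_integral k x) integrable_on {-1..1}"
proof -
  have ki: "k integrable_on {-1..1}" "\<And>x. x \<in> {-1..1} \<Longrightarrow> \<bar>k x\<bar> \<le> M" using k by (auto simp: orth_kernel_def)
  have t1: "tail_integral k 1 = 0" by (simp add: tail_integral_def)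
  have t2: "tail_integral k (-1) = 0"
    using k unfolding orth_kernel_def tail_integral_def by (auto dest!: spec[of _ "1::real poly"])
  note parts = integral_by_parts_bounded[of "-1" 1 k M g B "\<lambda>x. - tail_integral k x" G, OF _ ki g
    tail_integral_diff[OF ki(1)] G]
  have 1: "integral {-1..1} (\<lambda>x. - tail_integral k x * g x) + integral {-1..1} (\<lambda>x. G x * k x) = 0"
    using parts(1) t1 t2 by auto
  have 2: "(\<lambda>x. - tail_integral k x * g x) integrable_on {-1..1}" using parts(2) by auto
  have 3: "(\<lambda>x. - tail_integral k x * g x) = (\<lambda>x. - (g x * tail_integral k x))" by (auto simp: mult_ac)
  show "integral {-1..1} (\<lambda>x. g x * tail_integral k x) = integral {-1..1} (\<lambda>x. G x * k x)"
    "(\<lambda>x. g x * tail_integral k x) integrable_on {-1..1}"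
    using 1 2 unfolding 3 by (simp_all add: integrable_neg_iff)
qed

text \<open>The tail integral at \<open>y\<close> is the integral against a step function, from
  which a polynomial of degree \<open>m\<close> may be subtracted. The remaining bound
  \<open>C / (1 + (real m * (x - y))\<^sup>2)\<close> has an arctangent as antiderivative and
  integrates to at most \<open>C * pi / m\<close>.\<close>

lemma tail_integral_bound:
  "\<exists>C>0. \<forall>m\<ge>1. \<forall>M k. orth_kernel m M k \<longrightarrow> (\<forall>y\<in>{-1..1}. \<bar>tail_integral k y\<bar> \<le> C * M / real m)"
proof -
  obtain C where C: "C > 0" and approx: "\<forall>m\<ge>1. \<forall>y\<in>{-1..1::real}. \<exists>q. degree q \<le> m \<and>
     (\<forall>x\<in>{-1..1}. \<bar>of_bool (y \<le> x) - poly q x\<bar> \<le> C / (1 + (real m * (x - y))\<^sup>2))"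
    using step_poly_approx by blast
  show ?thesis
  proof (intro exI[of _ "C * pi"] conjI allI impI ballI)
    fix m :: nat and M :: real and k and y :: real
    assume m: "m \<ge> 1" and k: "orth_kernel m M k" and y: "y \<in> {-1..1}"
    have ki: "k integrable_on {-1..1}" "\<And>x. x \<in> {-1..1} \<Longrightarrow> \<bar>k x\<bar> \<le> M" using k by (auto simp: orth_kernel_def)
    have M0: "M \<ge> 0" using ki(2)[of 0] by simp
    obtain q where q: "degree q \<le> m" "\<And>x. x \<in> {-1..1} \<Longrightarrow> \<bar>of_bool (y \<le> x) - poly q x\<bar> \<le> C / (1
      + (real m * (x - y))\<^sup>2)"
      using approx m y by blast
    have qk: "(\<lambda>x. poly q x * k x) integrable_on {-1..1}"
      by (rule integrable_continuous_mult[OF ki]) (auto intro!: continuous_intros)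
    have "((\<lambda>x. poly q x * k x) has_integral 0) {-1..1}"
      using integrable_integral[OF qk] k q(1) by (simp add: orth_kernel_def)
    from has_integral_diff[OF integrable_step_mult[OF ki(1) y] this]
    have hi: "((\<lambda>x. (of_bool (y \<le> x) - poly q x) * k x) has_integral tail_integral k y) {-1..1}"
      by (simp add: left_diff_distrib tail_integral_def)
    define F where "F x = C * M / m * arctan (m * (x - y))" for x
    have F: "((\<lambda>x. C / (1 + (real m * (x - y))\<^sup>2) * M) has_integral (F 1 - F (-1))) {-1..1}"
    proof (rule fundamental_theorem_of_calculus)
      fix x :: real
      have "(F has_real_derivative C * M / m * (inverse (1 + (m * (x - y))\<^sup>2) * m)) (at x within {-1..1})"
        unfolding F_def by (intro DERIV_cmult DERIV_chain2[OF DERIV_arctan]) (auto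
          intro!: derivative_eq_intros)
      moreover have "C * M / m * (inverse (1 + (m * (x - y))\<^sup>2) * m) = C / (1 + (real m * (x - y))\<^sup>2) * M"
        using m by (simp add: divide_inverse)
      ultimately show "(F has_vector_derivative C / (1 + (real m * (x - y))\<^sup>2) * M) (at x within {-1..1})"
        by (simp only: has_real_derivative_iff_has_vector_derivative[symmetric])
    qed simp
    have "norm (integral {-1..1} (\<lambda>x. (of_bool (y \<le> x) - poly q x) * k x))
      \<le> integral {-1..1} (\<lambda>x. C / (1 + (real m * (x - y))\<^sup>2) * M)"
    proof (rule integral_norm_bound_integral)
      show "norm ((of_bool (y \<le> x) - poly q x) * k x) \<le> C / (1 + (real m * (x - y))\<^sup>2) * M" if "x
        \<in> {-1..1}" for x
        using q(2)[OF that] ki(2)[OF that] C unfolding real_norm_def abs_mult by (intro mult_mono) (auto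
          intro!: divide_nonneg_nonneg)
    qed (use hi F in blast)+
    then have "\<bar>tail_integral k y\<bar> \<le> F 1 - F (-1)" using hi F by (simp add: integral_unique)
    also have "F 1 - F (-1) = C * M / m * (arctan (m * (1 - y)) - arctan (m * (-1 - y)))" by
      (simp add: F_def right_diff_distrib)
    also have "\<dots> \<le> C * M / m * pi"
    proof (rule mult_left_mono)
      show "arctan (m * (1 - y)) - arctan (m * (-1 - y)) \<le> pi"
        using arctan_ubound[of "m * (1 - y)"] arctan_lbound[of "m * (-1 - y)"] by linarith
    qed (use C M0 in simp)
    finally show "\<bar>tail_integral k y\<bar> \<le> C * pi * M / real m" by (simp add: mult_ac)
  qed (use C in simp)
qed

text \<open>Integration by parts replaces \<open>p\<close> by an antiderivative, whose degree is one
  higher; this is the degree that is lost.\<close>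

lemma orth_kernel_tail_integral:
  assumes k: "orth_kernel (Suc m) M k" and bound: "\<And>y. y \<in> {-1..1} \<Longrightarrow> \<bar>tail_integral k y\<bar> \<le> M'"
  shows "orth_kernel m M' (tail_integral k)"
  unfolding orth_kernel_def
proof (intro conjI ballI allI impI)
  have ki: "k integrable_on {-1..1}" using k by (simp add: orth_kernel_def)
  have "continuous_on {-1..1} (\<lambda>x. integral {x..1} k)" by (rule indefinite_integral_continuous_1'[OF ki])
  then show "tail_integral k integrable_on {-1..1}"
    unfolding tail_integral_def[abs_def] by (rule integrable_continuous_real)
next
  fix p :: "real poly" assume p: "degree p \<le> m"
  obtain P where P: "pderiv P = p" "degree P \<le> Suc (degree p)" by (rule poly_antiderivative_exists)
  obtain B where B: "\<And>x. x \<in> {-1..1} \<Longrightarrow> \<bar>poly p x\<bar> \<le> B" using poly_bounded_on by blast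
  have "poly p integrable_on {-1..1}" by (intro integrable_continuous_real continuous_intros)
  from tail_integral_by_parts(1)[OF k this B, of "poly P"]
  have "integral {-1..1} (\<lambda>x. poly p x * tail_integral k x) = integral {-1..1} (\<lambda>x. poly P x * k x)"
    using poly_diff_eq_integral[of _ _ P] P(1) by simp
  then show "integral {-1..1} (\<lambda>x. poly p x * tail_integral k x) = 0"
    using k P(2) p by (simp add: orth_kernel_def)
qed (rule bound)

lemma orth_kernel_mono: "orth_kernel m M k \<Longrightarrow> M \<le> M' \<Longrightarrow> orth_kernel m M' k"
  unfolding orth_kernel_def by force

lemma iterated_tail_integral:
  fixes r :: nat
  shows "\<exists>C>0. \<forall>n\<ge>r+1. \<forall>M k. orth_kernel (n - 1) M k \<longrightarrow>
    (\<forall>s\<le>r. orth_kernel (n - 1 - s) (M * (C / real n) ^ s) ((tail_integral ^^ s) k))"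
proof -
  obtain C where C: "C > 0" and b: "\<And>m M k y. m \<ge> 1 \<Longrightarrow> orth_kernel m M k \<Longrightarrow> y \<in> {-1..1}
    \<Longrightarrow> \<bar>tail_integral k y\<bar> \<le> C * M / real m"
    using tail_integral_bound by metis
  \<comment> \<open>The successive denominators are \<open>n - 1 - s\<close> with
    \<open>s < r\<close>. As \<open>n \<ge> r + 1\<close>, each of them is at least
    \<open>n / (r + 1)\<close>.\<close>
  define C1 where "C1 = C * (real r + 1)"
  have C1: "C1 > 0" using C by (simp add: C1_def)
  have "orth_kernel (n - 1 - s) (M * (C1 / real n) ^ s) ((tail_integral ^^ s) k)"
    if n: "n \<ge> r + 1" and k: "orth_kernel (n - 1) M k" and s: "s \<le> r" for n M k s
    using s
  proof (induction s)
    case (Suc s)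
    let ?M = "M * (C1 / real n) ^ s"
    have IH: "orth_kernel (n - 1 - s) ?M ((tail_integral ^^ s) k)" using Suc by simp
    have M0: "?M \<ge> 0" using IH abs_ge_zero order_trans unfolding orth_kernel_def
      by (metis atLeastAtMost_iff le_numeral_extra(3) neg_le_0_iff_le order_refl zero_le_one)
    have m: "n - 1 - s = Suc (n - 1 - Suc s)" using Suc n by simp
    have "orth_kernel (n - 1 - Suc s) (C * ?M / real (n - 1 - s)) (tail_integral ((tail_integral ^^ s) k))"
      using IH m b[OF _ IH] by (intro orth_kernel_tail_integral[of _ ?M]) auto
    moreover have "C * ?M / real (n - 1 - s) \<le> M * (C1 / real n) ^ Suc s"
    proof -
      have "real n \<le> (real r + 1) * real (n - 1 - s)"
      proof -
        obtain j where j: "n = r + 1 + j" using n le_Suc_ex by blast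
        have "real (n - 1 - s) \<ge> 1 + real j" using Suc j by simp
        then have "(real r + 1) * (1 + real j) \<le> (real r + 1) * real (n - 1 - s)"
          by (intro mult_left_mono) auto
        moreover have "real n \<le> (real r + 1) * (1 + real j)" by (simp add: j algebra_simps)
        ultimately show ?thesis by linarith
      qed
      moreover have "real (n - 1 - s) > 0" "real n > 0" using m n by auto
      ultimately have "1 / real (n - 1 - s) \<le> (real r + 1) / real n" by (simp add: field_simps)
      then have "C * ?M * (1 / real (n - 1 - s)) \<le> C * ?M * ((real r + 1) / real n)"
        using M0 C by (intro mult_left_mono) auto
      then show ?thesis by (simp add: C1_def mult_ac)
    qed
    ultimately show ?case using orth_kernel_mono by simp
  qed (use k in simp)
  then show ?thesis using C1 by blast
qed

section \<open>Integrands of bounded variation and functionals annihilating polynomials\<close>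

lemma bounded_variation_decomposition:
  assumes "bounded_variation_on {a..b} g"
  obtains g1 g2 where "mono_on {a..b} g1" "mono_on {a..b} g2" "\<And>x. x \<in> {a..b} \<Longrightarrow> g x = g1 x - g2 x"
proof -
  define S where "S t = {(\<Sum>i<m. \<bar>g (x (Suc i)) - g (x i)\<bar>) | m x. (\<forall>i\<le>m. x i \<in> {a..t}) \<and> (\<forall>i<m. x i
    \<le> x (Suc i))}" for t
  define V where "V t = Sup (S t)" for t
  obtain B where B: "\<And>m x. (\<forall>i\<le>m. x i \<in> {a..b}) \<and> (\<forall>i<m. x i \<le> x (Suc i))
    \<Longrightarrow> (\<Sum>i<m. \<bar>g (x (Suc i)) - g (x i)\<bar>) \<le> B"
    using assms unfolding bounded_variation_on_def by blast
  have bdd: "bdd_above (S t)" if "t \<le> b" for t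
  proof (rule bdd_aboveI[of _ B])
    fix v assume "v \<in> S t"
    then obtain m x where v: "v = (\<Sum>i<m. \<bar>g (x (Suc i)) - g (x i)\<bar>)" "\<forall>i\<le>m. x i \<in> {a..t}" "\<forall>i<m. x i
      \<le> x (Suc i)"
      unfolding S_def by blast
    have "\<forall>i\<le>m. x i \<in> {a..b}" using v(2) that by force
    then show "v \<le> B" using B v by blast
  qed
  have key: "V s + \<bar>g t - g s\<bar> \<le> V t" if st: "a \<le> s" "s \<le> t" "t \<le> b" for s t
  proof -
    have "V s \<le> V t - \<bar>g t - g s\<bar>"
      unfolding V_def
    proof (rule cSup_least)
      have "(\<Sum>i<0. \<bar>g (a) - g (a)\<bar>) \<in> S s" unfolding S_def using st
        by (intro CollectI exI[of _ "0::nat"] exI[of _ "\<lambda>_. a"]) auto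
      then show "S s \<noteq> {}" by blast
    next
      fix v assume "v \<in> S s"
      then obtain m x where v: "v = (\<Sum>i<m. \<bar>g (x (Suc i)) - g (x i)\<bar>)" "\<forall>i\<le>m. x i \<in> {a..s}" "\<forall>i<m. x i
        \<le> x (Suc i)"
        unfolding S_def by blast
      \<comment> \<open>Jordan's decomposition uses the variation function \<open>V\<close>: a chain
        of points up to \<open>s\<close>, prolonged by \<open>s\<close> and \<open>t\<close>, shows
        that \<open>V\<close> grows by at least the increment of \<open>g\<close>.\<close>
      define x' where "x' i = (if i \<le> m then x i else if i = Suc m then s else t)" for i
      have "(\<Sum>i<Suc (Suc m). \<bar>g (x' (Suc i)) - g (x' i)\<bar>) \<in> S t"
        unfolding S_def
      proof (intro CollectI exI[of _ "Suc (Suc m)"] exI[of _ x'] conjI refl allI impI)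
        fix i assume "i \<le> Suc (Suc m)"
        then show "x' i \<in> {a..t}" using v(2) st by (force simp: x'_def)
      next
        fix i assume "i < Suc (Suc m)"
        then consider "i < m" | "i = m" | "i = Suc m" by linarith
        then show "x' i \<le> x' (Suc i)" using v(2,3) st by cases (auto simp: x'_def)
      qed
      then have "(\<Sum>i<Suc (Suc m). \<bar>g (x' (Suc i)) - g (x' i)\<bar>) \<le> Sup (S t)"
        by (rule cSup_upper) (use bdd st in auto)
      moreover have "(\<Sum>i<m. \<bar>g (x' (Suc i)) - g (x' i)\<bar>) = v" unfolding v(1) by (intro sum.cong) (auto
        simp: x'_def)
      ultimately show "v \<le> Sup (S t) - \<bar>g t - g s\<bar>" by (simp add: x'_def)
    qed
    then show ?thesis by simp
  qed
  show thesis
  proof (rule that[of V "\<lambda>x. V x - g x"])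
    show "mono_on {a..b} V"
    proof (rule mono_onI)
      fix s t assume "s \<in> {a..b}" "t \<in> {a..b}" "s \<le> t"
      then show "V s \<le> V t" using key[of s t] abs_ge_zero[of "g t - g s"] by simp
    qed
    show "mono_on {a..b} (\<lambda>x. V x - g x)"
    proof (rule mono_onI)
      fix s t assume "s \<in> {a..b}" "t \<in> {a..b}" "s \<le> t"
      then show "V s - g s \<le> V t - g t" using key[of s t] by (simp add: abs_if split: if_splits)
    qed
  qed simp
qed

text \<open>In the second mean value theorem the two partial integrals of \<open>k\<close> are
  opposite, because the total vanishes, and so both are tail integrals up to sign. A monotone factor
  thus gains one tail integration without being differentiated.\<close>

lemma mono_mult_orth_kernel:
  assumes g: "mono_on {-1..1} g" and k: "orth_kernel m M k" and tb: "\<And>y. y \<in> {-1..1}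
    \<Longrightarrow> \<bar>tail_integral k y\<bar> \<le> T"
  shows "(\<lambda>x. g x * k x) integrable_on {-1..1}"
    "\<bar>integral {-1..1} (\<lambda>x. g x * k x)\<bar> \<le> (\<bar>g (-1)\<bar> + \<bar>g 1\<bar>) * T"
proof -
  have ki: "k integrable_on {-1..1}" using k by (simp add: orth_kernel_def)
  have gm: "\<And>x y. -1 \<le> x \<Longrightarrow> x \<le> y \<Longrightarrow> y \<le> 1 \<Longrightarrow> g x \<le> g y" using g by (auto simp: mono_on_def)
  have "\<exists>c\<in>{-1..1}. ((\<lambda>x. g x * k x) has_integral (g (-1) * integral {-1..c} k
    + g 1 * integral {c..1} k)) {-1..1}"
    by (rule second_mean_value_theorem_full[OF ki _ gm]) auto
  then obtain c where c: "c \<in> {-1..1}"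
    and hi: "((\<lambda>x. g x * k x) has_integral (g (-1) * integral {-1..c} k
      + g 1 * integral {c..1} k)) {-1..1}" by blast
  show "(\<lambda>x. g x * k x) integrable_on {-1..1}" using hi by blast
  have z: "integral {-1..1} k = 0"
    using k unfolding orth_kernel_def by (auto dest!: spec[of _ "1::real poly"])
  have "integral {-1..c} k + integral {c..1} k = integral {-1..1} k"
    using c ki by (intro Henstock_Kurzweil_Integration.integral_combine) auto
  then have i1: "integral {-1..c} k = - tail_integral k c" using z by (simp add: tail_integral_def)
  have "\<bar>integral {-1..1} (\<lambda>x. g x * k x)\<bar> = \<bar>g (-1) * - tail_integral k c + g 1 * tail_integral k c\<bar>"
    using hi i1 by (simp add: integral_unique tail_integral_def)
  also have "\<dots> \<le> \<bar>g (-1)\<bar> * \<bar>tail_integral k c\<bar> + \<bar>g 1\<bar> * \<bar>tail_integral k c\<bar>"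
    by (rule order_trans[OF abs_triangle_ineq]) (simp add: abs_mult)
  also have "\<dots> \<le> \<bar>g (-1)\<bar> * T + \<bar>g 1\<bar> * T"
    using tb[OF c] by (intro add_mono mult_left_mono) auto
  finally show "\<bar>integral {-1..1} (\<lambda>x. g x * k x)\<bar> \<le> (\<bar>g (-1)\<bar> + \<bar>g 1\<bar>) * T" by (simp add: distrib_right)
qed

text \<open>The value of \<open>G\<close> at -1 drops out because the coefficients sum to 0. The sum
  in the integrand is the Peano kernel of order 1.\<close>

lemma functional_eq_kernel_integral:
  fixes c g G :: "real \<Rightarrow> real"
  assumes Z: "finite Z" "Z \<subseteq> {-1..1}" and c0: "(\<Sum>z\<in>Z. c z) = 0"
    and g: "g integrable_on {-1..1}"
    and G: "\<And>t. t \<in> {-1..1} \<Longrightarrow> G t - G (-1) = integral {-1..t} g"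
  shows "((\<lambda>x. g x * (\<Sum>z\<in>Z. c z * of_bool (x \<le> z))) has_integral (\<Sum>z\<in>Z. c z * G z)) {-1..1}"
proof -
  have "((\<lambda>x. \<Sum>z\<in>Z. c z * (of_bool (x \<le> z) * g x)) has_integral (\<Sum>z\<in>Z. c z * integral {-1..z} g)) {-1..1}"
    using Z by (intro has_integral_sum has_integral_mult_right integrable_step_mult_left[OF g]) auto
  moreover have "(\<Sum>z\<in>Z. c z * integral {-1..z} g) = (\<Sum>z\<in>Z. c z * G z) - (\<Sum>z\<in>Z. c z) * G (-1)"
    using Z by (auto simp: sum_distrib_right sum_subtractf[symmetric] right_diff_distrib[symmetric] G
      intro!: sum.cong)
  ultimately show ?thesis using c0 by (simp add: sum_distrib_left mult_ac)
qed

text \<open>Integrating \<open>p\<close> against the kernel applies the functional to an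
  antiderivative of \<open>p\<close>, hence \<open>n - 1\<close> in place of \<open>n\<close>. The
  value of the kernel at \<open>y\<close> is the functional applied to the step at \<open>y\<close>,
  which is what \<open>M\<close> bounds.\<close>

lemma functional_kernel_orth:
  assumes Z: "finite Z" "Z \<subseteq> {-1..1}" and n: "n \<ge> 1"
    and zero: "\<And>p. degree p \<le> n \<Longrightarrow> (\<Sum>z\<in>Z. c z * poly p z) = 0"
    and M: "\<And>y. y \<in> {-1..1} \<Longrightarrow> \<bar>\<Sum>z\<in>{z\<in>Z. y \<le> z}. c z\<bar> \<le> M"
  shows "orth_kernel (n - 1) M (\<lambda>x. \<Sum>z\<in>Z. c z * of_bool (x \<le> z))"
  unfolding orth_kernel_def
proof (intro conjI ballI allI impI)
  have c0: "(\<Sum>z\<in>Z. c z) = 0" using zero[of 1] by simp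
  have *: "((\<lambda>x. poly p x * (\<Sum>z\<in>Z. c z * of_bool (x \<le> z))) has_integral (\<Sum>z\<in>Z. c z * poly P z)) {-1..1}"
    if "pderiv P = p" for p P
  proof (rule functional_eq_kernel_integral[OF Z c0])
    show "poly p integrable_on {-1..1}" by (intro integrable_continuous_real continuous_intros)
    show "poly P t - poly P (-1) = integral {-1..t} (poly p)" if "t \<in> {-1..1}" for t
      using poly_diff_eq_integral[of "-1" t P] that \<open>pderiv P = p\<close> by simp
  qed
  show "(\<lambda>x. \<Sum>z\<in>Z. c z * of_bool (x \<le> z)) integrable_on {-1..1}"
    using *[of "[:0, 1:]" 1] by (auto simp: pderiv_pCons one_pCons)
  show "\<bar>\<Sum>z\<in>Z. c z * of_bool (x \<le> z)\<bar> \<le> M" if "x \<in> {-1..1}" for x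
  proof -
    have "(\<Sum>z\<in>Z. c z * of_bool (x \<le> z)) = (\<Sum>z\<in>{z\<in>Z. x \<le> z}. c z)"
      using Z by (intro sum.mono_neutral_cong_right) auto
    then show ?thesis using M[OF that] by simp
  qed
  fix p :: "real poly" assume p: "degree p \<le> n - 1"
  obtain P where P: "pderiv P = p" "degree P \<le> Suc (degree p)" by (rule poly_antiderivative_exists)
  have "degree P \<le> n" using P p n by linarith
  then show "integral {-1..1} (\<lambda>x. poly p x * (\<Sum>z\<in>Z. c z * of_bool (x \<le> z))) = 0"
    using *[OF P(1)] zero by (simp add: integral_unique)
qed

text \<open>The Peano kernel of order \<open>s + 1\<close> is the \<open>s\<close>-fold tail integral of the kernel of order 1.\<close>

lemma functional_bound:
  fixes D :: "nat \<Rightarrow> real \<Rightarrow> real" and g :: "real \<Rightarrow> real"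
  assumes r: "r \<ge> 1"
    and D_Suc: "\<And>k t. k < r - 1 \<Longrightarrow> t \<in> {-1..1} \<Longrightarrow>
                  (D k has_real_derivative D (Suc k) t) (at t within {-1..1})"
    and g: "g integrable_on {-1..1}" and bv: "bounded_variation_on {-1..1} g"
    and last: "\<And>t. t \<in> {-1..1} \<Longrightarrow> D (r - 1) t = D (r - 1) (-1) + integral {-1..t} g"
  shows "\<exists>C. \<forall>n\<ge>r+1. \<forall>Z c M. finite Z \<longrightarrow> Z \<subseteq> {-1..1} \<longrightarrow>
     (\<forall>p. degree p \<le> n \<longrightarrow> (\<Sum>z\<in>Z. c z * poly p z) = 0) \<longrightarrow>
     (\<forall>y\<in>{-1..1}. \<bar>\<Sum>z\<in>{z\<in>Z. y \<le> z}. c z\<bar> \<le> M) \<longrightarrow>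
     \<bar>\<Sum>z\<in>Z. c z * D 0 z\<bar> \<le> C * M * (1 / real n) ^ r"
proof -
  obtain g1 g2 where g12: "mono_on {-1..1} g1" "mono_on {-1..1} g2" "\<And>x. x \<in> {-1..1} \<Longrightarrow> g x = g1 x - g2 x"
    using bounded_variation_decomposition[OF bv] by blast
  \<comment> \<open>Bounds \<open>g\<close> itself and collects the endpoint values that the second
    mean value theorem produces for \<open>g1\<close> and \<open>g2\<close>.\<close>
  define W where "W = (\<bar>g1 (-1)\<bar> + \<bar>g1 1\<bar>) + (\<bar>g2 (-1)\<bar> + \<bar>g2 1\<bar>)"
  have gW: "\<bar>g x\<bar> \<le> W" if x: "x \<in> {-1..1}" for x
  proof -
    have "g1 (-1) \<le> g1 x" "g1 x \<le> g1 1" "g2 (-1) \<le> g2 x" "g2 x \<le> g2 1"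
      using g12(1,2) x by (auto simp: mono_on_def)
    then show ?thesis unfolding g12(3)[OF x] W_def by linarith
  qed
  \<comment> \<open>Continues the list of derivatives by \<open>g\<close> as the \<open>r\<close>-th
    one, so that the last integration by parts is treated like the others.\<close>
  define E where "E i = (if i < r then D i else g)" for i
  have contD: "continuous_on {-1..1} (D i)" if "i < r" for i
  proof (cases "i < r - 1")
    case True
    then show ?thesis using D_Suc by (intro DERIV_continuous_on) auto
  next
    case False
    then have i: "i = r - 1" using that by simp
    have "continuous_on {-1..1} (\<lambda>t. D (r - 1) (-1) + integral {-1..t} g)"
      by (intro continuous_intros indefinite_integral_continuous_1 g)
    then show ?thesis unfolding i by (rule continuous_on_eq) (rule last[symmetric])
  qed
  have Eint: "E i integrable_on {-1..1}" for i
    using contD g integrable_continuous_real by (auto simp: E_def)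
  have Ebd: "\<exists>B. \<forall>x\<in>{-1..1}. \<bar>E i x\<bar> \<le> B" for i
  proof (cases "i < r")
    case True
    have "bounded (D i ` {-1..1})" by (intro compact_imp_bounded compact_continuous_image contD True) simp
    then show ?thesis using True by (auto simp: E_def bounded_iff)
  qed (use gW in \<open>auto simp: E_def intro!: exI[of _ W]\<close>)
  have Ediff: "E i t - E i s = integral {s..t} (E (Suc i))" if "i < r" "-1 \<le> s" "s \<le> t" "t \<le> 1" for i s t
  proof (cases "i < r - 1")
    case True
    then have e: "E i = D i" "E (Suc i) = D (Suc i)" by (auto simp: E_def)
    have "(D (Suc i) has_integral (D i t - D i s)) {s..t}"
    proof (rule fundamental_theorem_of_calculus)
      fix x assume x: "x \<in> {s..t}"
      have "(D i has_real_derivative D (Suc i) x) (at x within {s..t})"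
        by (rule DERIV_subset[OF D_Suc]) (use True x that in auto)
      then show "(D i has_vector_derivative D (Suc i) x) (at x within {s..t})"
        by (simp add: has_real_derivative_iff_has_vector_derivative)
    qed (use that in simp)
    then show ?thesis unfolding e by (simp add: integral_unique)
  next
    case False
    then have i: "i = r - 1" using that by simp
    then have e: "E i = D (r - 1)" "E (Suc i) = g" using r by (auto simp: E_def)
    have "integral {-1..s} g + integral {s..t} g = integral {-1..t} g"
      by (rule Henstock_Kurzweil_Integration.integral_combine)
         (use that in \<open>auto intro: integrable_on_subinterval[OF g]\<close>)
    then show ?thesis unfolding e using last[of s] last[of t] that by auto
  qed
  obtain C where iter: "\<And>n M k s. n \<ge> r + 1 \<Longrightarrow> orth_kernel (n - 1) M k \<Longrightarrow> s \<le> r \<Longrightarrow>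
     orth_kernel (n - 1 - s) (M * (C / real n) ^ s) ((tail_integral ^^ s) k)"
    using iterated_tail_integral[of r] by blast
  show ?thesis
  proof (intro exI[of _ "W * C ^ r"] allI impI)
    fix n :: nat and Z :: "real set" and c :: "real \<Rightarrow> real" and M :: real
    assume n: "n \<ge> r + 1" and Z: "finite Z" "Z \<subseteq> {-1..1}"
      and zero: "\<forall>p. degree p \<le> n \<longrightarrow> (\<Sum>z\<in>Z. c z * poly p z) = 0"
      and M: "\<forall>y\<in>{-1..1}. \<bar>\<Sum>z\<in>{z\<in>Z. y \<le> z}. c z\<bar> \<le> M"
    define k where "k x = (\<Sum>z\<in>Z. c z * of_bool (x \<le> z))" for x
    have k: "orth_kernel (n - 1) M k"
      unfolding k_def using functional_kernel_orth[OF Z, of n c M] zero M n r by auto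
    note it = iter[OF n k]
    have "(\<Sum>z\<in>Z. c z * D 0 z) = integral {-1..1} (\<lambda>x. E (Suc s) x * (tail_integral ^^ s) k x)"
      if "s < r" for s
      using that
    proof (induction s)
      case 0
      have c0: "(\<Sum>z\<in>Z. c z) = 0" using zero[rule_format, of 1] by simp
      have "((\<lambda>x. E 1 x * (\<Sum>z\<in>Z. c z * of_bool (x \<le> z))) has_integral (\<Sum>z\<in>Z. c z * E 0 z)) {-1..1}"
        by (rule functional_eq_kernel_integral[OF Z c0 Eint]) (use Ediff[of 0 "-1"] r in auto)
      then show ?case using r by (simp add: integral_unique E_def k_def[symmetric])
    next
      case (Suc s)
      obtain B where B: "\<And>x. x \<in> {-1..1} \<Longrightarrow> \<bar>E (Suc (Suc s)) x\<bar> \<le> B" using Ebd by blast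
      have ok: "orth_kernel (n - 1 - s) (M * (C / real n) ^ s) ((tail_integral ^^ s) k)"
        using it[of s] Suc by simp
      have "integral {-1..1} (\<lambda>x. E (Suc (Suc s)) x * tail_integral ((tail_integral ^^ s) k) x) =
          integral {-1..1} (\<lambda>x. E (Suc s) x * (tail_integral ^^ s) k x)"
        by (rule tail_integral_by_parts(1)[OF ok Eint B Ediff]) (use Suc in auto)
      then show ?case using Suc by simp
    qed
    from this[of "r - 1"] have rep: "(\<Sum>z\<in>Z. c z * D 0 z)
      = integral {-1..1} (\<lambda>x. g x * (tail_integral ^^ (r - 1)) k x)"
      using r by (simp add: E_def)
    \<comment> \<open>The bound for the \<open>r\<close>-th tail integral. The kernel in
      \<open>rep\<close> is only the \<open>(r - 1)\<close>-st; the second mean value theorem brings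
      in the next one.\<close>
    define T where "T = M * (C / real n) ^ r"
    define \<kappa> where "\<kappa> = (tail_integral ^^ (r - 1)) k"
    have \<kappa>: "orth_kernel (n - 1 - (r - 1)) (M * (C / real n) ^ (r - 1)) \<kappa>" using it[of "r - 1"] by
      (simp add: \<kappa>_def)
    have tk: "tail_integral \<kappa> = (tail_integral ^^ r) k" using r by (cases r) (auto simp: \<kappa>_def)
    have tb: "\<bar>tail_integral \<kappa> y\<bar> \<le> T" if "y \<in> {-1..1}" for y
      using it[of r] that unfolding tk T_def orth_kernel_def by auto
    note m1 = mono_mult_orth_kernel[OF g12(1) \<kappa> tb] and m2 = mono_mult_orth_kernel[OF g12(2) \<kappa> tb]
    have "integral {-1..1} (\<lambda>x. g x * \<kappa> x) = integral {-1..1} (\<lambda>x. g1 x * \<kappa> x - g2 x * \<kappa> x)"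
      by (rule integral_cong) (simp add: g12(3) left_diff_distrib)
    also have "\<dots> = integral {-1..1} (\<lambda>x. g1 x * \<kappa> x) - integral {-1..1} (\<lambda>x. g2 x * \<kappa> x)"
      by (rule integral_diff[OF m1(1) m2(1)])
    finally have "\<bar>\<Sum>z\<in>Z. c z * D 0 z\<bar> \<le> (\<bar>g1 (-1)\<bar> + \<bar>g1 1\<bar>) * T + (\<bar>g2 (-1)\<bar> + \<bar>g2 1\<bar>) * T"
      using m1(2) m2(2) unfolding rep \<kappa>_def[symmetric] by linarith
    also have "\<dots> = W * T" by (simp add: W_def distrib_right)
    also have "\<dots> = W * C ^ r * M * (1 / real n) ^ r" by (simp add: T_def power_divide)
    finally show "\<bar>\<Sum>z\<in>Z. c z * D 0 z\<bar> \<le> W * C ^ r * M * (1 / real n) ^ r" .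
  qed
qed

section \<open>The interpolation error\<close>

text \<open>The eigenvalue and \<open>n\<^sup>2\<close> are comparable, and the five conditions on
  \<sigma> correspond one by one to the five terms of \<open>lagr_growth\<close>.\<close>

lemma lagr_growth_jacobi_eigenvalue_le:
  assumes ab: "\<alpha> > -1" "\<beta> > -1"
    and \<sigma>: "0 \<le> \<sigma>" "- (\<alpha> + 1/2) \<le> \<sigma>" "\<beta> - 1/2 \<le> \<sigma>" "\<alpha> - 5/2 \<le> \<sigma>" "\<beta> - \<alpha> \<le> \<sigma>"
  shows "\<exists>C\<ge>0. \<forall>n\<ge>2. lagr_growth (\<alpha> + 1/2) (\<beta> + 1/2) (jacobi_eigenvalue \<alpha> \<beta> n) \<le> C * (real n powr \<sigma>)\<^sup>2"
proof -
  define q where "q = \<bar>\<alpha> + \<beta> + 1\<bar>"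
  define K where "K = 2 + q"
  define E where "E = \<bar>\<alpha>\<bar> + \<bar>\<beta>\<bar> + 3"
  have q: "q \<ge> 0" "\<alpha> + \<beta> + 1 \<le> q" by (auto simp: q_def)
  then have K: "K \<ge> 2" by (simp add: K_def)
  have main: "jacobi_eigenvalue \<alpha> \<beta> n powr e \<le> K powr E * (real n powr \<sigma>)\<^sup>2"
    if n: "n \<ge> 2" and e: "e \<le> \<sigma>" "\<bar>e\<bar> \<le> E" for n e
  proof -
    let ?m = "jacobi_eigenvalue \<alpha> \<beta> n"
    have n2: "real n \<ge> 2" using n by simp
    have "?m \<le> real n * (K * real n)"
      unfolding jacobi_eigenvalue_def
    proof (rule mult_left_mono)
      have "q * 1 \<le> q * real n" using n2 q by (intro mult_left_mono) auto
      moreover have "K * real n = 2 * real n + q * real n" by (simp add: K_def distrib_right)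
      ultimately show "real n + \<alpha> + \<beta> + 1 \<le> K * real n" using n2 q by linarith
    qed simp
    then have up: "?m \<le> K * (real n)\<^sup>2" by (simp add: power2_eq_square mult_ac)
    have "(real n)\<^sup>2 = real n * real n" by (simp add: power2_eq_square)
    also have "\<dots> \<le> real n * (2 * (real n + \<alpha> + \<beta> + 1))" using n2 ab by (intro mult_left_mono) auto
    also have "\<dots> = 2 * ?m" by (simp add: jacobi_eigenvalue_def)
    also have "\<dots> \<le> K * ?m" using K jacobi_eigenvalue_ge[OF ab n] by (intro mult_right_mono) auto
    finally have lo: "(real n)\<^sup>2 \<le> K * ?m" .
    have "?m powr e \<le> K powr \<bar>e\<bar> * ((real n)\<^sup>2) powr e"
      using jacobi_eigenvalue_ge[OF ab n] n2 by (intro powr_le_of_ratio up lo) auto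
    also have "\<dots> \<le> K powr E * ((real n)\<^sup>2) powr \<sigma>"
      using K n2 e by (intro mult_mono powr_mono) (auto simp: one_le_power)
    also have "((real n)\<^sup>2) powr \<sigma> = (real n powr \<sigma>)\<^sup>2"
      using n2 by (simp add: power2_eq_square powr_mult)
    finally show ?thesis .
  qed
  show ?thesis
  proof (intro exI[of _ "1 + 4 * K powr E"] conjI allI impI)
    fix n :: nat assume n: "n \<ge> 2"
    have "1 \<le> real n powr \<sigma>" using n \<sigma> by (intro ge_one_powr_ge_zero) auto
    then have "1 \<le> (real n powr \<sigma>)\<^sup>2" by (simp add: one_le_power)
    moreover have "\<bar>- (\<alpha> + 1/2)\<bar> \<le> E" "\<bar>\<beta> + 1/2 - 1\<bar> \<le> E" "\<bar>\<alpha> + 1/2 - 3\<bar> \<le> E"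
      "\<bar>\<beta> + 1/2 - (\<alpha> + 1/2)\<bar> \<le> E" unfolding E_def by linarith+
    note main[OF n _ this(1)] main[OF n _ this(2)] main[OF n _ this(3)] main[OF n _ this(4)]
    ultimately show "lagr_growth (\<alpha> + 1/2) (\<beta> + 1/2) (jacobi_eigenvalue \<alpha> \<beta> n) \<le> (1
      + 4 * K powr E) * (real n powr \<sigma>)\<^sup>2"
      using \<sigma> unfolding lagr_growth_def by (simp add: distrib_right)
  qed simp
qed

lemma lagr_interpolation:
  assumes X: "finite X" "card X = n + 1"
  shows "degree p \<le> n \<Longrightarrow> (\<Sum>b\<in>X. lagr X b x * poly p b) = poly p x"
    and "poly (interp_poly n X f) x = (\<Sum>b\<in>X. lagr X b x * f b)"
proof -
  have "\<forall>b\<in>X. \<exists>L. degree L \<le> card X - 1 \<and> (\<forall>x. poly L x = lagr X b x)" using lagr_poly[OF X(1)] by metis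
  then obtain L where L: "\<And>b. b \<in> X \<Longrightarrow> degree (L b) \<le> n" "\<And>b x. b \<in> X \<Longrightarrow> poly (L b) x = lagr X b x"
    using X(2) by (metis add_diff_cancel_right')
  define Q where "Q h = (\<Sum>b\<in>X. smult (h b) (L b))" for h
  have Qx: "poly (Q h) x = (\<Sum>b\<in>X. lagr X b x * h b)" for h x
    unfolding Q_def using L(2) by (simp add: poly_sum mult.commute)
  have dQ: "degree (Q h) \<le> n" for h
    unfolding Q_def using L(1) by (intro degree_sum_le X order_trans[OF degree_smult_le]) auto
  have Qn: "poly (Q h) z = h z" if z: "z \<in> X" for h z
  proof -
    have "poly (Q h) z = (\<Sum>b\<in>X. of_bool (z = b) * h b)"
      unfolding Qx using lagr_node[OF _ X(1) z] by (intro sum.cong) auto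
    also have "\<dots> = h z" using z X(1) by (simp add: of_bool_def if_distrib[of "\<lambda>u. u * _"] sum.delta
      cong: if_cong)
    finally show ?thesis .
  qed
  have unique: "p = q" if "degree p \<le> n" "degree q \<le> n" "\<And>z. z \<in> X \<Longrightarrow> poly p z = poly q z" for p q
    using that X by (intro poly_eqI_degree[of X]) auto
  show "(\<Sum>b\<in>X. lagr X b x * poly p b) = poly p x" if "degree p \<le> n"
    using unique[OF dQ that, of "poly p"] Qn Qx[of "poly p" x] by simp
  have "interp_poly n X f = Q f"
    unfolding interp_poly_def using dQ Qn by (intro the_equality) (auto intro!: unique)
  then show "poly (interp_poly n X f) x = (\<Sum>b\<in>X. lagr X b x * f b)" by (simp add: Qx)
qed

text \<open>The free exponent \<sigma>, any common upper bound of those in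
  \<open>lagr_growth\<close>, lets one estimate serve all claims of the theorem.\<close>

lemma interp_error_bound:
  fixes D :: "nat \<Rightarrow> real \<Rightarrow> real" and g :: "real \<Rightarrow> real"
  assumes ab: "\<alpha> > -1" "\<beta> > -1" and r: "r \<ge> 1"
    and D_Suc: "\<And>k t. k < r - 1 \<Longrightarrow> t \<in> {-1..1} \<Longrightarrow>
                  (D k has_real_derivative D (Suc k) t) (at t within {-1..1})"
    and g: "g integrable_on {-1..1}" and bv: "bounded_variation_on {-1..1} g"
    and last: "\<And>t. t \<in> {-1..1} \<Longrightarrow> D (r - 1) t = D (r - 1) (-1) + integral {-1..t} g"
    and \<sigma>: "0 \<le> \<sigma>" "- (\<alpha> + 1/2) \<le> \<sigma>" "\<beta> - 1/2 \<le> \<sigma>" "\<alpha> - 5/2 \<le> \<sigma>" "\<beta> - \<alpha> \<le> \<sigma>"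
  shows "\<exists>C. \<forall>n\<ge>r+1. sup_norm (interp_error \<alpha> \<beta> n (D 0)) \<le> real n powr (- real r) * (C * real n powr \<sigma>)"
proof -
  have "\<exists>C0. \<forall>n\<ge>r+1. \<forall>Z c M. finite Z \<longrightarrow> Z \<subseteq> {-1..1} \<longrightarrow>
     (\<forall>p. degree p \<le> n \<longrightarrow> (\<Sum>z\<in>Z. c z * poly p z) = 0) \<longrightarrow>
     (\<forall>y\<in>{-1..1}. \<bar>\<Sum>z\<in>{z\<in>Z. y \<le> z}. c z\<bar> \<le> M) \<longrightarrow>
     \<bar>\<Sum>z\<in>Z. c z * D 0 z\<bar> \<le> C0 * M * (1 / real n) ^ r"
    by (rule functional_bound[OF r D_Suc g bv last])
  then obtain C0 where fb0: "\<forall>n\<ge>r+1. \<forall>Z c M. finite Z \<longrightarrow> Z \<subseteq> {-1..1} \<longrightarrow>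
     (\<forall>p. degree p \<le> n \<longrightarrow> (\<Sum>z\<in>Z. c z * poly p z) = 0) \<longrightarrow>
     (\<forall>y\<in>{-1..1}. \<bar>\<Sum>z\<in>{z\<in>Z. y \<le> z}. c z\<bar> \<le> M) \<longrightarrow>
     \<bar>\<Sum>z\<in>Z. c z * D 0 z\<bar> \<le> C0 * M * (1 / real n) ^ r" ..
  note fb = fb0[rule_format]
  obtain C1 where C1: "C1 > 0" and lb: "\<And>n b x. n \<ge> 2 \<Longrightarrow> b \<in> jacobi_nodes \<alpha> \<beta> n \<Longrightarrow> x \<in> {-1..1} \<Longrightarrow>
     (lagr (jacobi_nodes \<alpha> \<beta> n) b x)\<^sup>2 \<le> C1 * lagr_growth (\<alpha> + 1/2) (\<beta> + 1/2) (jacobi_eigenvalue \<alpha> \<beta> n)"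
    using jacobi_lagr_bound[OF ab] by blast
  obtain C2 where C2: "C2 \<ge> 0" and gb: "\<And>n. n \<ge> 2 \<Longrightarrow>
     lagr_growth (\<alpha> + 1/2) (\<beta> + 1/2) (jacobi_eigenvalue \<alpha> \<beta> n) \<le> C2 * (real n powr \<sigma>)\<^sup>2"
    using lagr_growth_jacobi_eigenvalue_le[OF ab \<sigma>] by blast
  \<comment> \<open>The fundamental polynomials were bounded in square, and \<open>B\<^sup>2\<close>
    exceeds \<open>C1 * C2\<close>. Being at least 1, \<open>B\<close> also covers the alternative
    in which the error of the step is only bounded by 1.\<close>
  define B where "B = 1 + C1 * C2"
  have B1: "B \<ge> 1" using C1 C2 by (simp add: B_def)
  have "sup_norm (interp_error \<alpha> \<beta> n (D 0)) \<le> real n powr (- real r) * ((C0 * B) * real n powr \<sigma>)"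
    if n: "n \<ge> r + 1" for n
  proof -
    have n2: "n \<ge> 2" using n r by simp
    define X where "X = jacobi_nodes \<alpha> \<beta> n"
    define M where "M = B * real n powr \<sigma>"
    note st = jacobi_nodes_structure[OF ab n2, folded X_def]
    have Xsub: "X \<subseteq> {-1..1}" using st(3,4) by force
    have n\<sigma>: "1 \<le> real n powr \<sigma>" using n2 \<sigma> by (intro ge_one_powr_ge_zero) auto
    have "1 * 1 \<le> B * real n powr \<sigma>" using n\<sigma> B1 by (intro mult_mono) auto
    then have M1: "1 \<le> M" by (simp add: M_def)
    have lM: "\<bar>lagr X b x\<bar> \<le> M" if b: "b \<in> X" and x: "x \<in> {-1..1}" for b x
    proof -
      have "(lagr X b x)\<^sup>2 \<le> C1 * (C2 * (real n powr \<sigma>)\<^sup>2)"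
        using lb[OF n2 b[unfolded X_def] x] gb[OF n2] C1 unfolding X_def
          by (meson less_imp_le mult_left_mono order_trans)
      also have "\<dots> = (C1 * C2) * (real n powr \<sigma>)\<^sup>2" by simp
      also have "\<dots> \<le> B\<^sup>2 * (real n powr \<sigma>)\<^sup>2"
      proof (rule mult_right_mono)
        have "C1 * C2 \<le> B * 1" by (simp add: B_def)
        also have "\<dots> \<le> B * B" using B1 by (intro mult_left_mono) auto
        finally show "C1 * C2 \<le> B\<^sup>2" by (simp add: power2_eq_square)
      qed simp
      also have "\<dots> = M\<^sup>2" by (simp add: M_def power_mult_distrib)
      finally show ?thesis using M1 by (simp add: abs_le_square_iff[symmetric])
    qed
    have "\<bar>interp_error \<alpha> \<beta> n (D 0) x\<bar> \<le> C0 * M * (1 / real n) ^ r" if x: "x \<in> {-1..1}" for x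
    proof -
      \<comment> \<open>Written as a difference, so that the two contributions to the coefficient at
        \<open>x\<close> simply add up when \<open>x\<close> is itself a node.\<close>
      define c where "c z = of_bool (z = x) - (if z \<in> X then lagr X z x else 0)" for z
      have csum: "(\<Sum>z\<in>{z\<in>insert x X. P z}. c z * h z)
        = of_bool (P x) * h x - (\<Sum>z\<in>{z\<in>X. P z}. lagr X z x * h z)" for P h
      proof -
        have "(\<Sum>z\<in>{z\<in>insert x X. P z}. c z * h z) =
            (\<Sum>z\<in>{z\<in>insert x X. P z}. of_bool (z = x) * h z) - (\<Sum>z\<in>{z\<in>insert x X. P z}. (if z
              \<in> X then lagr X z x else 0) * h z)"
          by (simp add: c_def left_diff_distrib sum_subtractf)
        also have "(\<Sum>z\<in>{z\<in>insert x X. P z}. of_bool (z = x) * h z) = (\<Sum>z\<in>{x} \<inter> {z. P z}. h z)"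
          using st(1) by (intro sum.mono_neutral_cong_right) auto
        also have "\<dots> = of_bool (P x) * h x" by auto
        also have "(\<Sum>z\<in>{z\<in>insert x X. P z}. (if z \<in> X then lagr X z x else 0) * h z)
          = (\<Sum>z\<in>{z\<in>X. P z}. lagr X z x * h z)"
          using st(1) by (intro sum.mono_neutral_cong_right) auto
        finally show ?thesis .
      qed
      have csum0: "(\<Sum>z\<in>insert x X. c z * h z) = h x - (\<Sum>z\<in>X. lagr X z x * h z)" for h
        using csum[where P = "\<lambda>_. True" and h = h] by (simp only: simp_thms Collect_mem_eq of_bool_eq mult_1)
      have "interp_error \<alpha> \<beta> n (D 0) x = (\<Sum>z\<in>insert x X. c z * D 0 z)"
        using csum0[of "D 0"] lagr_interpolation(2)[OF st(1,2), of "D 0" x] by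
          (simp add: interp_error_def X_def)
      moreover have "\<bar>\<Sum>z\<in>insert x X. c z * D 0 z\<bar> \<le> C0 * M * (1 / real n) ^ r"
      proof (rule fb[OF n])
        show "finite (insert x X)" "insert x X \<subseteq> {-1..1}" using st(1) Xsub x by auto
        show "(\<Sum>z\<in>insert x X. c z * poly p z) = 0" if "degree p \<le> n" for p
          using csum0[of "poly p"] lagr_interpolation(1)[OF st(1,2) that, of x] by simp
        fix y :: real
        have "(\<Sum>z\<in>{z\<in>insert x X. y \<le> z}. c z) = of_bool (y \<le> x) - (\<Sum>b\<in>{b\<in>X. y \<le> b}. lagr X b x)"
          using csum[where P = "\<lambda>z. y \<le> z" and h = "\<lambda>_. 1"] by simp
        then show "\<bar>\<Sum>z\<in>{z\<in>insert x X. y \<le> z}. c z\<bar> \<le> M"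
          using step_interpolation_error[OF st(1), of y x] lM[OF _ x] M1 by force
      qed
      ultimately show ?thesis by simp
    qed
    then have "sup_norm (interp_error \<alpha> \<beta> n (D 0)) \<le> C0 * M * (1 / real n) ^ r"
      unfolding sup_norm_def by (intro cSUP_least) auto
    also have "\<dots> = real n powr (- real r) * ((C0 * B) * real n powr \<sigma>)"
      using n2 by (simp add: M_def powr_minus_divide powr_realpow power_divide)
    finally show ?thesis .
  qed
  then show ?thesis by blast
qed

theorem theorem4p6:
  fixes \<alpha> \<beta> :: real and r :: nat and f g :: "real \<Rightarrow> real" and D :: "nat \<Rightarrow> real \<Rightarrow> real"
  assumes "\<alpha> > -1" and "\<beta> > -1" and "r \<ge> 1"
    and D_0: "D 0 = f"
    and D_Suc: "\<And>k t. k < r - 1 \<Longrightarrow> t \<in> {-1..1} \<Longrightarrow>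
                  (D k has_real_derivative D (Suc k) t) (at t within {-1..1})"
    and "abs_continuous_on {-1..1} (D (r - 1))"
    and "g absolutely_integrable_on {-1..1}"
    and "bounded_variation_on {-1..1} g"
    and "\<And>t. t \<in> {-1..1} \<Longrightarrow> D (r - 1) t = D (r - 1) (-1) + integral {-1..t} g"
  shows "(\<alpha> \<le> 1/2 \<longrightarrow>
           (\<exists>C. \<forall>n\<ge>r+1. sup_norm (interp_error \<alpha> \<beta> n f) \<le>
              real n powr (- real r) * (C * real n powr (- Min {0, \<alpha> + 1/2, \<alpha> - \<beta>}))))
       \<and> (\<alpha> > 1/2 \<longrightarrow>
           (\<exists>C. \<forall>n\<ge>r+1. sup_norm (interp_error \<alpha> \<beta> n f) \<le>
              real n powr (- real r) * (C * real n powr (- Min {0, 1/2 - \<beta>, 5/2 - \<alpha>, \<alpha> - \<beta>}))))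
       \<and> ((\<alpha>, \<beta>) \<in> S_bar \<longrightarrow>
           (\<exists>C. \<forall>n\<ge>r+1. sup_norm (interp_error \<alpha> \<beta> n f) \<le> C * real n powr (- real r)))"
proof -
  have g: "g integrable_on {-1..1}" using assms(7) absolutely_integrable_on_def by blast
  note bound = interp_error_bound[OF assms(1,2,3) D_Suc g assms(8,9), unfolded D_0]
  show ?thesis
  proof (intro conjI impI)
    assume "\<alpha> \<le> 1/2"
    \<comment> \<open>From \<open>\<alpha> \<le> 1/2\<close> it follows that
      \<open>\<beta> - 1/2 \<le> \<beta> - \<alpha>\<close> and
      \<open>\<alpha> - 5/2 < 0\<close>.\<close>
    then show "\<exists>C. \<forall>n\<ge>r+1. sup_norm (interp_error \<alpha> \<beta> n f) \<le>
        real n powr (- real r) * (C * real n powr (- Min {0, \<alpha> + 1/2, \<alpha> - \<beta>}))"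
      by (intro bound) (auto simp: min_def)
  next
    assume "\<alpha> > 1/2"
    \<comment> \<open>Here it is \<open>- (\<alpha> + 1/2)\<close> that is negative.\<close>
    then show "\<exists>C. \<forall>n\<ge>r+1. sup_norm (interp_error \<alpha> \<beta> n f) \<le>
        real n powr (- real r) * (C * real n powr (- Min {0, 1/2 - \<beta>, 5/2 - \<alpha>, \<alpha> - \<beta>}))"
      by (intro bound) (auto simp: min_def)
  next
    assume S: "(\<alpha>, \<beta>) \<in> S_bar"
    \<comment> \<open>On this set no exponent is positive: for \<open>\<alpha> \<le> 1/2\<close> the
      removed part forces \<open>\<beta> \<le> \<alpha>\<close>, and otherwise
      \<open>\<beta> \<le> 1/2 < \<alpha>\<close>.\<close>
    have "\<exists>C. \<forall>n\<ge>r+1. sup_norm (interp_error \<alpha> \<beta> n f) \<le> real n powr (- real r) * (C * real n powr 0)"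
      using S by (intro bound) (auto simp: S_bar_def)
    then obtain C where "\<forall>n\<ge>r+1. sup_norm (interp_error \<alpha> \<beta> n f)
      \<le> real n powr (- real r) * (C * real n powr 0)" by blast
    then have "\<forall>n\<ge>r+1. sup_norm (interp_error \<alpha> \<beta> n f) \<le> C * real n powr (- real r)"
      by (auto simp: mult.commute)
    then show "\<exists>C. \<forall>n\<ge>r+1. sup_norm (interp_error \<alpha> \<beta> n f) \<le> C * real n powr (- real r)" by blast
  qed
qed

end
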